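(* Let $\mathrm{L}$ be a relational first order signature and let $\{\psi_i : i\in I\}$ be a finitely conservative family of $\mathrm{L}_{\infty\infty}$-sentences. Then $\bigwedge_{i\in I}\psi_i$ is Boolean consistent, and it is a conservative strengthening of $\bigwedge_{i\in u}\psi_i$ for every non-empty finite $u\subseteq I$. Furthermore, if each $\psi_i$ is an $\mathrm{L}_{\infty\omega}$-sentence, then $\bigwedge_{i\in I}\psi_i$ has a mixing model, i.e. there are a complete Boolean algebra $\mathsf{B}$ and a $\mathsf{B}$-valued model $\mathcal{M}$ with the mixing property such that $[\![\bigwedge_{i\in I}\psi_i]\!]^{\mathcal{M}}_{\mathsf{B}}=1_{\mathsf{B}}$.
   Context: **Infinitary logics.** A relational first order signature $\mathrm{L}$ consists of relation symbols of finite arity and constant symbols; $\mathcal{D}$ denotes its set of constants. Given cardinals $\kappa,\lambda$ and variables $\{v_\alpha:\alpha<\kappa\}$, the $\mathrm{L}_{\kappa\lambda}$-formulae are built from atomic formulae (including equalities) by: negation $\neg\phi$; $\bigwedge\Phi$ and $\bigvee\Phi$ for sets $\Phi$ of fewer than $\kappa$ formulae whose free variables all lie in a common set of fewer than $\lambda$ variables; $\forall V\phi$ and $\exists V\phi$ for sets $V$ of fewer than $\lambda$ variables. $\mathrm{L}_{\infty\lambda}=\bigcup_\kappa \mathrm{L}_{\kappa\lambda}$ and $\mathrm{L}_{\infty\infty}=\bigcup_{\kappa,\lambda}\mathrm{L}_{\kappa\lambda}$. A sentence is a formula without free variables; a theory is a set of sentences. **Provability.** $\Gamma\vdash\Delta$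 (for sets of $\mathrm{L}_{\infty\infty}$-formulae) means that there is a well-founded labelled tree with root $\Gamma\vdash\Delta$, whose leaves are axioms and whose other nodes are obtained from their immediate successors by a rule. Axioms: $\Gamma,\phi\vdash\phi,\Delta$; $\vdash c=c$; $c=d\vdash d=c$; $c=d,d=e\vdash c=e$; $\{u_i=t_i:i\in I\},\phi(t_i:i\in I)\vdash\phi(u_i/t_i:i\in I)$. Rules: Cut (from $\Gamma,\phi\vdash\Delta$ and $\Gamma'\vdash\phi,\Delta'$ infer $\Gamma,\Gamma'\vdash\Delta,\Delta'$); Weakening; Substitution of free variables; from $\Gamma,\Gamma'\vdash\Delta$ infer $\Gamma,\bigwedge\Gamma'\vdash\Delta$; from $\Gamma\vdash\phi_i,\Delta$ for all $i\in I$ infer $\Gamma\vdash\bigwedge_{i\in I}\phi_i,\Delta$; from $\Gamma\vdash\Delta,\Delta'$ infer $\Gamma\vdash\Delta,\bigvee\Delta'$; from $\Gamma,\phi_i\vdash\Delta$ for all $i\in I$ infer $\Gamma,\bigvee_{i\in I}\phi_i\vdash\Delta$; from $\Gamma,\phi(\bar t/\bar v)\vdash\Delta$ infer $\Gamma,\forall\bar v\,\phi\vdash\Delta$; from $\Gamma\vdash\phi(\bar v),\Delta$ infer $\Gamma\vdash\forall\bar v\,\phi,\Delta$; from $\Gamma,\phi(\bar v)\vdash\Delta$ infer $\Gamma,\exists\bar v\,\phi\vdash\Delta$; from $\Gamma\vdash\phi(\bar t/\bar v),\Delta$ infer $\Gamma\vdash\exists\bar v\,\phi,\Delta$ (in the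 right-$\forall$ and left-$\exists$ rules no variable of $\bar v$ is free in $\Gamma\cup\Delta$); and the usual left and right rules for $\neg$. $\phi\vdash\psi$ means $\{\phi\}\vdash\{\psi\}$. **Boolean valued models.** Let $\mathsf{B}$ be a complete Boolean algebra ($0\neq1$). A $\mathsf{B}$-valued model $\mathcal{M}$ for $\mathrm{L}$ is a non-empty set $M$ with a map $(\tau,\sigma)\mapsto[\![\tau=\sigma]\!]\in\mathsf{B}$ on $M^2$, a map $[\![R(\cdot)]\!]:M^n\to\mathsf{B}$ for each $n$-ary relation symbol $R$, and $c^{\mathcal M}\in M$ for each constant $c$, such that $[\![\tau=\tau]\!]=1$, $[\![\tau=\sigma]\!]=[\![\sigma=\tau]\!]$, $[\![\tau=\sigma]\!]\wedge[\![\sigma=\pi]\!]\le[\![\tau=\pi]\!]$, and $\bigwedge_{i<n}[\![\tau_i=\sigma_i]\!]\wedge[\![R(\tau_i:i<n)]\!]\le[\![R(\sigma_i:i<n)]\!]$. Values of formulae under assignments are defined recursively: $\neg,\bigwedge,\bigvee$ are interpreted by the complement, infima and suprema of $\mathsf{B}$, and $\forall V\phi$, $\exists V\phi$ by the infimum, supremum over all $\bar a\in M^V$ of the value of $\phi$ with $V\mapsto\bar a$. A set $\Gamma$ of formulae is *Boolean consistent* if there are a complete Boolean algebra $\mathsf{B}$, a $\mathsf{B}$-valued model $\mathcal{M}$ and an assignment $\nu$ with $[\![\phi]\!]^{\mathcal{M},\nu}_{\mathsf{B}}=1_{\mathsf{B}}$ for all $\phi\in\Gamma$; a formula $\phi$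 is Boolean consistent if $\{\phi\}$ is. $\mathcal{M}$ has the *mixing property* if for every antichain $A\subseteq\mathsf{B}$ and every family $\{\tau_a:a\in A\}\subseteq M$ there is $\tau\in M$ with $a\le[\![\tau=\tau_a]\!]$ for all $a\in A$. **Subsentences.** For an $\mathrm{L}_{\kappa\lambda}$-sentence $\psi$ fix a set $\mathcal{C}$ of size $\lambda$ of fresh constants (not in $\mathrm{L}$). The *subsentences* of $\psi$ are the sentences of the expanded signature $\mathrm{L}(\mathcal{C})=\mathrm{L}\cup\mathcal{C}$ obtained from a subformula $\phi(\vec x)$ of $\psi$ by substituting for its free variables $\vec x$ a string of constants in $\mathcal{D}\cup\mathcal{C}$. When several sentences are considered, $\kappa,\lambda$ are fixed large enough that all of them are in $\mathrm{L}_{\kappa\lambda}$, and a single $\mathcal{C}$ of size $\lambda$ is used. **Conservative strengthening.** For $\mathrm{L}_{\infty\infty}$-sentences $\psi_0,\psi_1$, $\psi_1$ is a *conservative strengthening* of $\psi_0$ if $\psi_1\vdash\psi_0$ and for every finite set $s$ of subsentences of $\psi_0$, $\psi_0\wedge\bigwedge s$ is Boolean consistent if and only if $\psi_1\wedge\bigwedge s$ is Boolean consistent. **Finite conservativity.** A family $\{\psi_i:i\in I\}$ of $\mathrm{L}_{\infty\infty}$-sentences is *finitely conservative* if at least one $\psi_i$ is Boolean consistent, and for all non-empty finite $u\subseteq v\subseteq I$, $\bigwedge_{i\in v}\psi_i$ is a conservative strengthening of $\bigwedge_{i\in u}\psi_i$.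
   Formalization: Subformulae are taken with negations pushed inward (as in negation normal form); literally the claim fails for {¬⋀p_n}∪{p_n}. Boolean consistency and mixing models are read inside one arbitrary, sufficiently large universe; choosing it large enough gives the absolute notions. *)

theory Defs
  imports
    Complex_Main
    "HOL-Library.FuncSet"
    "HOL-Algebra.Complete_Lattice"
begin

unbundle cardinal_syntax

section \<open>Syntax\<close>

record ('r, 'c) signature =
  rsyms :: "'r set"
  ar :: "'r \<Rightarrow> nat"
  csyms :: "'c set"

datatype ('c, 'v) trm = Var 'v | Const 'c

text \<open>
  A conjunction or disjunction of a set of formulae is stored as an indexed family: \<open>Conj J f\<close> is
  the conjunction of the set \<open>f ` J\<close>. The type \<open>'i\<close> bounds the size of the connectives; it is a
  type variable, so it may be taken as large as desired.
\<close>

datatype ('r, 'c, 'v, 'i) fm =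
    Eq "('c, 'v) trm" "('c, 'v) trm"
  | Rel 'r "('c, 'v) trm list"
  | Neg "('r, 'c, 'v, 'i) fm"
  | Conj "'i set" "'i \<Rightarrow> ('r, 'c, 'v, 'i) fm"
  | Disj "'i set" "'i \<Rightarrow> ('r, 'c, 'v, 'i) fm"
  | All "'v set" "('r, 'c, 'v, 'i) fm"
  | Ex "'v set" "('r, 'c, 'v, 'i) fm"

text \<open>
  The formula \<open>\<And>\<Phi>\<close> for a set \<open>\<Phi>\<close> of formulae with \<open>|\<Phi>| \<le> |'i|\<close>, indexed by a chosen injection of \<open>\<Phi>\<close>
  into \<open>'i\<close> (for larger \<open>\<Phi>\<close> the value is irrelevant).
\<close>

definition BigConj :: "('r, 'c, 'v, 'i) fm set \<Rightarrow> ('r, 'c, 'v, 'i) fm" where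
  "BigConj \<Phi> =
     (let e = (SOME e :: ('r, 'c, 'v, 'i) fm \<Rightarrow> 'i. inj_on e \<Phi>) in Conj (e ` \<Phi>) (inv_into \<Phi> e))"

definition And :: "('r, 'c, 'v, 'i) fm \<Rightarrow> ('r, 'c, 'v, 'i) fm \<Rightarrow> ('r, 'c, 'v, 'i) fm" where
  "And \<phi> \<psi> = BigConj {\<phi>, \<psi>}"

primrec vars_trm :: "('c, 'v) trm \<Rightarrow> 'v set" where
  "vars_trm (Var x) = {x}"
| "vars_trm (Const c) = {}"

primrec trm_in :: "('r, 'c) signature \<Rightarrow> ('c, 'v) trm \<Rightarrow> bool" where
  "trm_in L (Var x) \<longleftrightarrow> True"
| "trm_in L (Const c) \<longleftrightarrow> c \<in> csyms L"

primrec fv :: "('r, 'c, 'v, 'i) fm \<Rightarrow> 'v set" where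
  "fv (Eq s t) = vars_trm s \<union> vars_trm t"
| "fv (Rel R ts) = (\<Union>t\<in>set ts. vars_trm t)"
| "fv (Neg \<phi>) = fv \<phi>"
| "fv (Conj J f) = (\<Union>j\<in>J. fv (f j))"
| "fv (Disj J f) = (\<Union>j\<in>J. fv (f j))"
| "fv (All V \<phi>) = fv \<phi> - V"
| "fv (Ex V \<phi>) = fv \<phi> - V"

text \<open>\<open>fm_in L \<kappa> \<mu> \<phi>\<close>: \<open>\<phi>\<close> is an \<open>L\<^sub>\<kappa>\<^sub>\<mu>\<close>-formula.\<close>

primrec fm_in ::
  "('r, 'c) signature \<Rightarrow> 'k rel \<Rightarrow> 'l rel \<Rightarrow> ('r, 'c, 'v, 'i) fm \<Rightarrow> bool" where
  "fm_in L \<kappa> \<mu> (Eq s t) \<longleftrightarrow> trm_in L s \<and> trm_in L t"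
| "fm_in L \<kappa> \<mu> (Rel R ts) \<longleftrightarrow> R \<in> rsyms L \<and> length ts = ar L R \<and> (\<forall>t\<in>set ts. trm_in L t)"
| "fm_in L \<kappa> \<mu> (Neg \<phi>) \<longleftrightarrow> fm_in L \<kappa> \<mu> \<phi>"
| "fm_in L \<kappa> \<mu> (Conj J f) \<longleftrightarrow>
     |f ` J| <o \<kappa> \<and> |\<Union>j\<in>J. fv (f j)| <o \<mu> \<and> (\<forall>j\<in>J. fm_in L \<kappa> \<mu> (f j))"
| "fm_in L \<kappa> \<mu> (Disj J f) \<longleftrightarrow>
     |f ` J| <o \<kappa> \<and> |\<Union>j\<in>J. fv (f j)| <o \<mu> \<and> (\<forall>j\<in>J. fm_in L \<kappa> \<mu> (f j))"
| "fm_in L \<kappa> \<mu> (All V \<phi>) \<longleftrightarrow> |V| <o \<mu> \<and> fm_in L \<kappa> \<mu> \<phi>"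
| "fm_in L \<kappa> \<mu> (Ex V \<phi>) \<longleftrightarrow> |V| <o \<mu> \<and> fm_in L \<kappa> \<mu> \<phi>"

text \<open>
  The unions over all infinite cardinals. It suffices to let the cardinals range over power types:
  every set of formulae in a connective is smaller than \<open>'i set\<close>, every set of variables is smaller
  than \<open>'v set\<close>. The summand \<open>nat\<close> makes these types infinite.
\<close>

definition fm_inf :: "('r, 'c) signature \<Rightarrow> 'l rel \<Rightarrow> ('r, 'c, 'v, 'i) fm \<Rightarrow> bool" where
  "fm_inf L \<mu> \<phi> \<longleftrightarrow> (\<exists>\<kappa> :: ('i + nat) set rel. Cinfinite \<kappa> \<and> fm_in L \<kappa> \<mu> \<phi>)"

definition fm_inf_inf :: "('r, 'c) signature \<Rightarrow> ('r, 'c, 'v, 'i) fm \<Rightarrow> bool" where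
  "fm_inf_inf L \<phi> \<longleftrightarrow> (\<exists>\<mu> :: ('v + nat) set rel. Cinfinite \<mu> \<and> fm_inf L \<mu> \<phi>)"

definition sentence :: "('r, 'c, 'v, 'i) fm \<Rightarrow> bool" where
  "sentence \<phi> \<longleftrightarrow> fv \<phi> = {}"

text \<open>
  Simultaneous substitution of terms for free variables. It does not rename bound variables;
  \<open>free_for \<phi> \<sigma>\<close> says that no variable is captured.
\<close>

definition shield :: "'v set \<Rightarrow> ('v \<Rightarrow> ('c, 'v) trm) \<Rightarrow> 'v \<Rightarrow> ('c, 'v) trm" where
  "shield V \<sigma> = override_on \<sigma> Var V"

primrec subst_trm :: "('c, 'v) trm \<Rightarrow> ('v \<Rightarrow> ('c, 'v) trm) \<Rightarrow> ('c, 'v) trm" where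
  "subst_trm (Var x) \<sigma> = \<sigma> x"
| "subst_trm (Const c) \<sigma> = Const c"

primrec subst_fm ::
  "('r, 'c, 'v, 'i) fm \<Rightarrow> ('v \<Rightarrow> ('c, 'v) trm) \<Rightarrow> ('r, 'c, 'v, 'i) fm" where
  "subst_fm (Eq s t) \<sigma> = Eq (subst_trm s \<sigma>) (subst_trm t \<sigma>)"
| "subst_fm (Rel R ts) \<sigma> = Rel R (map (\<lambda>t. subst_trm t \<sigma>) ts)"
| "subst_fm (Neg \<phi>) \<sigma> = Neg (subst_fm \<phi> \<sigma>)"
| "subst_fm (Conj J f) \<sigma> = Conj J (\<lambda>j. subst_fm (f j) \<sigma>)"
| "subst_fm (Disj J f) \<sigma> = Disj J (\<lambda>j. subst_fm (f j) \<sigma>)"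
| "subst_fm (All V \<phi>) \<sigma> = All V (subst_fm \<phi> (shield V \<sigma>))"
| "subst_fm (Ex V \<phi>) \<sigma> = Ex V (subst_fm \<phi> (shield V \<sigma>))"

primrec free_for :: "('r, 'c, 'v, 'i) fm \<Rightarrow> ('v \<Rightarrow> ('c, 'v) trm) \<Rightarrow> bool" where
  "free_for (Eq s t) \<sigma> \<longleftrightarrow> True"
| "free_for (Rel R ts) \<sigma> \<longleftrightarrow> True"
| "free_for (Neg \<phi>) \<sigma> \<longleftrightarrow> free_for \<phi> \<sigma>"
| "free_for (Conj J f) \<sigma> \<longleftrightarrow> (\<forall>j\<in>J. free_for (f j) \<sigma>)"
| "free_for (Disj J f) \<sigma> \<longleftrightarrow> (\<forall>j\<in>J. free_for (f j) \<sigma>)"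
| "free_for (All V \<phi>) \<sigma> \<longleftrightarrow>
     free_for \<phi> (shield V \<sigma>) \<and> (\<forall>x\<in>fv \<phi> - V. vars_trm (\<sigma> x) \<inter> V = {})"
| "free_for (Ex V \<phi>) \<sigma> \<longleftrightarrow>
     free_for \<phi> (shield V \<sigma>) \<and> (\<forall>x\<in>fv \<phi> - V. vars_trm (\<sigma> x) \<inter> V = {})"


section \<open>Provability\<close>

text \<open>
  In every rule the conclusion is required to consist of \<open>L\<^sub>\<infinity>\<^sub>\<infinity>\<close>-formulae; hence so do all sequents
  of a derivation. A substitution \<open>\<sigma>\<close> for the variables in \<open>V\<close> is one that is the identity off \<open>V\<close>.
\<close>

abbreviation fms_inf_inf :: "('r, 'c) signature \<Rightarrow> ('r, 'c, 'v, 'i) fm set" where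
  "fms_inf_inf L \<equiv> {\<phi>. fm_inf_inf L \<phi>}"

inductive provable ::
  "('r, 'c) signature \<Rightarrow> ('r, 'c, 'v, 'i) fm set \<Rightarrow> ('r, 'c, 'v, 'i) fm set \<Rightarrow> bool"
  for L where
  Axiom: "insert \<phi> \<Gamma> \<union> \<Delta> \<subseteq> fms_inf_inf L \<Longrightarrow> provable L (insert \<phi> \<Gamma>) (insert \<phi> \<Delta>)"
| Refl: "trm_in L t \<Longrightarrow> provable L {} {Eq t t}"
| Sym: "\<lbrakk>trm_in L s; trm_in L t\<rbrakk> \<Longrightarrow> provable L {Eq s t} {Eq t s}"
| Trans: "\<lbrakk>trm_in L s; trm_in L t; trm_in L u\<rbrakk> \<Longrightarrow> provable L {Eq s t, Eq t u} {Eq s u}"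
| Leibniz:
    "\<lbrakk>\<forall>x. x \<notin> V \<longrightarrow> \<sigma> x = Var x \<and> \<tau> x = Var x; free_for \<phi> \<sigma>; free_for \<phi> \<tau>;
      insert (subst_fm \<phi> \<sigma>) {Eq (\<tau> x) (\<sigma> x) |x. x \<in> V} \<union> {subst_fm \<phi> \<tau>} \<subseteq> fms_inf_inf L\<rbrakk>
     \<Longrightarrow> provable L (insert (subst_fm \<phi> \<sigma>) {Eq (\<tau> x) (\<sigma> x) |x. x \<in> V}) {subst_fm \<phi> \<tau>}"
| Cut:
    "\<lbrakk>provable L (insert \<phi> \<Gamma>) \<Delta>; provable L \<Gamma>' (insert \<phi> \<Delta>');
      \<Gamma> \<union> \<Gamma>' \<union> (\<Delta> \<union> \<Delta>') \<subseteq> fms_inf_inf L\<rbrakk>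
     \<Longrightarrow> provable L (\<Gamma> \<union> \<Gamma>') (\<Delta> \<union> \<Delta>')"
| Weakening:
    "\<lbrakk>provable L \<Gamma> \<Delta>; \<Gamma> \<subseteq> \<Gamma>'; \<Delta> \<subseteq> \<Delta>'; \<Gamma>' \<union> \<Delta>' \<subseteq> fms_inf_inf L\<rbrakk> \<Longrightarrow> provable L \<Gamma>' \<Delta>'"
| Substitution:
    "\<lbrakk>provable L \<Gamma> \<Delta>; \<forall>\<phi>\<in>\<Gamma> \<union> \<Delta>. free_for \<phi> \<sigma>;
      (\<lambda>\<phi>. subst_fm \<phi> \<sigma>) ` (\<Gamma> \<union> \<Delta>) \<subseteq> fms_inf_inf L\<rbrakk>
     \<Longrightarrow> provable L ((\<lambda>\<phi>. subst_fm \<phi> \<sigma>) ` \<Gamma>) ((\<lambda>\<phi>. subst_fm \<phi> \<sigma>) ` \<Delta>)"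
| NegL:
    "\<lbrakk>provable L \<Gamma> (insert \<phi> \<Delta>); insert (Neg \<phi>) \<Gamma> \<union> \<Delta> \<subseteq> fms_inf_inf L\<rbrakk>
     \<Longrightarrow> provable L (insert (Neg \<phi>) \<Gamma>) \<Delta>"
| NegR:
    "\<lbrakk>provable L (insert \<phi> \<Gamma>) \<Delta>; \<Gamma> \<union> insert (Neg \<phi>) \<Delta> \<subseteq> fms_inf_inf L\<rbrakk>
     \<Longrightarrow> provable L \<Gamma> (insert (Neg \<phi>) \<Delta>)"
| ConjL:
    "\<lbrakk>provable L (\<Gamma> \<union> f ` J) \<Delta>; insert (Conj J f) \<Gamma> \<union> \<Delta> \<subseteq> fms_inf_inf L\<rbrakk>
     \<Longrightarrow> provable L (insert (Conj J f) \<Gamma>) \<Delta>"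
| ConjR:
    "\<lbrakk>\<And>j. j \<in> J \<Longrightarrow> provable L \<Gamma> (insert (f j) \<Delta>);
      \<Gamma> \<union> insert (Conj J f) \<Delta> \<subseteq> fms_inf_inf L\<rbrakk>
     \<Longrightarrow> provable L \<Gamma> (insert (Conj J f) \<Delta>)"
| DisjR:
    "\<lbrakk>provable L \<Gamma> (\<Delta> \<union> f ` J); \<Gamma> \<union> insert (Disj J f) \<Delta> \<subseteq> fms_inf_inf L\<rbrakk>
     \<Longrightarrow> provable L \<Gamma> (insert (Disj J f) \<Delta>)"
| DisjL:
    "\<lbrakk>\<And>j. j \<in> J \<Longrightarrow> provable L (insert (f j) \<Gamma>) \<Delta>;
      insert (Disj J f) \<Gamma> \<union> \<Delta> \<subseteq> fms_inf_inf L\<rbrakk>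
     \<Longrightarrow> provable L (insert (Disj J f) \<Gamma>) \<Delta>"
| AllL:
    "\<lbrakk>provable L (insert (subst_fm \<phi> \<sigma>) \<Gamma>) \<Delta>; \<forall>x. x \<notin> V \<longrightarrow> \<sigma> x = Var x; free_for \<phi> \<sigma>;
      insert (All V \<phi>) \<Gamma> \<union> \<Delta> \<subseteq> fms_inf_inf L\<rbrakk>
     \<Longrightarrow> provable L (insert (All V \<phi>) \<Gamma>) \<Delta>"
| AllR:
    "\<lbrakk>provable L \<Gamma> (insert \<phi> \<Delta>); \<forall>\<chi>\<in>\<Gamma> \<union> \<Delta>. fv \<chi> \<inter> V = {};
      \<Gamma> \<union> insert (All V \<phi>) \<Delta> \<subseteq> fms_inf_inf L\<rbrakk>
     \<Longrightarrow> provable L \<Gamma> (insert (All V \<phi>) \<Delta>)"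
| ExL:
    "\<lbrakk>provable L (insert \<phi> \<Gamma>) \<Delta>; \<forall>\<chi>\<in>\<Gamma> \<union> \<Delta>. fv \<chi> \<inter> V = {};
      insert (Ex V \<phi>) \<Gamma> \<union> \<Delta> \<subseteq> fms_inf_inf L\<rbrakk>
     \<Longrightarrow> provable L (insert (Ex V \<phi>) \<Gamma>) \<Delta>"
| ExR:
    "\<lbrakk>provable L \<Gamma> (insert (subst_fm \<phi> \<sigma>) \<Delta>); \<forall>x. x \<notin> V \<longrightarrow> \<sigma> x = Var x; free_for \<phi> \<sigma>;
      \<Gamma> \<union> insert (Ex V \<phi>) \<Delta> \<subseteq> fms_inf_inf L\<rbrakk>
     \<Longrightarrow> provable L \<Gamma> (insert (Ex V \<phi>) \<Delta>)"


section \<open>Boolean valued models\<close>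

locale complete_boolean_algebra = complete_lattice B for B (structure) +
  assumes meet_join_distrib:
      "\<lbrakk>x \<in> carrier B; y \<in> carrier B; z \<in> carrier B\<rbrakk> \<Longrightarrow> x \<sqinter> (y \<squnion> z) = (x \<sqinter> y) \<squnion> (x \<sqinter> z)"
    and compl_exists:
      "x \<in> carrier B \<Longrightarrow> \<exists>y\<in>carrier B. x \<sqinter> y = \<bottom> \<and> x \<squnion> y = \<top>"
    and bottom_neq_top: "\<bottom> \<noteq> \<top>"

definition bcompl :: "'b gorder \<Rightarrow> 'b \<Rightarrow> 'b" where
  "bcompl B x = (THE y. y \<in> carrier B \<and> x \<sqinter>\<^bsub>B\<^esub> y = \<bottom>\<^bsub>B\<^esub> \<and> x \<squnion>\<^bsub>B\<^esub> y = \<top>\<^bsub>B\<^esub>)"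

record ('m, 'b, 'r, 'c) bv_structure =
  dom :: "'m set"
  eqv :: "'m \<Rightarrow> 'm \<Rightarrow> 'b"
  relv :: "'r \<Rightarrow> 'm list \<Rightarrow> 'b"
  cstv :: "'c \<Rightarrow> 'm"

definition bv_model ::
  "('r, 'c) signature \<Rightarrow> 'b gorder \<Rightarrow> ('m, 'b, 'r, 'c) bv_structure \<Rightarrow> bool" where
  "bv_model L B M \<longleftrightarrow>
     complete_boolean_algebra B \<and>
     dom M \<noteq> {} \<and>
     (\<forall>a\<in>dom M. \<forall>b\<in>dom M. eqv M a b \<in> carrier B) \<and>
     (\<forall>R\<in>rsyms L. \<forall>as\<in>lists (dom M). length as = ar L R \<longrightarrow> relv M R as \<in> carrier B) \<and>
     (\<forall>c\<in>csyms L. cstv M c \<in> dom M) \<and>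
     (\<forall>a\<in>dom M. eqv M a a = \<top>\<^bsub>B\<^esub>) \<and>
     (\<forall>a\<in>dom M. \<forall>b\<in>dom M. eqv M a b = eqv M b a) \<and>
     (\<forall>a\<in>dom M. \<forall>b\<in>dom M. \<forall>c\<in>dom M. eqv M a b \<sqinter>\<^bsub>B\<^esub> eqv M b c \<sqsubseteq>\<^bsub>B\<^esub> eqv M a c) \<and>
     (\<forall>R\<in>rsyms L. \<forall>as\<in>lists (dom M). \<forall>bs\<in>lists (dom M).
        length as = ar L R \<longrightarrow> length bs = ar L R \<longrightarrow>
        (\<Sqinter>\<^bsub>B\<^esub> ((\<lambda>i. eqv M (as ! i) (bs ! i)) ` {..<ar L R})) \<sqinter>\<^bsub>B\<^esub> relv M R as \<sqsubseteq>\<^bsub>B\<^esub> relv M R bs)"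

primrec val_trm ::
  "('m, 'b, 'r, 'c) bv_structure \<Rightarrow> ('v \<Rightarrow> 'm) \<Rightarrow> ('c, 'v) trm \<Rightarrow> 'm" where
  "val_trm M \<nu> (Var x) = \<nu> x"
| "val_trm M \<nu> (Const c) = cstv M c"

primrec val ::
  "'b gorder \<Rightarrow> ('m, 'b, 'r, 'c) bv_structure \<Rightarrow> ('r, 'c, 'v, 'i) fm \<Rightarrow> ('v \<Rightarrow> 'm) \<Rightarrow> 'b" where
  "val B M (Eq s t) = (\<lambda>\<nu>. eqv M (val_trm M \<nu> s) (val_trm M \<nu> t))"
| "val B M (Rel R ts) = (\<lambda>\<nu>. relv M R (map (val_trm M \<nu>) ts))"
| "val B M (Neg \<phi>) = (\<lambda>\<nu>. bcompl B (val B M \<phi> \<nu>))"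
| "val B M (Conj J f) = (\<lambda>\<nu>. \<Sqinter>\<^bsub>B\<^esub> ((\<lambda>j. val B M (f j) \<nu>) ` J))"
| "val B M (Disj J f) = (\<lambda>\<nu>. \<Squnion>\<^bsub>B\<^esub> ((\<lambda>j. val B M (f j) \<nu>) ` J))"
| "val B M (All V \<phi>) = (\<lambda>\<nu>. \<Sqinter>\<^bsub>B\<^esub> ((\<lambda>a. val B M \<phi> (override_on \<nu> a V)) ` (V \<rightarrow>\<^sub>E dom M)))"
| "val B M (Ex V \<phi>) = (\<lambda>\<nu>. \<Squnion>\<^bsub>B\<^esub> ((\<lambda>a. val B M \<phi> (override_on \<nu> a V)) ` (V \<rightarrow>\<^sub>E dom M)))"

text \<open>
  Algebras and models live on subsets of a fixed type \<open>'u\<close>, given by the first argument, since HOL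
  cannot quantify existentially over types.
\<close>

definition bool_consistent ::
  "'u itself \<Rightarrow> ('r, 'c) signature \<Rightarrow> ('r, 'c, 'v, 'i) fm set \<Rightarrow> bool" where
  "bool_consistent U L \<Gamma> \<longleftrightarrow>
     (\<exists>(B :: 'u gorder) (M :: ('u, 'u, 'r, 'c) bv_structure) \<nu>.
        bv_model L B M \<and> range \<nu> \<subseteq> dom M \<and> (\<forall>\<phi>\<in>\<Gamma>. val B M \<phi> \<nu> = \<top>\<^bsub>B\<^esub>))"

definition mixing :: "'b gorder \<Rightarrow> ('m, 'b, 'r, 'c) bv_structure \<Rightarrow> bool" where
  "mixing B M \<longleftrightarrow>
     (\<forall>A\<subseteq>carrier B. (\<forall>a\<in>A. \<forall>b\<in>A. a \<noteq> b \<longrightarrow> a \<sqinter>\<^bsub>B\<^esub> b = \<bottom>\<^bsub>B\<^esub>) \<longrightarrow>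
        (\<forall>t. t ` A \<subseteq> dom M \<longrightarrow> (\<exists>m\<in>dom M. \<forall>a\<in>A. a \<sqsubseteq>\<^bsub>B\<^esub> eqv M m (t a))))"

definition has_mixing_model ::
  "'u itself \<Rightarrow> ('r, 'c) signature \<Rightarrow> ('r, 'c, 'v, 'i) fm \<Rightarrow> bool" where
  "has_mixing_model U L \<phi> \<longleftrightarrow>
     (\<exists>(B :: 'u gorder) (M :: ('u, 'u, 'r, 'c) bv_structure).
        bv_model L B M \<and> mixing B M \<and> (\<forall>\<nu>. range \<nu> \<subseteq> dom M \<longrightarrow> val B M \<phi> \<nu> = \<top>\<^bsub>B\<^esub>))"


section \<open>Subsentences and finite conservativity\<close>

text \<open>
  Subformulae are taken with negations pushed inwards, as for formulae in negation normal form: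
  besides the formulae that occur in \<open>\<psi>\<close>, the formulae \<open>\<not>\<phi>\<close> with \<open>\<phi>\<close> an immediate constituent of \<open>\<chi>\<close>
  count as subformulae whenever \<open>\<not>\<chi>\<close> does. For \<open>\<psi>\<close> in negation normal form nothing is added, see
  \<open>subfms_nnf\<close> below.

  Without the added formulae finite conservativity would not imply joint consistency: let \<open>p\<^sub>n\<close> be
  distinct atomic sentences and take the family consisting of \<open>\<not>\<And>\<^sub>n p\<^sub>n\<close> and of all the \<open>p\<^sub>n\<close>.
  The formulae that occur in its members are \<open>\<not>\<And>\<^sub>n p\<^sub>n\<close>, \<open>\<And>\<^sub>n p\<^sub>n\<close> and the \<open>p\<^sub>n\<close>. Finitely many
  \<open>p\<^sub>n\<close> are always consistent with \<open>\<not>\<And>\<^sub>n p\<^sub>n\<close>, so finite subfamilies would be conservative over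
  each other, but the whole family is inconsistent.
\<close>

inductive_set subfms :: "('r, 'c, 'v, 'i) fm \<Rightarrow> ('r, 'c, 'v, 'i) fm set"
  for \<psi> where
  self: "\<psi> \<in> subfms \<psi>"
| neg: "Neg \<phi> \<in> subfms \<psi> \<Longrightarrow> \<phi> \<in> subfms \<psi>"
| conj: "\<lbrakk>Conj J f \<in> subfms \<psi>; j \<in> J\<rbrakk> \<Longrightarrow> f j \<in> subfms \<psi>"
| disj: "\<lbrakk>Disj J f \<in> subfms \<psi>; j \<in> J\<rbrakk> \<Longrightarrow> f j \<in> subfms \<psi>"
| all: "All V \<phi> \<in> subfms \<psi> \<Longrightarrow> \<phi> \<in> subfms \<psi>"
| ex: "Ex V \<phi> \<in> subfms \<psi> \<Longrightarrow> \<phi> \<in> subfms \<psi>"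
| neg_conj: "\<lbrakk>Neg (Conj J f) \<in> subfms \<psi>; j \<in> J\<rbrakk> \<Longrightarrow> Neg (f j) \<in> subfms \<psi>"
| neg_disj: "\<lbrakk>Neg (Disj J f) \<in> subfms \<psi>; j \<in> J\<rbrakk> \<Longrightarrow> Neg (f j) \<in> subfms \<psi>"
| neg_all: "Neg (All V \<phi>) \<in> subfms \<psi> \<Longrightarrow> Neg \<phi> \<in> subfms \<psi>"
| neg_ex: "Neg (Ex V \<phi>) \<in> subfms \<psi> \<Longrightarrow> Neg \<phi> \<in> subfms \<psi>"

text \<open>The formulae that occur in a formula, and negation normal form.\<close>

primrec occurring :: "('r, 'c, 'v, 'i) fm \<Rightarrow> ('r, 'c, 'v, 'i) fm set" where
  "occurring (Eq s t) = {Eq s t}"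
| "occurring (Rel R ts) = {Rel R ts}"
| "occurring (Neg \<phi>) = insert (Neg \<phi>) (occurring \<phi>)"
| "occurring (Conj J f) = insert (Conj J f) (\<Union>j\<in>J. occurring (f j))"
| "occurring (Disj J f) = insert (Disj J f) (\<Union>j\<in>J. occurring (f j))"
| "occurring (All V \<phi>) = insert (All V \<phi>) (occurring \<phi>)"
| "occurring (Ex V \<phi>) = insert (Ex V \<phi>) (occurring \<phi>)"

primrec atomic :: "('r, 'c, 'v, 'i) fm \<Rightarrow> bool" where
  "atomic (Eq s t) \<longleftrightarrow> True"
| "atomic (Rel R ts) \<longleftrightarrow> True"
| "atomic (Neg \<phi>) \<longleftrightarrow> False"
| "atomic (Conj J f) \<longleftrightarrow> False"
| "atomic (Disj J f) \<longleftrightarrow> False"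
| "atomic (All V \<phi>) \<longleftrightarrow> False"
| "atomic (Ex V \<phi>) \<longleftrightarrow> False"

primrec nnf :: "('r, 'c, 'v, 'i) fm \<Rightarrow> bool" where
  "nnf (Eq s t) \<longleftrightarrow> True"
| "nnf (Rel R ts) \<longleftrightarrow> True"
| "nnf (Neg \<phi>) \<longleftrightarrow> atomic \<phi>"
| "nnf (Conj J f) \<longleftrightarrow> (\<forall>j\<in>J. nnf (f j))"
| "nnf (Disj J f) \<longleftrightarrow> (\<forall>j\<in>J. nnf (f j))"
| "nnf (All V \<phi>) \<longleftrightarrow> nnf \<phi>"
| "nnf (Ex V \<phi>) \<longleftrightarrow> nnf \<phi>"

lemma occurring_self: "\<psi> \<in> occurring \<psi>"
  by (cases \<psi>) auto

lemma occurring_trans: "\<lbrakk>\<chi> \<in> occurring \<psi>; \<phi> \<in> occurring \<chi>\<rbrakk> \<Longrightarrow> \<phi> \<in> occurring \<psi>"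
  by (induction \<psi> arbitrary: \<phi> \<chi>) fastforce+

lemma subfms_trans:
  assumes "\<phi> \<in> subfms \<chi>" "\<chi> \<in> subfms \<psi>"
  shows "\<phi> \<in> subfms \<psi>"
  using assms by (induction rule: subfms.induct) (blast intro: subfms.intros)+

lemma occurring_subset_subfms: "occurring \<psi> \<subseteq> subfms \<psi>"
proof (induction \<psi>)
  case (Neg \<phi>)
  have "\<phi> \<in> subfms (Neg \<phi>)" by (rule subfms.neg[OF subfms.self])
  with Neg show ?case by (auto intro: subfms.self subfms_trans)
next
  case (Conj J f)
  have "f j \<in> subfms (Conj J f)" if "j \<in> J" for j by (rule subfms.conj[OF subfms.self that])
  with Conj show ?case by (auto intro: subfms.self subfms_trans)
next
  case (Disj J f)
  have "f j \<in> subfms (Disj J f)" if "j \<in> J" for j by (rule subfms.disj[OF subfms.self that])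
  with Disj show ?case by (auto intro: subfms.self subfms_trans)
next
  case (All V \<phi>)
  have "\<phi> \<in> subfms (All V \<phi>)" by (rule subfms.all[OF subfms.self])
  with All show ?case by (auto intro: subfms.self subfms_trans)
next
  case (Ex V \<phi>)
  have "\<phi> \<in> subfms (Ex V \<phi>)" by (rule subfms.ex[OF subfms.self])
  with Ex show ?case by (auto intro: subfms.self subfms_trans)
qed (auto intro: subfms.self)

lemma nnf_occurring: "\<lbrakk>nnf \<psi>; \<phi> \<in> occurring \<psi>\<rbrakk> \<Longrightarrow> nnf \<phi>"
proof (induction \<psi>)
  case (Neg \<chi>)
  then show ?case by (cases \<chi>) auto
qed auto

lemma subfms_nnf:
  assumes "nnf \<psi>"
  shows "subfms \<psi> = occurring \<psi>"
proof
  show "subfms \<psi> \<subseteq> occurring \<psi>"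
  proof
    fix \<phi>
    assume "\<phi> \<in> subfms \<psi>"
    then show "\<phi> \<in> occurring \<psi>"
    proof induction
      case self
      then show ?case by (rule occurring_self)
    qed (force dest: nnf_occurring[OF assms] intro: occurring_trans simp: occurring_self)+
  qed
qed (rule occurring_subset_subfms)

definition expand :: "('r, 'c) signature \<Rightarrow> 'c set \<Rightarrow> ('r, 'c) signature" where
  "expand L C = L\<lparr>csyms := csyms L \<union> C\<rparr>"

definition subsentences ::
  "('r, 'c) signature \<Rightarrow> 'c set \<Rightarrow> ('r, 'c, 'v, 'i) fm \<Rightarrow> ('r, 'c, 'v, 'i) fm set" where
  "subsentences L C \<psi> =
     {subst_fm \<phi> (\<lambda>x. Const (g x)) |\<phi> g. \<phi> \<in> subfms \<psi> \<and> g ` fv \<phi> \<subseteq> csyms L \<union> C}"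

definition conservative_strengthening ::
  "'u itself \<Rightarrow> ('r, 'c) signature \<Rightarrow> 'c set \<Rightarrow>
     ('r, 'c, 'v, 'i) fm \<Rightarrow> ('r, 'c, 'v, 'i) fm \<Rightarrow> bool" where
  "conservative_strengthening U L C \<psi>1 \<psi>0 \<longleftrightarrow>
     provable L {\<psi>1} {\<psi>0} \<and>
     (\<forall>s. finite s \<longrightarrow> s \<subseteq> subsentences L C \<psi>0 \<longrightarrow>
        (bool_consistent U (expand L C) {And \<psi>0 (BigConj s)} \<longleftrightarrow>
         bool_consistent U (expand L C) {And \<psi>1 (BigConj s)}))"

definition finitely_conservative ::
  "'u itself \<Rightarrow> ('r, 'c) signature \<Rightarrow> 'c set \<Rightarrow> 'j set \<Rightarrow> ('j \<Rightarrow> ('r, 'c, 'v, 'i) fm) \<Rightarrow> bool" where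
  "finitely_conservative U L C I \<psi> \<longleftrightarrow>
     (\<exists>i\<in>I. bool_consistent U L {\<psi> i}) \<and>
     (\<forall>u v. u \<noteq> {} \<longrightarrow> finite v \<longrightarrow> u \<subseteq> v \<longrightarrow> v \<subseteq> I \<longrightarrow>
        conservative_strengthening U L C (BigConj (\<psi> ` v)) (BigConj (\<psi> ` u)))"

end

theory Submission
  imports Defs
begin

text \<open>
  The conditions are the finite sets \<open>s\<close> of subsentences of the \<open>\<psi>\<^sub>i\<close> that are Boolean consistent with
  the conjunction of some finite subfamily containing the formulae that \<open>s\<close> comes from. By finite
  conservativity such an \<open>s\<close> is then consistent with every larger finite subfamily, so \<open>s \<union> {\<psi>\<^sub>i}\<close>
  is again a condition: the conditions form a consistency property, and every \<open>\<psi>\<^sub>i\<close> is dense in it.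
  A disjunction or an existential statement of value \<open>1\<close> only gives a disjunct or an instance of value
  \<open>b \<noteq> 0\<close>; passing to the part of the algebra below \<open>b\<close> turns this value into \<open>1\<close>, and a witness is
  named by constants of \<open>C\<close> that are not used yet.

  The model lives over the algebra of regular open sets of conditions. Its elements are the constants,
  or, for a mixing model, all names of mixtures of constants; an atomic sentence has as value the
  regularization of the set of conditions that imply it semantically. For finite quantifiers a name
  is decided to be a constant on a dense set, so enlarging the domain by mixtures does no harm, and
  every formula in a condition is forced by it.
\<close>

section \<open>Complete Boolean algebras\<close>

text \<open>Infinitary logic has no compactness: a consistent extension has to be found at a finite
  stage and must survive all later ones. Conservativity guarantees just this survival, and it does
  so only for finite sets of subsentences; this is why conditions are finite. Atomic values come
  from consequence and not from membership in conditions. The laws of equality are then inherited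
  from Boolean valued models, and conditions need not be closed under any rule for equality. A
  negated atom is still respected, since every stronger condition contains it and is consistent.
  Algebras are compared through lower bounds: complements and joins are expressed by the order
  alone. This links an algebra with its part below \<open>b\<close>, and the abstract operations
  with sets of conditions. Witnesses never run out: every subformula has fewer than
  \<open>\<mu>\<close> free variables, so a finite condition uses fewer than \<open>\<mu>\<close> of
  the \<open>\<mu>\<close> constants in \<open>C\<close>, and a quantified set has fewer than
  \<open>\<mu>\<close> variables.\<close>

locale cba = complete_boolean_algebra B for B :: "'b gorder" (structure)
begin

lemma complement_unique:
  assumes "x \<in> carrier B" "y \<in> carrier B" "z \<in> carrier B"
    and "x \<sqinter> y = \<bottom>" "x \<squnion> y = \<top>" "x \<sqinter> z = \<bottom>" "x \<squnion> z = \<top>"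
  shows "y = z"
proof -
  have *: "v \<sqsubseteq> w"
    if "v \<in> carrier B" "w \<in> carrier B" "x \<sqinter> v = \<bottom>" "x \<squnion> w = \<top>" for v w
  proof -
    have "v = v \<sqinter> (x \<squnion> w)"
      using that le_iff_join[of v \<top>] by simp
    also have "\<dots> = (v \<sqinter> x) \<squnion> (v \<sqinter> w)"
      using that assms(1) by (intro meet_join_distrib)
    also have "\<dots> = \<bottom> \<squnion> (v \<sqinter> w)"
      using that by (simp add: meet_comm)
    also have "\<dots> = v \<sqinter> w"
      using that le_iff_meet[of \<bottom> "v \<sqinter> w"] by simp
    finally show ?thesis
      using that le_iff_join by blast
  qed
  show ?thesis
    using *[of y z] *[of z y] assms by (auto intro: le_antisym)
qed

lemma bcompl_props:
  assumes "x \<in> carrier B"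
  shows bcompl_closed [simp]: "bcompl B x \<in> carrier B"
    and meet_bcompl: "x \<sqinter> bcompl B x = \<bottom>"
    and join_bcompl: "x \<squnion> bcompl B x = \<top>"
proof -
  have "\<exists>!y. y \<in> carrier B \<and> x \<sqinter> y = \<bottom> \<and> x \<squnion> y = \<top>"
    using compl_exists[OF assms] complement_unique[OF assms] by blast
  from theI'[OF this] show "bcompl B x \<in> carrier B" "x \<sqinter> bcompl B x = \<bottom>" "x \<squnion> bcompl B x = \<top>"
    by (auto simp: bcompl_def)
qed

lemma le_bottom_iff: "x \<in> carrier B \<Longrightarrow> x \<sqsubseteq> \<bottom> \<longleftrightarrow> x = \<bottom>"
  by (auto intro: le_antisym)

lemma top_le_iff: "x \<in> carrier B \<Longrightarrow> \<top> \<sqsubseteq> x \<longleftrightarrow> x = \<top>"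
  by (auto intro: le_antisym)

lemma meet_mono_le:
  assumes "x \<sqsubseteq> y" "x \<in> carrier B" "y \<in> carrier B" "z \<in> carrier B"
  shows "x \<sqinter> z \<sqsubseteq> y \<sqinter> z"
  using assms by (intro meet_le) (auto intro: le_trans[OF meet_left] meet_right)

lemma le_bcompl_iff:
  assumes "c \<in> carrier B" "x \<in> carrier B"
  shows "c \<sqsubseteq> bcompl B x \<longleftrightarrow> c \<sqinter> x = \<bottom>"
proof
  assume "c \<sqsubseteq> bcompl B x"
  from meet_mono_le[OF this, of x] assms have "c \<sqinter> x \<sqsubseteq> \<bottom>"
    by (simp add: meet_comm[where y = x] meet_bcompl)
  then show "c \<sqinter> x = \<bottom>"
    using assms by (simp add: le_bottom_iff)
next
  assume *: "c \<sqinter> x = \<bottom>"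
  have "c = c \<sqinter> (x \<squnion> bcompl B x)"
    using assms le_iff_join[of c \<top>] by (simp add: join_bcompl)
  also have "\<dots> = \<bottom> \<squnion> (c \<sqinter> bcompl B x)"
    using assms * by (simp add: meet_join_distrib)
  also have "\<dots> = c \<sqinter> bcompl B x"
    using assms le_iff_meet[of \<bottom> "c \<sqinter> bcompl B x"] by simp
  finally show "c \<sqsubseteq> bcompl B x"
    using assms le_iff_join by simp
qed

text \<open>Complements are described by the order and \<open>\<bottom>\<close> alone. Algebras
  whose orders agree can then be compared without computing operations; relative algebras and the
  regular open algebra are both handled in this way.\<close>

lemma le_bcompl_iff_disjoint:
  assumes "c \<in> carrier B" "x \<in> carrier B"
  shows "c \<sqsubseteq> bcompl B x \<longleftrightarrow> (\<forall>d\<in>carrier B. d \<sqsubseteq> c \<longrightarrow> d \<sqsubseteq> x \<longrightarrow> d = \<bottom>)"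
proof
  assume "c \<sqsubseteq> bcompl B x"
  then have "c \<sqinter> x = \<bottom>"
    using assms by (simp add: le_bcompl_iff)
  then show "\<forall>d\<in>carrier B. d \<sqsubseteq> c \<longrightarrow> d \<sqsubseteq> x \<longrightarrow> d = \<bottom>"
    using assms by (metis le_bottom_iff meet_le)
next
  assume "\<forall>d\<in>carrier B. d \<sqsubseteq> c \<longrightarrow> d \<sqsubseteq> x \<longrightarrow> d = \<bottom>"
  then have "c \<sqinter> x = \<bottom>"
    using assms by (simp add: meet_left meet_right)
  then show "c \<sqsubseteq> bcompl B x"
    using assms by (simp add: le_bcompl_iff)
qed

lemma bcompl_bcompl:
  assumes "x \<in> carrier B"
  shows "bcompl B (bcompl B x) = x"
  using assms complement_unique[of "bcompl B x" "bcompl B (bcompl B x)" x]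
  by (simp add: meet_bcompl join_bcompl meet_comm[where x = "bcompl B x" and y = x]
      join_comm[where x = "bcompl B x" and y = x])

lemma le_iff_disjoint_bcompl:
  assumes "c \<in> carrier B" "x \<in> carrier B"
  shows "c \<sqsubseteq> x \<longleftrightarrow> (\<forall>d\<in>carrier B. d \<sqsubseteq> c \<longrightarrow> d \<sqsubseteq> bcompl B x \<longrightarrow> d = \<bottom>)"
  using le_bcompl_iff_disjoint[of c "bcompl B x"] assms by (simp add: bcompl_bcompl)

lemma bcompl_top [simp]: "bcompl B \<top> = \<bottom>"
  using meet_bcompl[of \<top>] le_iff_join[of "bcompl B \<top>" \<top>] by (simp add: meet_comm)

lemma le_inf_iff:
  assumes "X \<subseteq> carrier B" "c \<in> carrier B"
  shows "c \<sqsubseteq> \<Sqinter>X \<longleftrightarrow> (\<forall>x\<in>X. c \<sqsubseteq> x)"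
  using assms by (meson inf_closed inf_lower inf_greatest le_trans subset_iff)

lemma inf_eq_top_iff:
  assumes "X \<subseteq> carrier B"
  shows "\<Sqinter>X = \<top> \<longleftrightarrow> (\<forall>x\<in>X. x = \<top>)"
  using le_inf_iff[OF assms, of \<top>] assms by (auto simp: top_le_iff subset_iff)

text \<open>A non-zero \<open>d\<close> none of whose non-zero parts lies below a member of
  \<open>X\<close> is disjoint from all of \<open>X\<close>, and then the whole join lies below the
  complement of \<open>d\<close>. Joins are thus expressed by density, again in terms of the order,
  and this form passes to relative algebras.\<close>

lemma le_sup_iff:
  assumes "X \<subseteq> carrier B" "c \<in> carrier B"
  shows "c \<sqsubseteq> \<Squnion>X \<longleftrightarrow>
    (\<forall>d\<in>carrier B. d \<sqsubseteq> c \<longrightarrow> d \<noteq> \<bottom> \<longrightarrow> (\<exists>e\<in>carrier B. e \<sqsubseteq> d \<and> e \<noteq> \<bottom> \<and> (\<exists>x\<in>X. e \<sqsubseteq> x)))"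
    (is "_ \<longleftrightarrow> ?D")
proof
  assume le: "c \<sqsubseteq> \<Squnion>X"
  show ?D
  proof (intro ballI impI, rule ccontr)
    fix d
    assume d: "d \<in> carrier B" "d \<sqsubseteq> c" "d \<noteq> \<bottom>"
      and no: "\<not> (\<exists>e\<in>carrier B. e \<sqsubseteq> d \<and> e \<noteq> \<bottom> \<and> (\<exists>x\<in>X. e \<sqsubseteq> x))"
    have "\<Squnion>X \<sqsubseteq> bcompl B d"
      using assms d no by (intro sup_least) (auto simp: le_bcompl_iff_disjoint subset_iff)
    then have "d \<sqsubseteq> bcompl B d"
      using assms le d by (meson le_trans bcompl_closed sup_closed)
    then show False
      using d by (auto simp: le_bcompl_iff_disjoint)
  qed
next
  assume D: ?D
  have "d = \<bottom>" if d: "d \<in> carrier B" "d \<sqsubseteq> c" "d \<sqsubseteq> bcompl B (\<Squnion>X)" for d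
  proof (rule ccontr)
    assume "d \<noteq> \<bottom>"
    with D d obtain e x where e: "e \<in> carrier B" "e \<sqsubseteq> d" "e \<noteq> \<bottom>" "x \<in> X" "e \<sqsubseteq> x"
      by blast
    then have "e \<sqsubseteq> \<Squnion>X"
      using assms sup_upper[of X x] by (meson le_trans sup_closed subset_iff)
    then show False
      using e d assms by (auto simp: le_bcompl_iff_disjoint)
  qed
  then show "c \<sqsubseteq> \<Squnion>X"
    using assms by (simp add: le_iff_disjoint_bcompl[of c])
qed

lemma sup_eq_bottom_iff:
  assumes "X \<subseteq> carrier B"
  shows "\<Squnion>X = \<bottom> \<longleftrightarrow> (\<forall>x\<in>X. x = \<bottom>)"
proof
  assume "\<Squnion>X = \<bottom>"
  then show "\<forall>x\<in>X. x = \<bottom>"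
    using assms sup_upper[OF assms] by (metis le_bottom_iff subset_iff)
next
  assume *: "\<forall>x\<in>X. x = \<bottom>"
  then have "\<Squnion>X \<sqsubseteq> \<bottom>"
    using assms by (intro sup_least) auto
  then show "\<Squnion>X = \<bottom>"
    using assms by (simp add: le_bottom_iff)
qed

end

text \<open>The law \<open>disj\<close> makes \<open>neg\<close> a pseudocomplement, and an
  involutive pseudocomplement turns a lattice into a Boolean algebra: it yields an implication,
  hence distributivity, and the negation of \<open>x \<squnion> neg x\<close> is disjoint from both
  \<open>x\<close> and \<open>neg x\<close>, hence zero.\<close>

lemma complete_boolean_algebraI:
  fixes B :: "'b gorder" (structure)
    and neg :: "'b \<Rightarrow> 'b"
  assumes "complete_lattice B"
    and neg: "\<And>x. x \<in> carrier B \<Longrightarrow> neg x \<in> carrier B"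
    and disj: "\<And>c x. \<lbrakk>c \<in> carrier B; x \<in> carrier B\<rbrakk> \<Longrightarrow>
      c \<sqsubseteq> neg x \<longleftrightarrow> (\<forall>d\<in>carrier B. d \<sqsubseteq> c \<longrightarrow> d \<sqsubseteq> x \<longrightarrow> d = \<bottom>)"
    and inv: "\<And>x. x \<in> carrier B \<Longrightarrow> neg (neg x) = x"
    and "\<bottom> \<noteq> \<top>"
  shows "complete_boolean_algebra B"
proof -
  interpret complete_lattice B by fact
  have le_comp: "c \<sqsubseteq> neg x \<longleftrightarrow> c \<sqinter> x = \<bottom>" if "c \<in> carrier B" "x \<in> carrier B" for c x
  proof
    assume "c \<sqsubseteq> neg x"
    then show "c \<sqinter> x = \<bottom>"
      using that disj[of c x] by (simp add: meet_left meet_right)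
  next
    assume "c \<sqinter> x = \<bottom>"
    then show "c \<sqsubseteq> neg x"
      using that disj[of c x] by (metis le_antisym bottom_closed bottom_lower meet_le)
  qed
  have comp_meet: "x \<sqinter> neg x = \<bottom>" if "x \<in> carrier B" for x
    using le_comp[of x "neg x"] neg that inv by simp
  have distrib: "x \<sqinter> (y \<squnion> z) = (x \<sqinter> y) \<squnion> (x \<sqinter> z)"
    if c: "x \<in> carrier B" "y \<in> carrier B" "z \<in> carrier B" for x y z
  proof (rule le_antisym)
    let ?w = "(x \<sqinter> y) \<squnion> (x \<sqinter> z)"
    let ?m = "x \<sqinter> neg ?w"
    note c' = c neg
    \<comment> \<open>\<open>neg ?m\<close> is the implication from \<open>x\<close> to
      \<open>?w\<close>: whatever meets \<open>x\<close> inside \<open>?w\<close> lies below it.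
      Both \<open>y\<close> and \<open>z\<close> do, hence so does their join, which is the
      non-trivial half of distributivity.\<close>
    have *: "v \<sqsubseteq> neg ?m" if "v \<in> carrier B" "x \<sqinter> v \<sqsubseteq> ?w" for v
    proof -
      have "v \<sqinter> ?m = (x \<sqinter> v) \<sqinter> neg ?w"
        using that c' by (metis meet_assoc meet_comm join_closed meet_closed)
      also have "\<dots> = \<bottom>"
        using that c' le_comp[of "x \<sqinter> v" "neg ?w"] inv by simp
      finally show ?thesis
        using that c' le_comp by simp
    qed
    have "y \<squnion> z \<sqsubseteq> neg ?m"
      using c' by (intro join_le *) (auto intro: join_left join_right)
    then have "(y \<squnion> z) \<sqinter> ?m = \<bottom>"
      using c' le_comp by simp
    then have "(x \<sqinter> (y \<squnion> z)) \<sqinter> neg ?w = \<bottom>"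
      using c' by (metis meet_assoc meet_comm join_closed meet_closed)
    then show "x \<sqinter> (y \<squnion> z) \<sqsubseteq> ?w"
      using le_comp[of "x \<sqinter> (y \<squnion> z)" "neg ?w"] c' inv by simp
    show "?w \<sqsubseteq> x \<sqinter> (y \<squnion> z)"
      using c by (intro join_le meet_le)
        (auto intro: meet_left meet_right le_trans[OF meet_right join_left] le_trans[OF meet_right join_right])
  qed (use c in auto)
  have "x \<squnion> neg x = \<top>" if x: "x \<in> carrier B" for x
  proof -
    let ?n = "neg (x \<squnion> neg x)"
    have n: "?n \<in> carrier B"
      using x neg by simp
    have "?n \<sqinter> (x \<squnion> neg x) = \<bottom>"
      using x neg le_comp[of ?n "x \<squnion> neg x"] by simp
    then have "(?n \<sqinter> x) \<squnion> (?n \<sqinter> neg x) = \<bottom>"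
      using x neg n distrib by simp
    then have b: "?n \<sqinter> x = \<bottom>" "?n \<sqinter> neg x = \<bottom>"
      using x neg n by (metis le_antisym bottom_closed bottom_lower join_left join_right meet_closed)+
    then have "?n \<sqsubseteq> neg x"
      using x n le_comp by simp
    then have "?n = \<bottom>"
      using b n x neg le_iff_join[of ?n "neg x"] by simp
    then have "x \<squnion> neg x = neg \<bottom>"
      using inv[of "x \<squnion> neg x"] x neg by simp
    moreover have "\<top> \<sqsubseteq> neg \<bottom>"
      using disj[of \<top> \<bottom>] by (auto intro: le_antisym)
    ultimately have "\<top> \<sqsubseteq> x \<squnion> neg x"
      by simp
    then show ?thesis
      using x neg by (auto intro: le_antisym)
  qed
  with comp_meet distrib neg assms(5) show ?thesis
    by unfold_locales blast+
qed

lemma complete_lattice_InfI: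
  fixes B :: "'b gorder" (structure)
  assumes "partial_order B" "t \<in> carrier B" "\<And>x. x \<in> carrier B \<Longrightarrow> x \<sqsubseteq> t"
    and "\<And>A. \<lbrakk>A \<subseteq> carrier B; A \<noteq> {}\<rbrakk> \<Longrightarrow>
      \<exists>i\<in>carrier B. (\<forall>x\<in>A. i \<sqsubseteq> x) \<and> (\<forall>y\<in>carrier B. (\<forall>x\<in>A. y \<sqsubseteq> x) \<longrightarrow> y \<sqsubseteq> i)"
  shows "complete_lattice B"
proof -
  interpret partial_order B by fact
  show ?thesis
  proof (rule complete_lattice_criterion1)
    show "\<exists>g. greatest B g (carrier B)"
      using assms(2,3) by (auto simp: greatest_def)
  next
    fix A
    assume "A \<subseteq> carrier B" "A \<noteq> {}"
    with assms(4)[of A] obtain i where "i \<in> carrier B" "\<forall>x\<in>A. i \<sqsubseteq> x"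
        "\<forall>y\<in>carrier B. (\<forall>x\<in>A. y \<sqsubseteq> x) \<longrightarrow> y \<sqsubseteq> i"
      by blast
    with \<open>A \<subseteq> carrier B\<close> have "greatest B i (Lower B A)"
      by (intro greatest_LowerI) (simp_all add: Lower_def subset_iff)
    then show "\<exists>i. greatest B i (Lower B A)" ..
  qed
qed

section \<open>Relative algebras below a non-zero element\<close>

definition below :: "'b gorder \<Rightarrow> 'b \<Rightarrow> 'b gorder" where
  "below B b = B\<lparr>carrier := {x \<in> carrier B. x \<sqsubseteq>\<^bsub>B\<^esub> b}\<rparr>"

context cba
begin

lemma below_simps [simp]:
  "x \<in> carrier (below B b) \<longleftrightarrow> x \<in> carrier B \<and> x \<sqsubseteq> b"
  "le (below B b) = le B"
  by (simp_all add: below_def)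

text \<open>Infima of non-empty sets are those of \<open>B\<close>; only the empty infimum changes,
  from \<open>\<top>\<close> to \<open>b\<close>. The complement becomes
  \<open>b \<sqinter> bcompl B x\<close>, which obeys the disjointness law of
  \<open>bcompl B x\<close> for all elements below \<open>b\<close>.\<close>

lemma complete_boolean_algebra_below:
  fixes b
  assumes b: "b \<in> carrier B" "b \<noteq> \<bottom>"
  shows "complete_boolean_algebra (below B b)" (is ?cba)
    and top_below: "\<top>\<^bsub>below B b\<^esub> = b"
    and bottom_below: "\<bottom>\<^bsub>below B b\<^esub> = \<bottom>"
proof -
  let ?B = "below B b"
  have po: "partial_order ?B"
    apply unfold_locales
           apply (simp_all add: below_def eq_is_equal)
     apply (metis le_antisym)
    apply (metis le_trans)
    done
  have cl: "complete_lattice ?B"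
  proof (rule complete_lattice_InfI[OF po, of b])
    fix A
    assume A: "A \<subseteq> carrier ?B" "A \<noteq> {}"
    then have A': "A \<subseteq> carrier B"
      by (simp add: subset_iff)
    have le: "\<Sqinter>A \<sqsubseteq> x" if "x \<in> A" for x
      using inf_lower[OF A'] that by simp
    obtain a where a: "a \<in> A"
      using A by blast
    then have "a \<in> carrier B" "a \<sqsubseteq> b"
      using A by (simp_all add: subset_iff)
    then have "\<Sqinter>A \<sqsubseteq> b"
      using le_trans[OF le[OF a]] A' b by simp
    with A' b le show "\<exists>i\<in>carrier ?B. (\<forall>x\<in>A. i \<sqsubseteq>\<^bsub>?B\<^esub> x) \<and>
        (\<forall>y\<in>carrier ?B. (\<forall>x\<in>A. y \<sqsubseteq>\<^bsub>?B\<^esub> x) \<longrightarrow> y \<sqsubseteq>\<^bsub>?B\<^esub> i)"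
      by (intro bexI[of _ "\<Sqinter>A"]) (simp_all add: le_inf_iff)
  qed (use b in simp_all)
  interpret C: complete_lattice ?B by (rule cl)
  show top: "\<top>\<^bsub>?B\<^esub> = b"
    using C.top_higher[of b] b C.top_closed by (intro le_antisym) simp_all
  show bot: "\<bottom>\<^bsub>?B\<^esub> = \<bottom>"
    using C.bottom_lower[of \<bottom>] b C.bottom_closed by (intro le_antisym) simp_all
  let ?comp = "\<lambda>x. b \<sqinter> bcompl B x"
  have disj: "c \<sqsubseteq> ?comp x \<longleftrightarrow> (\<forall>d\<in>carrier B. d \<sqsubseteq> c \<longrightarrow> d \<sqsubseteq> x \<longrightarrow> d = \<bottom>)"
    if "c \<in> carrier B" "x \<in> carrier B" "c \<sqsubseteq> b" for c x
  proof -
    have "c \<sqsubseteq> ?comp x \<longleftrightarrow> c \<sqsubseteq> bcompl B x"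
      using that b by (meson le_trans meet_le meet_right meet_closed bcompl_closed)
    then show ?thesis
      using that by (simp add: le_bcompl_iff_disjoint)
  qed
  show ?cba
  proof (rule complete_boolean_algebraI[OF cl, where neg = ?comp])
    fix x
    assume "x \<in> carrier ?B"
    then have x: "x \<in> carrier B" "x \<sqsubseteq> b"
      by simp_all
    show "?comp x \<in> carrier ?B"
      using x b by (simp add: meet_left)
    show "?comp (?comp x) = x"
    proof (rule le_antisym)
      show "x \<sqsubseteq> ?comp (?comp x)"
      proof (subst disj; (intro ballI impI)?)
        fix d
        assume d: "d \<in> carrier B" "d \<sqsubseteq> x" "d \<sqsubseteq> ?comp x"
        then have "d \<sqsubseteq> b"
          using le_trans[of d x b] x b by simp
        then show "d = \<bottom>"
          using d disj[of d x] x b by simp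
      qed (use x b in simp_all)
      show "?comp (?comp x) \<sqsubseteq> x"
      proof -
        have "d = \<bottom>" if d: "d \<in> carrier B" "d \<sqsubseteq> ?comp (?comp x)" "d \<sqsubseteq> bcompl B x" for d
        proof -
          have db: "d \<sqsubseteq> b"
            using d b x by (meson bcompl_closed le_trans meet_closed meet_left)
          then have "d \<sqsubseteq> ?comp x"
            using d b x by (simp add: meet_le)
          then show ?thesis
            using disj[of d "?comp x"] d db x b by simp
        qed
        then show ?thesis
          using x b by (subst le_iff_disjoint_bcompl) simp_all
      qed
    qed (use x b in simp_all)
  next
    fix c x
    assume "c \<in> carrier ?B" "x \<in> carrier ?B"
    moreover from this have "(d \<in> carrier B \<and> d \<sqsubseteq> b \<longrightarrow> d \<sqsubseteq> c \<longrightarrow> P) = (d \<in> carrier B \<longrightarrow> d \<sqsubseteq> c \<longrightarrow> P)" for d P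
      using le_trans[of d c b] b by auto
    ultimately show "(c \<sqsubseteq>\<^bsub>?B\<^esub> ?comp x) = (\<forall>d\<in>carrier ?B. d \<sqsubseteq>\<^bsub>?B\<^esub> c \<longrightarrow> d \<sqsubseteq>\<^bsub>?B\<^esub> x \<longrightarrow> d = \<bottom>\<^bsub>?B\<^esub>)"
      using disj[of c x] bot by (simp add: Ball_def)
  qed (use top bot b in simp_all)
qed

end

context cba
begin

lemma bcompl_bottom [simp]: "bcompl B \<bottom> = \<top>"
  using bcompl_bcompl[OF top_closed] by simp

lemma bcompl_eq_bottom_iff: "x \<in> carrier B \<Longrightarrow> bcompl B x = \<bottom> \<longleftrightarrow> x = \<top>"
  using bcompl_bcompl[of x] by auto

lemma bcompl_eq_top_iff: "x \<in> carrier B \<Longrightarrow> bcompl B x = \<top> \<longleftrightarrow> x = \<bottom>"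
  using bcompl_bcompl[of x] by auto

end

section \<open>Formulae\<close>

text \<open>The formulae over \<open>L\<close>, without restriction on the sizes of connectives and quantifiers.\<close>

definition lang :: "('r, 'c) signature \<Rightarrow> ('r, 'c, 'v, 'i) fm \<Rightarrow> bool" where
  "lang L \<phi> \<longleftrightarrow> fm_in L |UNIV :: 'i set set| |UNIV :: 'v set set| \<phi>"

section \<open>Sizes of connectives and of quantified sets\<close>

lemma card_of_less_set_UNIV: "|A :: 'a set| <o |UNIV :: 'a set set|"
  by (metis Pow_UNIV card_of_Pow card_of_mono1 ordLeq_ordLess_trans subset_UNIV)

lemma card_of_image_less: "|UNIV :: 'i set| <o \<kappa> \<Longrightarrow> |f ` (J :: 'i set)| <o \<kappa>"
  by (meson card_of_image card_of_mono1 ordLeq_ordLess_trans subset_UNIV)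

lemma card_of_less: "|UNIV :: 'v set| <o \<mu> \<Longrightarrow> |V :: 'v set| <o \<mu>"
  by (meson card_of_mono1 ordLeq_ordLess_trans subset_UNIV)

text \<open>The types \<open>'i\<close> and \<open>'v\<close> already bound every connective and
  every set of variables, so cardinals beyond them impose nothing. This allows \<open>lang\<close>
  to replace \<open>fm_in\<close> wherever sizes do not matter.\<close>

lemma fm_in_large:
  fixes \<phi> :: "('r, 'c, 'v, 'i) fm"
  assumes "fm_in L \<kappa> \<mu> \<phi>" "|UNIV :: 'i set| <o \<kappa>'" "|UNIV :: 'v set| <o \<mu>'"
  shows "fm_in L \<kappa>' \<mu>' \<phi>"
  using assms by (induction \<phi>) (auto intro: card_of_image_less card_of_less)

lemma fm_in_lang: "fm_in L \<kappa> \<mu> \<phi> \<Longrightarrow> lang L \<phi>"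
  unfolding lang_def by (erule fm_in_large) (rule card_of_less_set_UNIV)+

lemma lang_simps [simp]:
  "lang L (Eq s t) \<longleftrightarrow> trm_in L s \<and> trm_in L t"
  "lang L (Rel R ts) \<longleftrightarrow> R \<in> rsyms L \<and> length ts = ar L R \<and> (\<forall>t\<in>set ts. trm_in L t)"
  "lang L (Neg \<phi>) \<longleftrightarrow> lang L \<phi>"
  "lang L (Conj J f) \<longleftrightarrow> (\<forall>j\<in>J. lang L (f j))"
  "lang L (Disj J f) \<longleftrightarrow> (\<forall>j\<in>J. lang L (f j))"
  "lang L (All V \<phi>) \<longleftrightarrow> lang L \<phi>"
  "lang L (Ex V \<phi>) \<longleftrightarrow> lang L \<phi>"
  by (auto simp: lang_def intro: card_of_image_less card_of_less card_of_less_set_UNIV)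

lemma lang_mono:
  fixes \<phi> :: "('r, 'c, 'v, 'i) fm"
  assumes "lang L \<phi>" "rsyms L \<subseteq> rsyms L'" "ar L' = ar L" "csyms L \<subseteq> csyms L'"
  shows "lang L' \<phi>"
proof -
  have t: "trm_in L t \<Longrightarrow> trm_in L' t" for t :: "('c, 'v) trm"
    using assms(4) by (cases t) auto
  show ?thesis
    using assms(1) by (induction \<phi>) (use assms(2,3) t in auto)
qed

lemma expand_simps [simp]:
  "rsyms (expand L C) = rsyms L" "ar (expand L C) = ar L" "csyms (expand L C) = csyms L \<union> C"
  by (simp_all add: expand_def)

lemma lang_expand: "lang L \<phi> \<Longrightarrow> lang (expand L C) \<phi>"
  by (erule lang_mono) auto

lemma Cinfinite_card_of_set_plus_nat: "Cinfinite |UNIV :: ('x + nat) set set|"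
proof -
  have "infinite (UNIV :: ('x + nat) set)"
    by (simp add: finite_Plus_UNIV_iff)
  then show ?thesis
    by (simp add: cinfinite_def Finite_Set.finite_set card_of_card_order_on Field_card_of)
qed

lemma card_of_less_set_plus_nat: "|UNIV :: 'x set| <o |UNIV :: ('x + nat) set set|"
proof -
  have "|UNIV :: 'x set| \<le>o |UNIV :: ('x + nat) set|"
    by (rule card_of_ordLeqI[of Inl]) auto
  then show ?thesis
    using card_of_less_set_UNIV ordLeq_ordLess_trans by blast
qed

text \<open>The summand \<open>nat\<close> keeps the cardinals infinite even for finite
  \<open>'i\<close> or \<open>'v\<close>. The lemma is for derivations, whose rules admit only
  formulae satisfying \<open>fm_inf_inf\<close>.\<close>

lemma lang_fm_inf_inf:
  fixes \<phi> :: "('r, 'c, 'v, 'i) fm"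
  assumes "lang L \<phi>"
  shows "fm_inf_inf L \<phi>"
proof -
  have "fm_in L |UNIV :: ('i + nat) set set| |UNIV :: ('v + nat) set set| \<phi>"
    using assms card_of_less_set_plus_nat card_of_less_set_plus_nat
    unfolding lang_def by (rule fm_in_large)
  then show ?thesis
    using Cinfinite_card_of_set_plus_nat Cinfinite_card_of_set_plus_nat
    unfolding fm_inf_inf_def fm_inf_def by blast
qed

lemma fm_in_subfms:
  assumes "\<phi> \<in> subfms \<psi>" "fm_in L \<kappa> \<mu> \<psi>"
  shows "fm_in L \<kappa> \<mu> \<phi>"
  using assms by induction auto

lemma finite_card_of_less: "\<lbrakk>finite A; Cinfinite \<mu>\<rbrakk> \<Longrightarrow> |A| <o \<mu>"
  by (intro Cfinite_ordLess_Cinfinite) (simp_all add: cfinite_def card_of_card_order_on Field_card_of)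

text \<open>For conjunctions and disjunctions the bound on the union is a clause of
  \<open>fm_in\<close>, so \<open>\<mu>\<close> may well be singular; atomic formulae have finitely
  many variables. The bound limits how many constants an instance of \<open>\<phi>\<close> can bring
  in.\<close>

lemma card_of_fv_less:
  fixes \<phi> :: "('r, 'c, 'v, 'i) fm"
  assumes "fm_in L \<kappa> \<mu> \<phi>" "Cinfinite \<mu>"
  shows "|fv \<phi>| <o \<mu>"
proof -
  have vars: "finite (vars_trm t)" for t :: "('c, 'v) trm"
    by (cases t) auto
  from assms(1) show ?thesis
  proof (induction \<phi>)
    case (All V \<phi>)
    then show ?case
      by simp (meson Diff_subset card_of_mono1 ordLeq_ordLess_trans)
  next
    case (Ex V \<phi>)
    then show ?case
      by simp (meson Diff_subset card_of_mono1 ordLeq_ordLess_trans)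
  qed (simp_all add: finite_card_of_less[OF _ assms(2)] vars)
qed

section \<open>Substituting constants for free variables\<close>

lemma shield_shield: "shield V (shield W \<sigma>) = shield (V \<union> W) \<sigma>"
  by (auto simp: shield_def override_on_def)

lemma shield_empty [simp]: "shield {} \<sigma> = \<sigma>"
  by (simp add: shield_def override_on_def)

text \<open>The set \<open>W\<close> collects the variables bound by the quantifiers passed so far,
  which the substitution leaves alone. The induction needs it; the case of interest is
  \<open>W = {}\<close>.\<close>

lemma lang_subst_consts_shield:
  assumes "lang L \<phi>" "g ` (fv \<phi> - W) \<subseteq> csyms L"
  shows "lang L (subst_fm \<phi> (shield W (\<lambda>x. Const (g x))))"
proof -
  have t: "trm_in L (subst_trm t (shield W (\<lambda>x. Const (g x))))"
    if "trm_in L t" "g ` (vars_trm t - W) \<subseteq> csyms L" for t W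
    using that by (cases t) (auto simp: shield_def override_on_def)
  show ?thesis
    using assms
  proof (induction \<phi> arbitrary: W)
    case (Rel R ts)
    then show ?case
      by (auto intro!: t)
  next
    case (Conj J f)
    have "lang L (subst_fm (f j) (shield W (\<lambda>x. Const (g x))))" if "j \<in> J" for j
      using that Conj.prems by (intro Conj.IH) auto
    then show ?case
      by simp
  next
    case (Disj J f)
    have "lang L (subst_fm (f j) (shield W (\<lambda>x. Const (g x))))" if "j \<in> J" for j
      using that Disj.prems by (intro Disj.IH) auto
    then show ?case
      by simp
  next
    case (All V \<phi>)
    have "g ` (fv \<phi> - (V \<union> W)) \<subseteq> csyms L"
      using All.prems by auto
    with All show ?case
      by (simp add: shield_shield)
  next
    case (Ex V \<phi>)
    have "g ` (fv \<phi> - (V \<union> W)) \<subseteq> csyms L"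
      using Ex.prems by auto
    with Ex show ?case
      by (simp add: shield_shield)
  qed (auto intro!: t)
qed

lemma lang_subst_consts:
  "\<lbrakk>lang L \<phi>; g ` fv \<phi> \<subseteq> csyms L\<rbrakk> \<Longrightarrow> lang L (subst_fm \<phi> (\<lambda>x. Const (g x)))"
  using lang_subst_consts_shield[of L \<phi> g "{}"] by simp

section \<open>Boolean values\<close>

lemma val_cong_fv:
  assumes "\<And>x. x \<in> fv \<phi> \<Longrightarrow> \<nu> x = \<nu>' x"
  shows "val B M \<phi> \<nu> = val B M \<phi> \<nu>'"
proof -
  have t: "val_trm M \<nu> t = val_trm M \<nu>' t" if "\<And>x. x \<in> vars_trm t \<Longrightarrow> \<nu> x = \<nu>' x" for \<nu> \<nu>' t
    using that by (cases t) auto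
  show ?thesis
    using assms
  proof (induction \<phi> arbitrary: \<nu> \<nu>')
    case (Eq s u)
    then show ?case
      using t[of s \<nu> \<nu>'] t[of u \<nu> \<nu>'] by simp
  next
    case (Rel R ts)
    have "val_trm M \<nu> u = val_trm M \<nu>' u" if "u \<in> set ts" for u
      using that Rel by (intro t) auto
    then have "map (val_trm M \<nu>) ts = map (val_trm M \<nu>') ts"
      by simp
    then show ?case
      by (simp only: val.simps)
  next
    case (Conj J f)
    have "val B M (f j) \<nu> = val B M (f j) \<nu>'" if "j \<in> J" for j
      using that Conj.prems by (intro Conj.IH) auto
    then show ?case
      by (simp cong: image_cong)
  next
    case (Disj J f)
    have "val B M (f j) \<nu> = val B M (f j) \<nu>'" if "j \<in> J" for j
      using that Disj.prems by (intro Disj.IH) auto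
    then show ?case
      by (simp cong: image_cong)
  next
    case (All V \<phi>)
    have "val B M \<phi> (override_on \<nu> a V) = val B M \<phi> (override_on \<nu>' a V)" for a
      using All.prems by (intro All.IH) (auto simp: override_on_def)
    then show ?case
      by simp
  next
    case (Ex V \<phi>)
    have "val B M \<phi> (override_on \<nu> a V) = val B M \<phi> (override_on \<nu>' a V)" for a
      using Ex.prems by (intro Ex.IH) (auto simp: override_on_def)
    then show ?case
      by simp
  next
    case (Neg \<phi>)
    have "val B M \<phi> \<nu> = val B M \<phi> \<nu>'"
      using Neg.prems by (intro Neg.IH) auto
    then show ?case
      by simp
  qed
qed

lemma val_sentence: "sentence \<phi> \<Longrightarrow> val B M \<phi> \<nu> = val B M \<phi> \<nu>'"
  by (rule val_cong_fv) (simp add: sentence_def)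

text \<open>Shielded variables are still read from \<open>\<nu>\<close>, all others from the
  constants chosen by \<open>g\<close>. For \<open>W = {}\<close> the assignment
  \<open>\<nu>\<close> disappears, so the value of an instance depends on the structure
  alone.\<close>

lemma val_subst_consts_shield:
  fixes M :: "('m, 'b, 'r, 'c) bv_structure" and \<phi> :: "('r, 'c, 'v, 'i) fm"
  shows "val B M (subst_fm \<phi> (shield W (\<lambda>x. Const (g x)))) \<nu> =
    val B M \<phi> (override_on (\<lambda>x. cstv M (g x)) \<nu> W)"
proof -
  have t: "val_trm M \<nu> (subst_trm t (shield W (\<lambda>x. Const (g x)))) =
      val_trm M (override_on (\<lambda>x. cstv M (g x)) \<nu> W) t"
    for t W and \<nu> :: "'v \<Rightarrow> 'm"
    by (cases t) (auto simp: shield_def override_on_def)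
  have o: "override_on k (override_on \<nu> a V) (V \<union> W) = override_on (override_on k \<nu> W) a V"
    for k \<nu> a :: "'v \<Rightarrow> 'm" and V W :: "'v set"
    by (auto simp: override_on_def)
  show ?thesis
    by (induction \<phi> arbitrary: W \<nu>) (simp_all add: t o shield_shield comp_def)
qed

lemma val_subst_consts:
  "val B M (subst_fm \<phi> (\<lambda>x. Const (g x))) \<nu> = val B M \<phi> (\<lambda>x. cstv M (g x))"
  using val_subst_consts_shield[of B M \<phi> "{}" g \<nu>] by simp

text \<open>Constants outside \<open>L\<close> may be reinterpreted at will. This is how witnesses
  get names and how models pass to an expanded signature.\<close>

lemma val_cong_signature:
  fixes M M' :: "('m, 'b, 'r, 'c) bv_structure" and \<phi> :: "('r, 'c, 'v, 'i) fm"
  assumes "lang L \<phi>" "dom M' = dom M" "eqv M' = eqv M" "relv M' = relv M"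
    and "\<And>c. c \<in> csyms L \<Longrightarrow> cstv M' c = cstv M c"
  shows "val B M' \<phi> \<nu> = val B M \<phi> \<nu>"
proof -
  have t: "trm_in L t \<Longrightarrow> val_trm M' \<nu> t = val_trm M \<nu> t" for t and \<nu> :: "'v \<Rightarrow> 'm"
    using assms(5) by (cases t) auto
  show ?thesis
    using assms(1)
  proof (induction \<phi> arbitrary: \<nu>)
    case (Rel R ts)
    then have "map (val_trm M' \<nu>) ts = map (val_trm M \<nu>) ts"
      by (simp add: t)
    then show ?case
      by (simp only: val.simps assms(4))
  qed (simp_all add: assms(2-4) t cong: image_cong)
qed

section \<open>Closure properties of Boolean valued models\<close>

lemma bv_modelD:
  assumes "bv_model L B M"
  shows "complete_boolean_algebra B" "dom M \<noteq> {}"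
    and "\<And>a b. \<lbrakk>a \<in> dom M; b \<in> dom M\<rbrakk> \<Longrightarrow> eqv M a b \<in> carrier B"
    and "\<And>R as. \<lbrakk>R \<in> rsyms L; as \<in> lists (dom M); length as = ar L R\<rbrakk> \<Longrightarrow> relv M R as \<in> carrier B"
    and "\<And>c. c \<in> csyms L \<Longrightarrow> cstv M c \<in> dom M"
    and "\<And>a. a \<in> dom M \<Longrightarrow> eqv M a a = \<top>\<^bsub>B\<^esub>"
    and "\<And>a b. \<lbrakk>a \<in> dom M; b \<in> dom M\<rbrakk> \<Longrightarrow> eqv M a b = eqv M b a"
proof -
  note D = assms[unfolded bv_model_def]
  show "complete_boolean_algebra B" "dom M \<noteq> {}"
    by (rule D[THEN conjunct1], rule D[THEN conjunct2, THEN conjunct1])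
  note D = D[THEN conjunct2, THEN conjunct2]
  show "eqv M a b \<in> carrier B" if "a \<in> dom M" "b \<in> dom M" for a b
    using D[THEN conjunct1] that by blast
  note D = D[THEN conjunct2]
  show "relv M R as \<in> carrier B" if "R \<in> rsyms L" "as \<in> lists (dom M)" "length as = ar L R" for R as
    using D[THEN conjunct1] that by blast
  note D = D[THEN conjunct2]
  show "cstv M c \<in> dom M" if "c \<in> csyms L" for c
    using D[THEN conjunct1] that by blast
  note D = D[THEN conjunct2]
  show "eqv M a a = \<top>\<^bsub>B\<^esub>" if "a \<in> dom M" for a
    using D[THEN conjunct1] that by blast
  note D = D[THEN conjunct2]
  show "eqv M a b = eqv M b a" if "a \<in> dom M" "b \<in> dom M" for a b
    using D[THEN conjunct1] that by blast
qed

lemma val_trm_closed: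
  "\<lbrakk>bv_model L B M; trm_in L t; \<nu> ` vars_trm t \<subseteq> dom M\<rbrakk> \<Longrightarrow> val_trm M \<nu> t \<in> dom M"
  by (cases t) (auto intro: bv_modelD)

lemma override_on_closed:
  "\<lbrakk>\<nu> ` (A - V) \<subseteq> D; a \<in> V \<rightarrow>\<^sub>E D\<rbrakk> \<Longrightarrow> override_on \<nu> a V ` A \<subseteq> D"
  by (auto simp: override_on_def PiE_def Pi_def)

lemma val_closed:
  assumes "bv_model L B M" "lang L \<phi>" "\<nu> ` fv \<phi> \<subseteq> dom M"
  shows "val B M \<phi> \<nu> \<in> carrier B"
proof -
  interpret cba B
    using bv_modelD(1)[OF assms(1)] by (simp add: cba_def)
  note t = val_trm_closed[OF assms(1)]
  show ?thesis
    using assms(2,3)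
  proof (induction \<phi> arbitrary: \<nu>)
    case (Eq s u)
    then have "val_trm M \<nu> s \<in> dom M" "val_trm M \<nu> u \<in> dom M"
      by (auto intro!: t)
    then show ?case
      using bv_modelD(3)[OF assms(1)] by simp
  next
    case (Rel R ts)
    then have "val_trm M \<nu> u \<in> dom M" if "u \<in> set ts" for u
      using that by (intro t) auto
    then have "map (val_trm M \<nu>) ts \<in> lists (dom M)"
      by auto
    then show ?case
      using bv_modelD(4)[OF assms(1)] Rel.prems by (simp del: in_lists_conv_set)
  next
    case (Conj J f)
    have "val B M (f j) \<nu> \<in> carrier B" if "j \<in> J" for j
      using that Conj.prems by (intro Conj.IH) auto
    then show ?case
      by (simp add: image_subset_iff)
  next
    case (Disj J f)
    have "val B M (f j) \<nu> \<in> carrier B" if "j \<in> J" for j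
      using that Disj.prems by (intro Disj.IH) auto
    then show ?case
      by (simp add: image_subset_iff)
  next
    case (All V \<phi>)
    have "val B M \<phi> (override_on \<nu> a V) \<in> carrier B" if "a \<in> V \<rightarrow>\<^sub>E dom M" for a
      using All.prems override_on_closed[OF _ that] by (intro All.IH) auto
    then show ?case
      by (simp add: image_subset_iff)
  next
    case (Ex V \<phi>)
    have "val B M \<phi> (override_on \<nu> a V) \<in> carrier B" if "a \<in> V \<rightarrow>\<^sub>E dom M" for a
      using Ex.prems override_on_closed[OF _ that] by (intro Ex.IH) auto
    then show ?case
      by (simp add: image_subset_iff)
  qed simp
qed

text \<open>The image of \<open>M\<close> under the homomorphism
  \<open>x \<mapsto> x \<sqinter> b\<close> onto the relative algebra, or the quotient of
  \<open>M\<close> by the filter generated by \<open>b\<close>.\<close>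

definition restrict_model :: "'b gorder \<Rightarrow> 'b \<Rightarrow> ('m, 'b, 'r, 'c) bv_structure \<Rightarrow> ('m, 'b, 'r, 'c) bv_structure"
  where "restrict_model B b M =
    M\<lparr>eqv := \<lambda>x y. eqv M x y \<sqinter>\<^bsub>B\<^esub> b, relv := \<lambda>R as. relv M R as \<sqinter>\<^bsub>B\<^esub> b\<rparr>"

lemma restrict_model_simps [simp]:
  "dom (restrict_model B b M) = dom M"
  "eqv (restrict_model B b M) x y = eqv M x y \<sqinter>\<^bsub>B\<^esub> b"
  "relv (restrict_model B b M) R as = relv M R as \<sqinter>\<^bsub>B\<^esub> b"
  "cstv (restrict_model B b M) = cstv M"
  by (simp_all add: restrict_model_def)

lemma val_trm_restrict: "val_trm (restrict_model B b M) \<nu> t = val_trm M \<nu> t"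
  by (cases t) auto

lemma val_trm_restrict_model [simp]: "val_trm (restrict_model B b M) = val_trm M"
  by (simp add: fun_eq_iff val_trm_restrict)

context cba
begin

text \<open>Transitivity and congruence are asked for lower bounds \<open>d\<close> in place of
  meets. In an algebra of sets of conditions they become statements about single conditions, and no
  meet has to be computed.\<close>

lemma bv_modelI:
  assumes "dom M \<noteq> {}"
    and "\<And>a b. \<lbrakk>a \<in> dom M; b \<in> dom M\<rbrakk> \<Longrightarrow> eqv M a b \<in> carrier B"
    and "\<And>R as. \<lbrakk>R \<in> rsyms L; as \<in> lists (dom M); length as = ar L R\<rbrakk> \<Longrightarrow> relv M R as \<in> carrier B"
    and "\<And>c. c \<in> csyms L \<Longrightarrow> cstv M c \<in> dom M"
    and "\<And>a. a \<in> dom M \<Longrightarrow> eqv M a a = \<top>"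
    and "\<And>a b. \<lbrakk>a \<in> dom M; b \<in> dom M\<rbrakk> \<Longrightarrow> eqv M a b = eqv M b a"
    and "\<And>a b c d. \<lbrakk>a \<in> dom M; b \<in> dom M; c \<in> dom M; d \<in> carrier B;
        d \<sqsubseteq> eqv M a b; d \<sqsubseteq> eqv M b c\<rbrakk> \<Longrightarrow> d \<sqsubseteq> eqv M a c"
    and "\<And>R as bs d. \<lbrakk>R \<in> rsyms L; as \<in> lists (dom M); bs \<in> lists (dom M); d \<in> carrier B;
        length as = ar L R; length bs = ar L R; \<And>i. i < ar L R \<Longrightarrow> d \<sqsubseteq> eqv M (as ! i) (bs ! i);
        d \<sqsubseteq> relv M R as\<rbrakk> \<Longrightarrow> d \<sqsubseteq> relv M R bs"
  shows "bv_model L B M"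
  unfolding bv_model_def
proof (intro conjI ballI impI)
  fix a b c
  assume "a \<in> dom M" "b \<in> dom M" "c \<in> dom M"
  then show "eqv M a b \<sqinter> eqv M b c \<sqsubseteq> eqv M a c"
    using assms(2) by (intro assms(7)[of a b c]) (simp_all add: meet_left meet_right)
next
  fix R as bs
  assume *: "R \<in> rsyms L" "as \<in> lists (dom M)" "bs \<in> lists (dom M)"
    and len: "length as = ar L R" "length bs = ar L R"
  let ?E = "(\<lambda>i. eqv M (as ! i) (bs ! i)) ` {..<ar L R}"
  have E: "?E \<subseteq> carrier B"
    using * len by (intro image_subsetI assms(2)) (simp_all add: in_lists_conv_set)
  have c: "relv M R as \<in> carrier B" "\<Sqinter>?E \<in> carrier B"
    using assms(3)[OF *(1,2) len(1)] E by simp_all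
  show "\<Sqinter>?E \<sqinter> relv M R as \<sqsubseteq> relv M R bs"
  proof (rule assms(8)[OF * _ len])
    fix i
    assume "i < ar L R"
    then show "\<Sqinter>?E \<sqinter> relv M R as \<sqsubseteq> eqv M (as ! i) (bs ! i)"
      using le_inf_iff[OF E, of "\<Sqinter>?E \<sqinter> relv M R as"] c by (simp add: meet_left)
  qed (use c in \<open>simp_all add: meet_right\<close>)
qed (fact assms complete_boolean_algebra_axioms | rule assms; assumption)+

lemma bv_model_transD:
  assumes "bv_model L B M" "a \<in> dom M" "b \<in> dom M" "c \<in> dom M" "d \<in> carrier B"
    and "d \<sqsubseteq> eqv M a b" "d \<sqsubseteq> eqv M b c"
  shows "d \<sqsubseteq> eqv M a c"
proof -
  note cl = bv_modelD(3)[OF assms(1)]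
  have "eqv M a b \<sqinter> eqv M b c \<sqsubseteq> eqv M a c"
    using assms(1)[unfolded bv_model_def, THEN conjunct2, THEN conjunct2, THEN conjunct2, THEN conjunct2,
        THEN conjunct2, THEN conjunct2, THEN conjunct2, THEN conjunct1] assms(2-4) by blast
  moreover have "d \<sqsubseteq> eqv M a b \<sqinter> eqv M b c"
    using assms(2-) by (intro meet_le cl)
  ultimately show ?thesis
    using assms(2-5) cl le_trans[of d "eqv M a b \<sqinter> eqv M b c" "eqv M a c"] by simp
qed

lemma bv_model_relD:
  assumes "bv_model L B M" "R \<in> rsyms L" "as \<in> lists (dom M)" "bs \<in> lists (dom M)"
    and "d \<in> carrier B" "length as = ar L R" "length bs = ar L R"
    and "\<And>i. i < ar L R \<Longrightarrow> d \<sqsubseteq> eqv M (as ! i) (bs ! i)" "d \<sqsubseteq> relv M R as"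
  shows "d \<sqsubseteq> relv M R bs"
proof -
  let ?E = "(\<lambda>i. eqv M (as ! i) (bs ! i)) ` {..<ar L R}"
  have E: "?E \<subseteq> carrier B"
    using assms(3,4,6,7) by (intro image_subsetI bv_modelD(3)[OF assms(1)]) (simp_all add: in_lists_conv_set)
  have c: "relv M R as \<in> carrier B" "relv M R bs \<in> carrier B" "\<Sqinter>?E \<in> carrier B"
    using bv_modelD(4)[OF assms(1,2)] assms(3,4,6,7) E by simp_all
  have "\<Sqinter>?E \<sqinter> relv M R as \<sqsubseteq> relv M R bs"
    using assms(1)[unfolded bv_model_def, THEN conjunct2, THEN conjunct2, THEN conjunct2, THEN conjunct2,
        THEN conjunct2, THEN conjunct2, THEN conjunct2, THEN conjunct2] assms(2-4,6,7) by blast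
  moreover have "d \<sqsubseteq> \<Sqinter>?E \<sqinter> relv M R as"
    using assms(5,8,9) c by (intro meet_le) (simp_all add: le_inf_iff[OF E])
  ultimately show ?thesis
    using assms(5) c le_trans[of d "\<Sqinter>?E \<sqinter> relv M R as" "relv M R bs"] by simp
qed

lemma bv_model_restrict:
  assumes M: "bv_model L B M" and b: "b \<in> carrier B" "b \<noteq> \<bottom>"
  shows "bv_model L (below B b) (restrict_model B b M)"
proof -
  interpret C: cba "below B b"
    using complete_boolean_algebra_below[OF b] by (simp add: cba_def)
  have le_meet: "d \<sqsubseteq> x \<sqinter> b \<longleftrightarrow> d \<sqsubseteq> x" if "d \<in> carrier B" "d \<sqsubseteq> b" "x \<in> carrier B" for d x
    using that b by (meson le_trans meet_closed meet_le meet_left)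
  have top: "\<top> \<sqinter> b = b"
    using b le_iff_join[of b \<top>] by (simp add: meet_comm)
  have nth: "as ! i \<in> dom M" if "as \<in> lists (dom M)" "i < length as" for as i
    using that by (metis in_lists_conv_set nth_mem)
  show ?thesis
  proof (rule C.bv_modelI)
    fix x y z d
    assume "x \<in> dom (restrict_model B b M)" "y \<in> dom (restrict_model B b M)"
      "z \<in> dom (restrict_model B b M)" "d \<in> carrier (below B b)"
      "d \<sqsubseteq>\<^bsub>below B b\<^esub> eqv (restrict_model B b M) x y" "d \<sqsubseteq>\<^bsub>below B b\<^esub> eqv (restrict_model B b M) y z"
    then show "d \<sqsubseteq>\<^bsub>below B b\<^esub> eqv (restrict_model B b M) x z"
      using bv_model_transD[OF M, of x y z d] bv_modelD(3)[OF M] by (simp add: le_meet)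
  next
    fix R as bs d
    assume *: "R \<in> rsyms L" "as \<in> lists (dom (restrict_model B b M))" "bs \<in> lists (dom (restrict_model B b M))"
      "d \<in> carrier (below B b)" "length as = ar L R" "length bs = ar L R"
      "\<And>i. i < ar L R \<Longrightarrow> d \<sqsubseteq>\<^bsub>below B b\<^esub> eqv (restrict_model B b M) (as ! i) (bs ! i)"
      "d \<sqsubseteq>\<^bsub>below B b\<^esub> relv (restrict_model B b M) R as"
    have "d \<sqsubseteq> eqv M (as ! i) (bs ! i)" if "i < ar L R" for i
      using * that nth bv_modelD(3)[OF M] by (simp add: le_meet del: in_lists_conv_set)
    with * show "d \<sqsubseteq>\<^bsub>below B b\<^esub> relv (restrict_model B b M) R bs"
      using bv_model_relD[OF M, of R as bs d] bv_modelD(4)[OF M, of R]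
      by (simp add: le_meet del: in_lists_conv_set)
  next
    fix x y
    assume "x \<in> dom (restrict_model B b M)" "y \<in> dom (restrict_model B b M)"
    then show "eqv (restrict_model B b M) x y = eqv (restrict_model B b M) y x"
      using bv_modelD(7)[OF M, of x y] by simp
  qed (use bv_modelD[OF M] b in \<open>simp_all add: top top_below meet_right del: in_lists_conv_set\<close>)
qed

lemma le_inf_below_iff:
  assumes b: "b \<in> carrier B" "b \<noteq> \<bottom>" and d: "d \<in> carrier B" "d \<sqsubseteq> b"
    and c: "\<And>x. x \<in> X \<Longrightarrow> v' x \<in> carrier (below B b)" "\<And>x. x \<in> X \<Longrightarrow> v x \<in> carrier B"
    and IH: "\<And>x. x \<in> X \<Longrightarrow> d \<sqsubseteq> v' x \<longleftrightarrow> d \<sqsubseteq> v x"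
  shows "d \<sqsubseteq> \<Sqinter>\<^bsub>below B b\<^esub> (v' ` X) \<longleftrightarrow> d \<sqsubseteq> \<Sqinter> (v ` X)"
proof -
  interpret C: cba "below B b"
    using complete_boolean_algebra_below[OF b] by (simp add: cba_def)
  show ?thesis
    using c d IH C.le_inf_iff[of "v' ` X" d] by (simp add: image_subset_iff le_inf_iff)
qed

text \<open>By \<open>le_sup_iff\<close>, applied in both algebras, joins are compared through
  non-zero parts. Hence the hypothesis \<open>IH\<close> concerns all
  \<open>e \<sqsubseteq> b\<close>, whereas for infima the element \<open>d\<close> alone
  suffices.\<close>

lemma le_sup_below_iff:
  assumes b: "b \<in> carrier B" "b \<noteq> \<bottom>" and d: "d \<in> carrier B" "d \<sqsubseteq> b"
    and c: "\<And>x. x \<in> X \<Longrightarrow> v' x \<in> carrier (below B b)" "\<And>x. x \<in> X \<Longrightarrow> v x \<in> carrier B"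
    and IH: "\<And>x e. \<lbrakk>x \<in> X; e \<in> carrier B; e \<sqsubseteq> b\<rbrakk> \<Longrightarrow> e \<sqsubseteq> v' x \<longleftrightarrow> e \<sqsubseteq> v x"
  shows "d \<sqsubseteq> \<Squnion>\<^bsub>below B b\<^esub> (v' ` X) \<longleftrightarrow> d \<sqsubseteq> \<Squnion> (v ` X)"
proof -
  interpret C: cba "below B b"
    using complete_boolean_algebra_below[OF b] by (simp add: cba_def)
  have le_b: "e \<sqsubseteq> b" if "e \<sqsubseteq> d" "d \<sqsubseteq> b" "e \<in> carrier B" "d \<in> carrier B" for d e
    using that b le_trans[of e d b] by simp
  have "d \<sqsubseteq> \<Squnion>\<^bsub>below B b\<^esub> (v' ` X) \<longleftrightarrow>
      (\<forall>c\<in>carrier B. c \<sqsubseteq> b \<longrightarrow> c \<sqsubseteq> d \<longrightarrow> c \<noteq> \<bottom> \<longrightarrow>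
        (\<exists>e\<in>carrier B. e \<sqsubseteq> b \<and> e \<sqsubseteq> c \<and> e \<noteq> \<bottom> \<and> (\<exists>x\<in>X. e \<sqsubseteq> v' x)))"
    using C.le_sup_iff[of "v' ` X" d] c d bottom_below[OF b]
    by (simp add: image_subset_iff Ball_def Bex_def imp_conjL conj_assoc)
  \<comment> \<open>Whatever lies below \<open>d\<close> lies below \<open>b\<close>, so the bounds
    by \<open>b\<close> hold automatically and \<open>IH\<close> applies to every \<open>e\<close>
    in question.\<close>
  also have "\<dots> \<longleftrightarrow> (\<forall>c\<in>carrier B. c \<sqsubseteq> d \<longrightarrow> c \<noteq> \<bottom> \<longrightarrow>
        (\<exists>e\<in>carrier B. e \<sqsubseteq> c \<and> e \<noteq> \<bottom> \<and> (\<exists>x\<in>X. e \<sqsubseteq> v x)))"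
    using IH le_b d by (smt (verit))
  also have "\<dots> \<longleftrightarrow> d \<sqsubseteq> \<Squnion> (v ` X)"
    using c d by (simp add: image_subset_iff le_sup_iff)
  finally show ?thesis .
qed

text \<open>Comparing lower bounds \<open>d \<sqsubseteq> b\<close> avoids computing the cut values.
  The element \<open>d\<close> varies in the induction because complements and joins are tested on
  smaller elements.\<close>

lemma le_val_restrict_iff:
  fixes \<phi> :: "('r, 'c, 'v, 'i) fm"
  assumes M: "bv_model L B M" and b: "b \<in> carrier B" "b \<noteq> \<bottom>"
    and "lang L \<phi>" "\<nu> ` fv \<phi> \<subseteq> dom M" "d \<in> carrier B" "d \<sqsubseteq> b"
  shows "d \<sqsubseteq> val (below B b) (restrict_model B b M) \<phi> \<nu> \<longleftrightarrow> d \<sqsubseteq> val B M \<phi> \<nu>"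
proof -
  let ?M = "restrict_model B b M"
  interpret C: cba "below B b"
    using complete_boolean_algebra_below[OF b] by (simp add: cba_def)
  have M': "bv_model L (below B b) ?M"
    by (rule bv_model_restrict) (fact M b)+
  have le_meet: "d \<sqsubseteq> x \<sqinter> b \<longleftrightarrow> d \<sqsubseteq> x" if "d \<in> carrier B" "d \<sqsubseteq> b" "x \<in> carrier B" for d x
    using that b by (meson le_trans meet_closed meet_le meet_left)
  have bot: "\<bottom>\<^bsub>below B b\<^esub> = \<bottom>"
    by (rule bottom_below) (fact b)+
  have le_b: "e \<sqsubseteq> b" if "e \<sqsubseteq> d" "d \<sqsubseteq> b" "e \<in> carrier B" "d \<in> carrier B" for d e
    using that b le_trans[of e d b] by simp
  have vM: "val B M \<phi> \<nu> \<in> carrier B" if "lang L \<phi>" "\<nu> ` fv \<phi> \<subseteq> dom M" for \<phi> :: "('r, 'c, 'v, 'i) fm" and \<nu>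
    using val_closed[OF M] that by simp
  have vM': "val (below B b) ?M \<phi> \<nu> \<in> carrier (below B b)" if "lang L \<phi>" "\<nu> ` fv \<phi> \<subseteq> dom M" for \<phi> :: "('r, 'c, 'v, 'i) fm" and \<nu>
    using val_closed[OF M'] that by simp
  show ?thesis
    using assms(4-)
  proof (induction \<phi> arbitrary: \<nu> d)
    case (Eq s t)
    then show ?case
      using vM[of "Eq s t" \<nu>] by (simp add: le_meet)
  next
    case (Rel R ts)
    then show ?case
      using vM[of "Rel R ts" \<nu>] by (simp add: le_meet)
  next
    case (Neg \<phi>)
    let ?v = "val B M \<phi> \<nu>" and ?v' = "val (below B b) ?M \<phi> \<nu>"
    have c: "?v \<in> carrier B" "?v' \<in> carrier (below B b)"
      using vM[of \<phi> \<nu>] vM'[of \<phi> \<nu>] Neg.prems by simp_all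
    have IH: "e \<sqsubseteq> ?v' \<longleftrightarrow> e \<sqsubseteq> ?v" if "e \<in> carrier B" "e \<sqsubseteq> d" for e
      using Neg.prems that le_b[of e d] by (intro Neg.IH) simp_all
    have "d \<sqsubseteq> bcompl (below B b) ?v' \<longleftrightarrow> (\<forall>e\<in>carrier B. e \<sqsubseteq> b \<longrightarrow> e \<sqsubseteq> d \<longrightarrow> e \<sqsubseteq> ?v' \<longrightarrow> e = \<bottom>)"
      using C.le_bcompl_iff_disjoint[of d ?v'] c Neg.prems by (simp add: bot Ball_def imp_conjL)
    also have "\<dots> \<longleftrightarrow> (\<forall>e\<in>carrier B. e \<sqsubseteq> d \<longrightarrow> e \<sqsubseteq> ?v \<longrightarrow> e = \<bottom>)"
    proof (rule ball_cong[OF HOL.refl])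
      fix e
      assume "e \<in> carrier B"
      then show "(e \<sqsubseteq> b \<longrightarrow> e \<sqsubseteq> d \<longrightarrow> e \<sqsubseteq> ?v' \<longrightarrow> e = \<bottom>) \<longleftrightarrow> (e \<sqsubseteq> d \<longrightarrow> e \<sqsubseteq> ?v \<longrightarrow> e = \<bottom>)"
        using IH[of e] le_b[of e d] Neg.prems by (cases "e \<sqsubseteq> d") simp_all
    qed
    also have "\<dots> \<longleftrightarrow> d \<sqsubseteq> bcompl B ?v"
      using c Neg.prems by (simp add: le_bcompl_iff_disjoint)
    finally show ?case
      by simp
  next
    case (Conj J f)
    have p: "lang L (f j)" "\<nu> ` fv (f j) \<subseteq> dom M" if "j \<in> J" for j
      using that Conj.prems by auto
    show ?case
      using le_inf_below_iff[OF b Conj.prems(3,4) vM'[OF p] vM[OF p] Conj.IH[OF _ p Conj.prems(3,4)]] by simp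
  next
    case (Disj J f)
    have p: "lang L (f j)" "\<nu> ` fv (f j) \<subseteq> dom M" if "j \<in> J" for j
      using that Disj.prems by auto
    show ?case
      using le_sup_below_iff[OF b Disj.prems(3,4) vM'[OF p] vM[OF p] Disj.IH[OF _ p]] by simp
  next
    case (All V \<phi>)
    have p: "lang L \<phi>" "override_on \<nu> a V ` fv \<phi> \<subseteq> dom M" if "a \<in> V \<rightarrow>\<^sub>E dom M" for a
      using that All.prems override_on_closed[OF _ that] by auto
    show ?case
      using le_inf_below_iff[OF b All.prems(3,4) vM'[OF p] vM[OF p] All.IH[OF p All.prems(3,4)]] by simp
  next
    case (Ex V \<phi>)
    have p: "lang L \<phi>" "override_on \<nu> a V ` fv \<phi> \<subseteq> dom M" if "a \<in> V \<rightarrow>\<^sub>E dom M" for a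
      using that Ex.prems override_on_closed[OF _ that] by auto
    show ?case
      using le_sup_below_iff[OF b Ex.prems(3,4) vM'[OF p] vM[OF p] Ex.IH[OF p]] by simp
  qed
qed

end

text \<open>Restricting to the part of the algebra below \<open>b\<close> turns values above \<open>b\<close> into \<open>1\<close>.\<close>

lemma bool_consistentI_nonzero:
  fixes B :: "'u gorder" and M :: "('u, 'u, 'r, 'c) bv_structure"
  assumes "bv_model L B M" "range \<nu> \<subseteq> dom M" "b \<in> carrier B" "b \<noteq> \<bottom>\<^bsub>B\<^esub>"
    and "\<And>\<phi>. \<phi> \<in> \<Gamma> \<Longrightarrow> lang L \<phi> \<and> b \<sqsubseteq>\<^bsub>B\<^esub> val B M \<phi> \<nu>"
  shows "bool_consistent (U :: 'u itself) L \<Gamma>"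
proof -
  interpret cba B
    using bv_modelD(1)[OF assms(1)] by (simp add: cba_def)
  interpret C: cba "below B b"
    using complete_boolean_algebra_below assms(3,4) by (simp add: cba_def)
  have M': "bv_model L (below B b) (restrict_model B b M)"
    using assms by (intro bv_model_restrict)
  have "val (below B b) (restrict_model B b M) \<phi> \<nu> = \<top>\<^bsub>below B b\<^esub>" if "\<phi> \<in> \<Gamma>" for \<phi>
  proof -
    have \<nu>: "\<nu> ` fv \<phi> \<subseteq> dom M"
      using assms(2) by blast
    then have "b \<sqsubseteq>\<^bsub>B\<^esub> val (below B b) (restrict_model B b M) \<phi> \<nu>"
      using assms that by (subst le_val_restrict_iff) auto
    moreover have "val (below B b) (restrict_model B b M) \<phi> \<nu> \<in> carrier (below B b)"
      using \<nu> assms(5)[OF that] by (intro val_closed[OF M']) simp_all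
    ultimately show ?thesis
      using C.top_le_iff[of "val (below B b) (restrict_model B b M) \<phi> \<nu>"] assms(3,4)
      by (simp add: top_below)
  qed
  with M' assms(2) show ?thesis
    unfolding bool_consistent_def by (intro exI[of _ "below B b"] exI[of _ "restrict_model B b M"] exI[of _ \<nu>]) auto
qed

section \<open>The regular open algebra of a set of conditions\<close>

text \<open>Larger conditions are stronger. The regular open sets are encoded as elements of \<open>'u\<close> by \<open>e\<close>.\<close>

locale conditions =
  fixes P :: "'a set set" and e :: "'a set set \<Rightarrow> 'u"
  assumes nonempty: "P \<noteq> {}" and inj: "inj e"
begin

text \<open>On upward closed sets this is the interior of the closure, in the topology whose open
  sets are the upward closed ones: the conditions above which \<open>X\<close> is dense.\<close>

definition reg :: "'a set set \<Rightarrow> 'a set set" where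
  "reg X = {p \<in> P. \<forall>q\<in>P. p \<subseteq> q \<longrightarrow> (\<exists>r\<in>P. q \<subseteq> r \<and> r \<in> X)}"

definition up :: "'a set set \<Rightarrow> bool" where
  "up X \<longleftrightarrow> X \<subseteq> P \<and> (\<forall>p\<in>X. \<forall>q\<in>P. p \<subseteq> q \<longrightarrow> q \<in> X)"

definition RO :: "'a set set set" where
  "RO = {X. up X \<and> reg X \<subseteq> X}"

definition dec :: "'u \<Rightarrow> 'a set set" where
  "dec = inv e"

definition alg :: "'u gorder" where
  "alg = \<lparr>carrier = e ` RO, eq = (=), le = \<lambda>x y. dec x \<subseteq> dec y\<rparr>"

text \<open>The interior of the complement of \<open>X\<close>, as in the forcing clause for
  negation.\<close>

definition neg :: "'a set set \<Rightarrow> 'a set set" where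
  "neg X = {p \<in> P. \<forall>q\<in>P. p \<subseteq> q \<longrightarrow> q \<notin> X}"

lemma dec_e [simp]: "dec (e X) = X"
  using inj by (simp add: dec_def)

lemma carrier_alg [simp]: "carrier alg = e ` RO"
  and le_alg [simp]: "x \<sqsubseteq>\<^bsub>alg\<^esub> y \<longleftrightarrow> dec x \<subseteq> dec y"
  and eq_alg: "eq alg = (=)"
  by (simp_all add: alg_def)

lemma up_reg: "up X \<Longrightarrow> up (reg X)"
  unfolding up_def reg_def by (auto intro: subset_trans)

lemma up_Union:
  assumes "\<And>X. X \<in> \<X> \<Longrightarrow> up X"
  shows "up (\<Union>\<X>)"
  unfolding up_def
proof (intro conjI ballI impI)
  show "\<Union>\<X> \<subseteq> P"
    using assms by (auto simp: up_def)
  fix p q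
  assume "p \<in> \<Union>\<X>" "q \<in> P" "p \<subseteq> q"
  then obtain X where "X \<in> \<X>" "q \<in> X"
    using assms by (auto simp: up_def)
  then show "q \<in> \<Union>\<X>"
    by blast
qed

lemma subset_reg: "up X \<Longrightarrow> X \<subseteq> reg X"
  unfolding up_def reg_def by blast

lemma reg_in_RO: "up X \<Longrightarrow> reg X \<in> RO"
proof -
  assume X: "up X"
  have "p \<in> reg X" if p: "p \<in> reg (reg X)" for p
    unfolding reg_def
  proof (intro CollectI conjI ballI impI)
    show "p \<in> P"
      using p by (simp add: reg_def)
    fix q
    assume "q \<in> P" "p \<subseteq> q"
    then have "\<exists>r\<in>P. q \<subseteq> r \<and> r \<in> reg X"
      using p by (simp add: reg_def[of "reg X"])
    then obtain r where r: "r \<in> P" "q \<subseteq> r" "r \<in> reg X"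
      by blast
    then have "\<exists>s\<in>P. r \<subseteq> s \<and> s \<in> X"
      by (simp add: reg_def)
    with r show "\<exists>s\<in>P. q \<subseteq> s \<and> s \<in> X"
      by (meson subset_trans)
  qed
  then show "reg X \<in> RO"
    using up_reg[OF X] by (auto simp: RO_def)
qed

lemma RO_up: "X \<in> RO \<Longrightarrow> up X"
  by (simp add: RO_def)

lemma RO_subset: "\<lbrakk>X \<in> RO; p \<in> X\<rbrakk> \<Longrightarrow> p \<in> P"
  by (auto simp: RO_def up_def)

lemma RO_mono: "\<lbrakk>X \<in> RO; p \<in> X; q \<in> P; p \<subseteq> q\<rbrakk> \<Longrightarrow> q \<in> X"
  by (auto simp: RO_def up_def)

text \<open>This is how a condition is shown to force something that only its extensions visibly
  force: extend an arbitrary stronger condition by the missing formula, then return by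
  density.\<close>

lemma RO_dense:
  assumes "X \<in> RO" "p \<in> P" "\<And>q. \<lbrakk>q \<in> P; p \<subseteq> q\<rbrakk> \<Longrightarrow> \<exists>r\<in>P. q \<subseteq> r \<and> r \<in> X"
  shows "p \<in> X"
  using assms by (auto simp: RO_def reg_def)

lemma RO_eq_P: "\<lbrakk>X \<in> RO; P \<subseteq> X\<rbrakk> \<Longrightarrow> X = P"
  by (auto dest: RO_subset)

lemma neg_in_RO:
  assumes "up X"
  shows "neg X \<in> RO"
proof -
  have "up (neg X)"
    by (auto simp: up_def neg_def)
  moreover have "reg (neg X) \<subseteq> neg X"
  proof
    fix p
    assume p: "p \<in> reg (neg X)"
    have "q \<notin> X" if "q \<in> P" "p \<subseteq> q" for q
    proof
      assume "q \<in> X"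
      have "\<exists>r\<in>P. q \<subseteq> r \<and> r \<in> neg X"
        using p that by (simp add: reg_def)
      then obtain r where r: "r \<in> P" "q \<subseteq> r" "r \<in> neg X"
        by blast
      then have "r \<in> X"
        using assms \<open>q \<in> X\<close> by (simp add: up_def)
      then show False
        using r by (simp add: neg_def)
    qed
    then show "p \<in> neg X"
      using p by (auto simp: neg_def reg_def)
  qed
  ultimately show ?thesis
    by (simp add: RO_def)
qed

lemma neg_neg:
  assumes "X \<in> RO"
  shows "neg (neg X) = X"
proof
  show "neg (neg X) \<subseteq> X"
  proof
    fix p
    assume p: "p \<in> neg (neg X)"
    show "p \<in> X"
    proof (rule RO_dense[OF assms])
      show "p \<in> P"
        using p by (simp add: neg_def)
      fix q
      assume "q \<in> P" "p \<subseteq> q"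
      then have "q \<notin> neg X"
        using p by (simp add: neg_def[of "neg X"])
      then show "\<exists>r\<in>P. q \<subseteq> r \<and> r \<in> X"
        using \<open>q \<in> P\<close> by (simp add: neg_def)
    qed
  qed
  show "X \<subseteq> neg (neg X)"
  proof
    fix p
    assume "p \<in> X"
    then have "q \<notin> neg X" if "q \<in> P" "p \<subseteq> q" for q
      using RO_mono[OF assms, of p q] that by (auto simp: neg_def)
    with \<open>p \<in> X\<close> show "p \<in> neg (neg X)"
      using RO_subset[OF assms] by (simp add: neg_def[of "neg X"])
  qed
qed

lemma empty_in_RO: "{} \<in> RO"
  by (auto simp: RO_def up_def reg_def)

lemma P_in_RO: "P \<in> RO"
  by (auto simp: RO_def up_def reg_def)

lemma Inter_in_RO:
  assumes "\<X> \<subseteq> RO"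
  shows "{p \<in> P. \<forall>X\<in>\<X>. p \<in> X} \<in> RO" (is "?I \<in> RO")
proof -
  have "up ?I"
    using assms RO_mono by (fastforce simp: up_def)
  moreover have "reg ?I \<subseteq> ?I"
  proof (intro subsetI CollectI conjI ballI)
    fix p X
    assume p: "p \<in> reg ?I" and X: "X \<in> \<X>"
    show "p \<in> X"
    proof (rule RO_dense)
      show "X \<in> RO" "p \<in> P"
        using X assms p by (auto simp: reg_def)
      fix q
      assume "q \<in> P" "p \<subseteq> q"
      then have "\<exists>r\<in>P. q \<subseteq> r \<and> r \<in> ?I"
        using p by (simp add: reg_def)
      then show "\<exists>r\<in>P. q \<subseteq> r \<and> r \<in> X"
        using X by blast
    qed
  qed (simp add: reg_def)
  ultimately show ?thesis
    by (simp add: RO_def)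
qed

text \<open>If a member of \<open>C\<close> were outside \<open>neg X\<close>, some extension of it
  would lie in \<open>C \<inter> X\<close>, which is regular open and may be taken as
  \<open>D\<close>. This is the law that \<open>complete_boolean_algebraI\<close> asks for.\<close>

lemma subset_neg_iff:
  assumes "C \<in> RO" "X \<in> RO"
  shows "C \<subseteq> neg X \<longleftrightarrow> (\<forall>D\<in>RO. D \<subseteq> C \<longrightarrow> D \<subseteq> X \<longrightarrow> D = {})"
proof
  assume "C \<subseteq> neg X"
  then show "\<forall>D\<in>RO. D \<subseteq> C \<longrightarrow> D \<subseteq> X \<longrightarrow> D = {}"
    unfolding neg_def by blast
next
  assume D: "\<forall>D\<in>RO. D \<subseteq> C \<longrightarrow> D \<subseteq> X \<longrightarrow> D = {}"
  have "{p \<in> P. \<forall>Y\<in>{C, X}. p \<in> Y} \<in> RO"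
    using assms by (intro Inter_in_RO) auto
  with D have "{p \<in> P. \<forall>Y\<in>{C, X}. p \<in> Y} = {}"
    by (metis (no_types, lifting) insertCI mem_Collect_eq subsetI)
  then show "C \<subseteq> neg X"
    using assms(1) unfolding neg_def by (auto dest: RO_subset RO_mono)
qed

section \<open>The complete Boolean algebra of regular open sets\<close>

lemma partial_order_alg: "partial_order alg"
  by unfold_locales (auto simp: eq_alg)

lemma complete_lattice_alg: "complete_lattice alg"
proof (rule complete_lattice_InfI[OF partial_order_alg, of "e P"])
  fix A
  assume A: "A \<subseteq> carrier alg" "A \<noteq> {}"
  let ?i = "{p \<in> P. \<forall>X\<in>dec ` A. p \<in> X}"
  have "dec ` A \<subseteq> RO"
    using A by auto
  then have "?i \<in> RO"
    by (rule Inter_in_RO)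
  then show "\<exists>i\<in>carrier alg. (\<forall>x\<in>A. i \<sqsubseteq>\<^bsub>alg\<^esub> x) \<and>
      (\<forall>y\<in>carrier alg. (\<forall>x\<in>A. y \<sqsubseteq>\<^bsub>alg\<^esub> x) \<longrightarrow> y \<sqsubseteq>\<^bsub>alg\<^esub> i)"
    by (intro bexI[of _ "e ?i"]) (auto dest: RO_subset)
qed (auto simp: P_in_RO dest: RO_subset)

interpretation A: complete_lattice alg
  by (rule complete_lattice_alg)

lemma bottom_alg: "\<bottom>\<^bsub>alg\<^esub> = e {}"
  using A.bottom_lower[of "e {}"] A.bottom_closed empty_in_RO by auto

lemma top_alg: "\<top>\<^bsub>alg\<^esub> = e P"
  using A.top_higher[of "e P"] A.top_closed P_in_RO RO_eq_P by auto

lemma complete_boolean_algebra_alg: "complete_boolean_algebra alg"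
proof (rule complete_boolean_algebraI[OF complete_lattice_alg, where neg = "\<lambda>x. e (neg (dec x))"])
  fix c x
  assume cx: "c \<in> carrier alg" "x \<in> carrier alg"
  then obtain C X where CX: "c = e C" "x = e X" "C \<in> RO" "X \<in> RO"
    by auto
  then have "C \<subseteq> neg X \<longleftrightarrow> (\<forall>D\<in>RO. D \<subseteq> C \<longrightarrow> D \<subseteq> X \<longrightarrow> D = {})"
    by (intro subset_neg_iff)
  moreover have "e D = e {} \<longleftrightarrow> D = {}" for D
    using inj by (simp add: inj_eq)
  ultimately show "c \<sqsubseteq>\<^bsub>alg\<^esub> e (neg (dec x)) \<longleftrightarrow>
      (\<forall>d\<in>carrier alg. d \<sqsubseteq>\<^bsub>alg\<^esub> c \<longrightarrow> d \<sqsubseteq>\<^bsub>alg\<^esub> x \<longrightarrow> d = \<bottom>\<^bsub>alg\<^esub>)"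
    using CX by (simp add: bottom_alg)
next
  show "\<bottom>\<^bsub>alg\<^esub> \<noteq> \<top>\<^bsub>alg\<^esub>"
    using inj nonempty by (simp add: bottom_alg top_alg inj_eq)
next
  fix x
  assume "x \<in> carrier alg"
  then obtain X where X: "x = e X" "X \<in> RO"
    by auto
  then show "e (neg (dec x)) \<in> carrier alg" "e (neg (dec (e (neg (dec x))))) = x"
    by (simp_all add: neg_in_RO neg_neg RO_up)
qed

interpretation B: cba alg
  by (simp add: cba_def complete_boolean_algebra_alg)

lemma dec_RO: "x \<in> carrier alg \<Longrightarrow> dec x \<in> RO"
  by auto

lemma eq_topI:
  assumes "x \<in> carrier alg" "P \<subseteq> dec x"
  shows "x = \<top>\<^bsub>alg\<^esub>"
proof -
  obtain X where "x = e X" "X \<in> RO"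
    using assms by auto
  with assms(2) show ?thesis
    using RO_eq_P[of X] by (simp add: top_alg)
qed

lemma dec_bcompl:
  assumes "x \<in> carrier alg"
  shows "dec (bcompl alg x) = neg (dec x)"
proof -
  obtain X where X: "x = e X" "X \<in> RO"
    using assms by auto
  then have n: "neg X \<in> RO"
    by (simp add: neg_in_RO RO_up)
  have b: "dec (bcompl alg x) \<in> RO"
    using B.bcompl_closed[OF assms] by (rule dec_RO)
  have le: "C \<subseteq> dec (bcompl alg x) \<longleftrightarrow> C \<subseteq> neg X" if C: "C \<in> RO" for C
    using B.le_bcompl_iff_disjoint[of "e C" x] X C inj
    by (simp add: subset_neg_iff bottom_alg inj_eq)
  from le[OF b] le[OF n] X show ?thesis
    by simp
qed

lemma dec_inf:
  assumes "X \<subseteq> carrier alg"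
  shows "dec (\<Sqinter>\<^bsub>alg\<^esub>X) = {p \<in> P. \<forall>x\<in>X. p \<in> dec x}"
proof
  let ?i = "{p \<in> P. \<forall>Y\<in>dec ` X. p \<in> Y}"
  have i: "?i \<in> RO"
    using assms by (intro Inter_in_RO) auto
  have c: "\<Sqinter>\<^bsub>alg\<^esub>X \<in> carrier alg"
    using assms by (rule A.inf_closed)
  have "dec (\<Sqinter>\<^bsub>alg\<^esub>X) \<subseteq> dec x" if "x \<in> X" for x
    using A.inf_lower[OF assms that] by simp
  then show "dec (\<Sqinter>\<^bsub>alg\<^esub>X) \<subseteq> {p \<in> P. \<forall>x\<in>X. p \<in> dec x}"
    using RO_subset[OF dec_RO[OF c]] by blast
  have "e ?i \<sqsubseteq>\<^bsub>alg\<^esub> \<Sqinter>\<^bsub>alg\<^esub>X"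
    using assms i by (intro A.inf_greatest) auto
  then show "{p \<in> P. \<forall>x\<in>X. p \<in> dec x} \<subseteq> dec (\<Sqinter>\<^bsub>alg\<^esub>X)"
    by simp
qed

text \<open>A union of regular open sets is upward closed but in general not regular;
  \<open>reg\<close> gives the least regular open set above it. For infima no such correction
  occurs.\<close>

lemma dec_sup:
  assumes "X \<subseteq> carrier alg"
  shows "dec (\<Squnion>\<^bsub>alg\<^esub>X) = reg (\<Union>(dec ` X))"
proof
  have RO: "dec x \<in> RO" if "x \<in> X" for x
    using assms that by (intro dec_RO) blast
  have u: "up (\<Union>(dec ` X))"
    using RO_up[OF RO] by (intro up_Union) blast
  then have s: "reg (\<Union>(dec ` X)) \<in> RO"
    by (rule reg_in_RO)
  have c: "\<Squnion>\<^bsub>alg\<^esub>X \<in> carrier alg"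
    using assms by (rule A.sup_closed)
  have up: "dec x \<subseteq> dec (\<Squnion>\<^bsub>alg\<^esub>X)" if "x \<in> X" for x
    using A.sup_upper[OF assms that] by simp
  show "reg (\<Union>(dec ` X)) \<subseteq> dec (\<Squnion>\<^bsub>alg\<^esub>X)"
  proof
    fix p
    assume p: "p \<in> reg (\<Union>(dec ` X))"
    show "p \<in> dec (\<Squnion>\<^bsub>alg\<^esub>X)"
    proof (rule RO_dense[OF dec_RO[OF c]])
      show "p \<in> P"
        using p by (simp add: reg_def)
      fix q
      assume "q \<in> P" "p \<subseteq> q"
      then have "\<exists>r\<in>P. q \<subseteq> r \<and> r \<in> \<Union>(dec ` X)"
        using p by (simp add: reg_def)
      then show "\<exists>r\<in>P. q \<subseteq> r \<and> r \<in> dec (\<Squnion>\<^bsub>alg\<^esub>X)"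
        using up by blast
    qed
  qed
  have "\<Squnion>\<^bsub>alg\<^esub>X \<sqsubseteq>\<^bsub>alg\<^esub> e (reg (\<Union>(dec ` X)))"
    using assms s subset_reg[OF u] by (intro A.sup_least) auto
  then show "dec (\<Squnion>\<^bsub>alg\<^esub>X) \<subseteq> reg (\<Union>(dec ` X))"
    by simp
qed

lemma disjoint_dec:
  assumes "a \<in> carrier alg" "b \<in> carrier alg" "a \<sqinter>\<^bsub>alg\<^esub> b = \<bottom>\<^bsub>alg\<^esub>"
  shows "dec a \<inter> dec b = {}"
proof -
  have "dec (a \<sqinter>\<^bsub>alg\<^esub> b) = {p \<in> P. \<forall>x\<in>{a, b}. p \<in> dec x}"
    unfolding meet_def using assms(1,2) by (intro dec_inf) blast
  then have "{p \<in> P. \<forall>x\<in>{a, b}. p \<in> dec x} = {}"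
    using assms(3) by (simp add: bottom_alg)
  then show ?thesis
    using RO_subset[OF dec_RO[OF assms(1)]] by blast
qed

end

context conditions
begin

interpretation cba alg
  by (simp add: cba_def complete_boolean_algebra_alg)

lemma dec_supI:
  assumes "X \<subseteq> carrier alg" "x \<in> X" "p \<in> dec x"
  shows "p \<in> dec (\<Squnion>\<^bsub>alg\<^esub>X)"
  using sup_upper[OF assms(1,2)] assms(3) by auto

lemma neg_infI:
  assumes "X \<subseteq> carrier alg" "x \<in> X" "p \<in> neg (dec x)"
  shows "p \<in> neg (dec (\<Sqinter>\<^bsub>alg\<^esub>X))"
  using inf_lower[OF assms(1,2)] assms(3) by (auto simp: neg_def)

lemma neg_supI:
  assumes "X \<subseteq> carrier alg" "p \<in> P" "\<And>x. x \<in> X \<Longrightarrow> p \<in> neg (dec x)"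
  shows "p \<in> neg (dec (\<Squnion>\<^bsub>alg\<^esub>X))"
proof -
  have "q \<notin> reg (\<Union>(dec ` X))" if q: "q \<in> P" "p \<subseteq> q" for q
  proof
    assume "q \<in> reg (\<Union>(dec ` X))"
    then have "\<exists>r\<in>P. q \<subseteq> r \<and> r \<in> \<Union>(dec ` X)"
      using q by (simp add: reg_def)
    then obtain r x where "r \<in> P" "q \<subseteq> r" "x \<in> X" "r \<in> dec x"
      by blast
    then show False
      using assms(3)[of x] q by (auto simp: neg_def)
  qed
  then show ?thesis
    using assms(1,2) by (simp add: dec_sup neg_def)
qed

text \<open>The requirements are met one after the other along an increasing chain of conditions,
  and monotonicity keeps those already met. Infinitely many requirements would call for limits of
  chains, which need not exist in \<open>P\<close>; here finite arities and finite quantifiers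
  become essential.\<close>

lemma dense_finite:
  assumes "finite X" "p \<in> P"
    and "\<And>x q. \<lbrakk>x \<in> X; q \<in> P; p \<subseteq> q\<rbrakk> \<Longrightarrow> \<exists>r\<in>P. q \<subseteq> r \<and> (\<exists>y. R x r y)"
    and mono: "\<And>x q r y. \<lbrakk>R x q y; q \<subseteq> r; r \<in> P\<rbrakk> \<Longrightarrow> R x r y"
  shows "\<exists>q\<in>P. p \<subseteq> q \<and> (\<exists>h. \<forall>x\<in>X. R x q (h x))"
  using assms(1,3)
proof (induction rule: finite_induct)
  case empty
  then show ?case
    using assms(2) by auto
next
  case (insert x X)
  then obtain q h where q: "q \<in> P" "p \<subseteq> q" and h: "\<And>z. z \<in> X \<Longrightarrow> R z q (h z)"
    by (metis insertCI)
  obtain r y where r: "r \<in> P" "q \<subseteq> r" "R x r y"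
    using insert.prems[of x q] q by blast
  have "R z r ((h(x := y)) z)" if "z \<in> insert x X" for z
    using that r(3) h mono[OF h r(2,1)] by auto
  then show ?case
    using q r by (meson subset_trans)
qed

end

abbreviation inst :: "('r, 'c, 'v, 'i) fm \<Rightarrow> ('v \<Rightarrow> 'c) \<Rightarrow> ('r, 'c, 'v, 'i) fm" where
  "inst \<phi> g \<equiv> subst_fm \<phi> (\<lambda>x. Const (g x))"

primrec cval :: "('v \<Rightarrow> 'c) \<Rightarrow> ('c, 'v) trm \<Rightarrow> 'c" where
  "cval g (Var x) = g x"
| "cval g (Const c) = c"

lemma subst_trm_consts: "subst_trm t (\<lambda>x. Const (g x)) = Const (cval g t)"
  by (cases t) auto

section \<open>The generic model of a consistency property\<close>

text \<open>The clauses speak of a formula with free variables together with constants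
  \<open>g\<close>, since the truth lemma is an induction over such pairs. Each is a one-step
  extension property; as it applies to every stronger condition, which still contains the formula,
  it amounts to a density statement. \<open>eqc\<close> and \<open>relc\<close> are separate from
  membership, so that the atomic facts settled by a condition need not be elements of it.\<close>

locale consistency_property = conditions P e
  for P :: "('r, 'c, 'v, 'i) fm set set" and e :: "('r, 'c, 'v, 'i) fm set set \<Rightarrow> 'u" +
  fixes code :: "(('r, 'c, 'v, 'i) fm set \<times> 'c) set \<Rightarrow> 'u"
    and L :: "('r, 'c) signature"
    and \<Psi> :: "('r, 'c, 'v, 'i) fm set"
    and eqc :: "('r, 'c, 'v, 'i) fm set \<Rightarrow> 'c \<Rightarrow> 'c \<Rightarrow> bool"
    and relc :: "('r, 'c, 'v, 'i) fm set \<Rightarrow> 'r \<Rightarrow> 'c list \<Rightarrow> bool"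
  assumes inj_code: "inj code"
    and csyms_nonempty: "csyms L \<noteq> {}"
    and lang: "\<And>\<psi>. \<psi> \<in> \<Psi> \<Longrightarrow> lang L \<psi>"
    and eqc_mono: "\<And>p q c d. \<lbrakk>eqc p c d; p \<subseteq> q\<rbrakk> \<Longrightarrow> eqc q c d"
    and relc_mono: "\<And>p q R cs. \<lbrakk>relc p R cs; p \<subseteq> q\<rbrakk> \<Longrightarrow> relc q R cs"
    and eqc_refl: "\<And>p c. c \<in> csyms L \<Longrightarrow> eqc p c c"
    and eqc_sym: "\<And>p c d. \<lbrakk>eqc p c d; c \<in> csyms L; d \<in> csyms L\<rbrakk> \<Longrightarrow> eqc p d c"
    and eqc_trans: "\<And>p b c d. \<lbrakk>eqc p b c; eqc p c d; b \<in> csyms L; c \<in> csyms L; d \<in> csyms L\<rbrakk> \<Longrightarrow> eqc p b d"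
    and relc_cong: "\<And>p R cs ds. \<lbrakk>relc p R cs; R \<in> rsyms L; length cs = ar L R; length ds = ar L R;
        set cs \<subseteq> csyms L; set ds \<subseteq> csyms L; \<And>i. i < ar L R \<Longrightarrow> eqc p (cs ! i) (ds ! i)\<rbrakk> \<Longrightarrow> relc p R ds"
    and eq: "\<And>p c d. \<lbrakk>p \<in> P; Eq (Const c) (Const d) \<in> p\<rbrakk> \<Longrightarrow> eqc p c d"
    and rel: "\<And>p R cs. \<lbrakk>p \<in> P; Rel R (map Const cs) \<in> p\<rbrakk> \<Longrightarrow> relc p R cs"
    and neg_eq: "\<And>p c d. \<lbrakk>p \<in> P; Neg (Eq (Const c) (Const d)) \<in> p\<rbrakk> \<Longrightarrow> \<not> eqc p c d"
    and neg_rel: "\<And>p R cs. \<lbrakk>p \<in> P; Neg (Rel R (map Const cs)) \<in> p\<rbrakk> \<Longrightarrow> \<not> relc p R cs"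
    and neg_neg': "\<And>p \<phi> g. \<lbrakk>p \<in> P; Neg (Neg \<phi>) \<in> \<Union>(subfms ` \<Psi>); g ` fv \<phi> \<subseteq> csyms L;
        inst (Neg (Neg \<phi>)) g \<in> p\<rbrakk> \<Longrightarrow> insert (inst \<phi> g) p \<in> P"
    and conj: "\<And>p J f g j. \<lbrakk>p \<in> P; Conj J f \<in> \<Union>(subfms ` \<Psi>); g ` fv (Conj J f) \<subseteq> csyms L;
        inst (Conj J f) g \<in> p; j \<in> J\<rbrakk> \<Longrightarrow> insert (inst (f j) g) p \<in> P"
    and neg_conj: "\<And>p J f g. \<lbrakk>p \<in> P; Neg (Conj J f) \<in> \<Union>(subfms ` \<Psi>); g ` fv (Conj J f) \<subseteq> csyms L;
        inst (Neg (Conj J f)) g \<in> p\<rbrakk> \<Longrightarrow> \<exists>j\<in>J. insert (inst (Neg (f j)) g) p \<in> P"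
    and disj: "\<And>p J f g. \<lbrakk>p \<in> P; Disj J f \<in> \<Union>(subfms ` \<Psi>); g ` fv (Disj J f) \<subseteq> csyms L;
        inst (Disj J f) g \<in> p\<rbrakk> \<Longrightarrow> \<exists>j\<in>J. insert (inst (f j) g) p \<in> P"
    and neg_disj: "\<And>p J f g j. \<lbrakk>p \<in> P; Neg (Disj J f) \<in> \<Union>(subfms ` \<Psi>); g ` fv (Disj J f) \<subseteq> csyms L;
        inst (Neg (Disj J f)) g \<in> p; j \<in> J\<rbrakk> \<Longrightarrow> insert (inst (Neg (f j)) g) p \<in> P"
    and all: "\<And>p V \<phi> g h. \<lbrakk>p \<in> P; All V \<phi> \<in> \<Union>(subfms ` \<Psi>); g ` fv (All V \<phi>) \<subseteq> csyms L;
        inst (All V \<phi>) g \<in> p; h ` V \<subseteq> csyms L\<rbrakk> \<Longrightarrow> insert (inst \<phi> (override_on g h V)) p \<in> P"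
    and neg_all: "\<And>p V \<phi> g. \<lbrakk>p \<in> P; Neg (All V \<phi>) \<in> \<Union>(subfms ` \<Psi>); g ` fv (All V \<phi>) \<subseteq> csyms L;
        inst (Neg (All V \<phi>)) g \<in> p\<rbrakk> \<Longrightarrow>
        \<exists>h. h ` V \<subseteq> csyms L \<and> insert (inst (Neg \<phi>) (override_on g h V)) p \<in> P"
    and ex: "\<And>p V \<phi> g. \<lbrakk>p \<in> P; Ex V \<phi> \<in> \<Union>(subfms ` \<Psi>); g ` fv (Ex V \<phi>) \<subseteq> csyms L;
        inst (Ex V \<phi>) g \<in> p\<rbrakk> \<Longrightarrow>
        \<exists>h. h ` V \<subseteq> csyms L \<and> insert (inst \<phi> (override_on g h V)) p \<in> P"
    and neg_ex: "\<And>p V \<phi> g h. \<lbrakk>p \<in> P; Neg (Ex V \<phi>) \<in> \<Union>(subfms ` \<Psi>); g ` fv (Ex V \<phi>) \<subseteq> csyms L;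
        inst (Neg (Ex V \<phi>)) g \<in> p; h ` V \<subseteq> csyms L\<rbrakk> \<Longrightarrow>
        insert (inst (Neg \<phi>) (override_on g h V)) p \<in> P"
begin

interpretation cba alg
  by (simp add: cba_def complete_boolean_algebra_alg)

abbreviation F :: "('r, 'c, 'v, 'i) fm set" where
  "F \<equiv> \<Union>(subfms ` \<Psi>)"

text \<open>A name is a description of a mixture of constants: \<open>(p, c) \<in> \<tau>\<close> says that \<open>p\<close> forces \<open>\<tau> = c\<close>.\<close>

definition names :: "(('r, 'c, 'v, 'i) fm set \<times> 'c) set set" where
  "names = {\<tau>. \<tau> \<subseteq> P \<times> csyms L \<and>
     (\<forall>p c q. (p, c) \<in> \<tau> \<longrightarrow> q \<in> P \<longrightarrow> p \<subseteq> q \<longrightarrow> (q, c) \<in> \<tau>) \<and>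
     (\<forall>p c d. (p, c) \<in> \<tau> \<longrightarrow> (p, d) \<in> \<tau> \<longrightarrow> eqc p c d) \<and>
     (\<forall>p\<in>P. \<exists>q\<in>P. p \<subseteq> q \<and> (\<exists>c. (q, c) \<in> \<tau>))}"

definition hat :: "'c \<Rightarrow> (('r, 'c, 'v, 'i) fm set \<times> 'c) set" where
  "hat c = P \<times> {c}"

definition name :: "'u \<Rightarrow> (('r, 'c, 'v, 'i) fm set \<times> 'c) set" where
  "name = inv code"

text \<open>Only conditions at which both names already have a value are counted; the others are
  supplied by \<open>reg\<close> in \<open>model\<close>.\<close>

definition eqset :: "(('r, 'c, 'v, 'i) fm set \<times> 'c) set \<Rightarrow> (('r, 'c, 'v, 'i) fm set \<times> 'c) set \<Rightarrow>
    ('r, 'c, 'v, 'i) fm set set" where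
  "eqset \<tau> \<sigma> = {p \<in> P. \<exists>c d. (p, c) \<in> \<tau> \<and> (p, d) \<in> \<sigma> \<and> eqc p c d}"

definition relset :: "'r \<Rightarrow> (('r, 'c, 'v, 'i) fm set \<times> 'c) set list \<Rightarrow> ('r, 'c, 'v, 'i) fm set set" where
  "relset R \<tau>s = {p \<in> P. \<exists>cs. length cs = length \<tau>s \<and> (\<forall>i<length \<tau>s. (p, cs ! i) \<in> \<tau>s ! i) \<and> relc p R cs}"

definition model :: "(('r, 'c, 'v, 'i) fm set \<times> 'c) set set \<Rightarrow> ('u, 'u, 'r, 'c) bv_structure" where
  "model D = \<lparr>dom = code ` D, eqv = \<lambda>a b. e (reg (eqset (name a) (name b))),
     relv = \<lambda>R as. e (reg (relset R (map name as))), cstv = \<lambda>c. code (hat c)\<rparr>"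

lemma name_code [simp]: "name (code \<tau>) = \<tau>"
  using inj_code by (simp add: name_def)

lemma model_simps [simp]:
  "dom (model D) = code ` D"
  "eqv (model D) a b = e (reg (eqset (name a) (name b)))"
  "relv (model D) R as = e (reg (relset R (map name as)))"
  "cstv (model D) c = code (hat c)"
  by (simp_all add: model_def)

lemma namesD:
  assumes "\<tau> \<in> names"
  shows names_closed: "(p, c) \<in> \<tau> \<Longrightarrow> p \<in> P \<and> c \<in> csyms L"
    and names_mono: "\<lbrakk>(p, c) \<in> \<tau>; q \<in> P; p \<subseteq> q\<rbrakk> \<Longrightarrow> (q, c) \<in> \<tau>"
    and names_eqc: "\<lbrakk>(p, c) \<in> \<tau>; (p, d) \<in> \<tau>\<rbrakk> \<Longrightarrow> eqc p c d"
    and names_dense: "p \<in> P \<Longrightarrow> \<exists>q\<in>P. p \<subseteq> q \<and> (\<exists>c. (q, c) \<in> \<tau>)"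
  using assms unfolding names_def by blast+

lemma hat_names: "c \<in> csyms L \<Longrightarrow> hat c \<in> names"
  using eqc_refl by (auto simp: names_def hat_def)

lemma up_eqset:
  assumes "\<tau> \<in> names" "\<sigma> \<in> names"
  shows "up (eqset \<tau> \<sigma>)"
  unfolding up_def
proof (intro conjI ballI impI)
  fix p q
  assume "p \<in> eqset \<tau> \<sigma>" and q: "q \<in> P" "p \<subseteq> q"
  then obtain c d where "(p, c) \<in> \<tau>" "(p, d) \<in> \<sigma>" "eqc p c d"
    by (auto simp: eqset_def)
  then have "(q, c) \<in> \<tau>" "(q, d) \<in> \<sigma>" "eqc q c d"
    using q names_mono[OF assms(1)] names_mono[OF assms(2)] eqc_mono by blast+
  then show "q \<in> eqset \<tau> \<sigma>"
    using q by (auto simp: eqset_def)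
qed (auto simp: eqset_def)

lemma up_relset:
  assumes "set \<tau>s \<subseteq> names"
  shows "up (relset R \<tau>s)"
  unfolding up_def
proof (intro conjI ballI impI)
  fix p q
  assume "p \<in> relset R \<tau>s" and q: "q \<in> P" "p \<subseteq> q"
  then obtain cs where cs: "length cs = length \<tau>s" "\<forall>i<length \<tau>s. (p, cs ! i) \<in> \<tau>s ! i" "relc p R cs"
    by (auto simp: relset_def)
  have "(q, cs ! i) \<in> \<tau>s ! i" if "i < length \<tau>s" for i
  proof -
    have "\<tau>s ! i \<in> names"
      using assms that by (simp add: subset_iff)
    then show ?thesis
      using names_mono cs q that by blast
  qed
  then show "q \<in> relset R \<tau>s"
    using q cs relc_mono[OF cs(3)] by (auto simp: relset_def)
qed (auto simp: relset_def)

text \<open>The values that witness membership in \<open>eqset\<close> may differ from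
  \<open>c\<close> and \<open>d\<close>, but any two values of one name at \<open>p\<close> are
  related by \<open>eqc\<close>. So it does not matter which values are chosen.\<close>

lemma eqset_names:
  assumes "\<tau> \<in> names" "\<sigma> \<in> names" "p \<in> eqset \<tau> \<sigma>" "(p, c) \<in> \<tau>" "(p, d) \<in> \<sigma>"
  shows "eqc p c d"
proof -
  obtain c' d' where *: "(p, c') \<in> \<tau>" "(p, d') \<in> \<sigma>" "eqc p c' d'"
    using assms(3) by (auto simp: eqset_def)
  note cl = names_closed[OF assms(1) *(1)] names_closed[OF assms(1,4)]
    names_closed[OF assms(2) *(2)] names_closed[OF assms(2,5)]
  have "eqc p c c'" "eqc p d' d"
    using names_eqc[OF assms(1)] names_eqc[OF assms(2)] * assms(4,5) by blast+
  then show ?thesis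
    using eqc_trans[of p c c' d'] eqc_trans[of p c d' d] *(3) cl by blast
qed

lemma reg_dense:
  assumes "p \<in> reg X" "q \<in> P" "p \<subseteq> q"
  obtains r where "r \<in> P" "q \<subseteq> r" "r \<in> X"
  using assms unfolding reg_def by (simp only: mem_Collect_eq) blast

lemma model_eqv_trans:
  assumes n: "\<tau> \<in> names" "\<sigma> \<in> names" "\<rho> \<in> names"
    and p: "p \<in> reg (eqset \<tau> \<sigma>)" "p \<in> reg (eqset \<sigma> \<rho>)"
  shows "p \<in> reg (eqset \<tau> \<rho>)"
  unfolding reg_def
proof (intro CollectI conjI ballI impI)
  show "p \<in> P"
    using p by (simp add: reg_def)
  fix q
  assume q: "q \<in> P" "p \<subseteq> q"
  obtain r where r: "r \<in> P" "q \<subseteq> r" "r \<in> eqset \<tau> \<sigma>"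
    using reg_dense[OF p(1) q] .
  then obtain s where s: "s \<in> P" "r \<subseteq> s" "s \<in> eqset \<sigma> \<rho>"
    using reg_dense[OF p(2), of r] q by blast
  have s': "s \<in> eqset \<tau> \<sigma>"
    using up_eqset[OF n(1,2)] r s by (simp add: up_def)
  obtain a b where ab: "(s, a) \<in> \<tau>" "(s, b) \<in> \<sigma>" "eqc s a b"
    using s' by (auto simp: eqset_def)
  obtain c where c: "(s, c) \<in> \<rho>"
    using s by (auto simp: eqset_def)
  \<comment> \<open>The two equalities may have been witnessed by different values of
    \<open>\<sigma>\<close>; \<open>eqset_names\<close> moves the second one to the value
    \<open>b\<close> used by the first.\<close>
  have "eqc s b c"
    using eqset_names[OF n(2,3) s(3)] ab c by blast
  then have "eqc s a c"
    using eqc_trans ab c names_closed n by blast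
  then have "s \<in> eqset \<tau> \<rho>"
    using s ab c by (auto simp: eqset_def)
  then show "\<exists>r\<in>P. q \<subseteq> r \<and> r \<in> eqset \<tau> \<rho>"
    using r s by blast
qed

lemma model_rel_cong:
  assumes R: "R \<in> rsyms L" and n: "set \<tau>s \<subseteq> names" "set \<sigma>s \<subseteq> names"
    and len: "length \<tau>s = ar L R" "length \<sigma>s = ar L R"
    and eq: "\<And>i. i < ar L R \<Longrightarrow> p \<in> reg (eqset (\<tau>s ! i) (\<sigma>s ! i))"
    and p: "p \<in> reg (relset R \<tau>s)"
  shows "p \<in> reg (relset R \<sigma>s)"
  unfolding reg_def
proof (intro CollectI conjI ballI impI)
  show "p \<in> P"
    using p by (simp add: reg_def)
  fix q
  assume q: "q \<in> P" "p \<subseteq> q"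
  have n': "\<tau>s ! i \<in> names" "\<sigma>s ! i \<in> names" if "i < ar L R" for i
    using n len that by (simp_all add: subset_iff)
  obtain r where r: "r \<in> P" "q \<subseteq> r" "r \<in> relset R \<tau>s"
    using reg_dense[OF p q] .
  \<comment> \<open>A single condition has to settle all equations and all values of
    \<open>\<sigma>s\<close>, which is possible because the arity is finite. The conjunct
    \<open>i < ar L R\<close> sits inside the relation since \<open>dense_finite\<close> asks for
    monotonicity at every \<open>i\<close>.\<close>
  have "\<exists>s\<in>P. r \<subseteq> s \<and> (\<exists>h. \<forall>i\<in>{..<ar L R}. i < ar L R \<and> s \<in> eqset (\<tau>s ! i) (\<sigma>s ! i) \<and> (s, h i) \<in> \<sigma>s ! i)"
  proof (rule dense_finite)
    show "\<exists>t\<in>P. s \<subseteq> t \<and> (\<exists>c. i < ar L R \<and> t \<in> eqset (\<tau>s ! i) (\<sigma>s ! i) \<and> (t, c) \<in> \<sigma>s ! i)"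
      if s: "i \<in> {..<ar L R}" "s \<in> P" "r \<subseteq> s" for i s
    proof -
      have "p \<subseteq> s"
        using s q r by blast
      then obtain t where t: "t \<in> P" "s \<subseteq> t" "t \<in> eqset (\<tau>s ! i) (\<sigma>s ! i)"
        using reg_dense[OF eq, of i s] s by auto
      then show ?thesis
        using s(1) by (auto simp: eqset_def)
    qed
    show "i < ar L R \<and> t \<in> eqset (\<tau>s ! i) (\<sigma>s ! i) \<and> (t, c) \<in> \<sigma>s ! i"
      if "i < ar L R \<and> s \<in> eqset (\<tau>s ! i) (\<sigma>s ! i) \<and> (s, c) \<in> \<sigma>s ! i" "s \<subseteq> t" "t \<in> P" for i s t c
      using up_eqset[OF n'] names_mono[OF n'(2)] that by (auto simp: up_def)
  qed (use r in auto)
  then obtain s h where s: "s \<in> P" "r \<subseteq> s"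
    and h: "\<And>i. i < ar L R \<Longrightarrow> s \<in> eqset (\<tau>s ! i) (\<sigma>s ! i) \<and> (s, h i) \<in> \<sigma>s ! i"
    by auto
  have "s \<in> relset R \<tau>s"
    using up_relset[OF n(1)] r s by (simp add: up_def)
  then obtain cs where cs: "length cs = ar L R" "\<forall>i<ar L R. (s, cs ! i) \<in> \<tau>s ! i" "relc s R cs"
    using len by (auto simp: relset_def)
  let ?ds = "map h [0..<ar L R]"
  have "relc s R ?ds"
  proof (rule relc_cong[OF cs(3) R cs(1)])
    show "set cs \<subseteq> csyms L"
      using cs names_closed[OF n'(1)] by (auto simp: set_conv_nth)
    show "set ?ds \<subseteq> csyms L"
    proof
      fix c
      assume "c \<in> set ?ds"
      then obtain i where "i < ar L R" "c = h i"
        by auto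
      then show "c \<in> csyms L"
        using h[of i] names_closed[OF n'(2)[of i], of s "h i"] by simp
    qed
    show "eqc s (cs ! i) (?ds ! i)" if "i < ar L R" for i
      using eqset_names[OF n'[OF that]] h cs that by simp
  qed simp
  then have "s \<in> relset R \<sigma>s"
    using s h len unfolding relset_def by (auto intro!: exI[of _ ?ds])
  then show "\<exists>r\<in>P. q \<subseteq> r \<and> r \<in> relset R \<sigma>s"
    using r s by blast
qed

lemma eqset_refl:
  assumes "\<tau> \<in> names"
  shows "reg (eqset \<tau> \<tau>) = P"
proof -
  have "p \<in> reg (eqset \<tau> \<tau>)" if "p \<in> P" for p
    unfolding reg_def
  proof (intro CollectI conjI ballI impI that)
    fix q
    assume "q \<in> P"
    then obtain r c where "r \<in> P" "q \<subseteq> r" "(r, c) \<in> \<tau>"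
      using names_dense[OF assms] by blast
    then show "\<exists>r\<in>P. q \<subseteq> r \<and> r \<in> eqset \<tau> \<tau>"
      using names_eqc[OF assms] unfolding eqset_def by blast
  qed
  then show ?thesis
    by (auto simp: reg_def)
qed

lemma eqset_sym:
  assumes "\<tau> \<in> names" "\<sigma> \<in> names"
  shows "eqset \<tau> \<sigma> = eqset \<sigma> \<tau>"
  using names_closed[OF assms(1)] names_closed[OF assms(2)] eqc_sym unfolding eqset_def by blast

lemma bv_model_model:
  assumes D: "D \<subseteq> names" "hat ` csyms L \<subseteq> D"
  shows "bv_model L alg (model D)"
proof (rule bv_modelI)
  show "dom (model D) \<noteq> {}"
    using D csyms_nonempty by auto
next
  fix a b
  assume ab: "a \<in> dom (model D)" "b \<in> dom (model D)"
  then have "name a \<in> names" "name b \<in> names"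
    using D by auto
  then show "eqv (model D) a b \<in> carrier alg" "eqv (model D) a b = eqv (model D) b a"
    by (simp_all add: reg_in_RO up_eqset eqset_sym)
next
  fix R as
  assume "as \<in> lists (dom (model D))"
  then have "set (map name as) \<subseteq> names"
    using D by fastforce
  then show "relv (model D) R as \<in> carrier alg"
    by (simp add: reg_in_RO up_relset)
next
  show "cstv (model D) c \<in> dom (model D)" if "c \<in> csyms L" for c
    using D that by auto
next
  show "eqv (model D) a a = \<top>\<^bsub>alg\<^esub>" if "a \<in> dom (model D)" for a
    using D that by (auto simp: eqset_refl top_alg)
next
  fix a b c d
  assume "a \<in> dom (model D)" "b \<in> dom (model D)" "c \<in> dom (model D)"
    and le: "d \<sqsubseteq>\<^bsub>alg\<^esub> eqv (model D) a b" "d \<sqsubseteq>\<^bsub>alg\<^esub> eqv (model D) b c"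
  then have "name a \<in> names" "name b \<in> names" "name c \<in> names"
    using D by auto
  note tr = model_eqv_trans[OF this]
  show "d \<sqsubseteq>\<^bsub>alg\<^esub> eqv (model D) a c"
    using le tr by (simp add: subset_iff)
next
  fix R as bs d
  assume R: "R \<in> rsyms L" and l: "as \<in> lists (dom (model D))" "bs \<in> lists (dom (model D))"
    and len: "length as = ar L R" "length bs = ar L R"
    and le: "\<And>i. i < ar L R \<Longrightarrow> d \<sqsubseteq>\<^bsub>alg\<^esub> eqv (model D) (as ! i) (bs ! i)" "d \<sqsubseteq>\<^bsub>alg\<^esub> relv (model D) R as"
  have n: "set (map name as) \<subseteq> names" "set (map name bs) \<subseteq> names"
    using l D by fastforce+
  have "p \<in> reg (relset R (map name bs))" if "p \<in> dec d" for p
    using that le len by (intro model_rel_cong[OF R n]) auto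
  then show "d \<sqsubseteq>\<^bsub>alg\<^esub> relv (model D) R bs"
    by auto
qed

text \<open>
  All that the truth lemma needs to know about the domain \<open>D\<close>. For infinite \<open>V\<close> mixtures violate it:
  infinitely many names need not be decided by a single condition.
\<close>

definition adequate :: "(('r, 'c, 'v, 'i) fm set \<times> 'c) set set \<Rightarrow> bool" where
  "adequate D \<longleftrightarrow> D \<subseteq> names \<and> hat ` csyms L \<subseteq> D \<and>
     (\<forall>V \<phi> a. \<forall>p\<in>P. All V \<phi> \<in> F \<or> Ex V \<phi> \<in> F \<longrightarrow> a ` V \<subseteq> D \<longrightarrow>
        (\<exists>q\<in>P. p \<subseteq> q \<and> (\<exists>h. \<forall>x\<in>V. (q, h x) \<in> a x)))"

text \<open>The name of a constant has its value at every condition, so arbitrarily many of them are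
  decided at once, without any extension.\<close>

lemma adequate_hats: "adequate (hat ` csyms L)"
  unfolding adequate_def
proof (intro conjI allI ballI impI)
  fix V :: "'v set" and a p
  assume "p \<in> P" and a: "a ` V \<subseteq> hat ` csyms L"
  have "\<exists>c. (p, c) \<in> a x" if "x \<in> V" for x
    using a that \<open>p \<in> P\<close> by (auto simp: hat_def)
  then have "\<exists>h. \<forall>x\<in>V. (p, h x) \<in> a x"
    by (rule bchoice[OF ballI])
  then show "\<exists>q\<in>P. p \<subseteq> q \<and> (\<exists>h. \<forall>x\<in>V. (q, h x) \<in> a x)"
    using \<open>p \<in> P\<close> by blast
qed (use hat_names in auto)

text \<open>Every name is decided densely, and finitely many of them can be decided in
  succession.\<close>

lemma adequate_names:
  assumes "\<And>V \<phi>. All V \<phi> \<in> F \<or> Ex V \<phi> \<in> F \<Longrightarrow> finite V"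
  shows "adequate names"
  unfolding adequate_def
proof (intro conjI allI ballI impI)
  fix V \<phi> a p
  assume p: "p \<in> P" and V: "All V \<phi> \<in> F \<or> Ex V \<phi> \<in> F" and a: "a ` V \<subseteq> names"
  have "\<exists>q\<in>P. p \<subseteq> q \<and> (\<exists>h. \<forall>x\<in>V. x \<in> V \<and> (q, h x) \<in> a x)"
  proof (rule dense_finite)
    show "finite V"
      using assms V by blast
    show "\<exists>r\<in>P. q \<subseteq> r \<and> (\<exists>c. x \<in> V \<and> (r, c) \<in> a x)" if "x \<in> V" "q \<in> P" for x q
      using names_dense[of "a x" q] a that by auto
    show "x \<in> V \<and> (r, c) \<in> a x" if "x \<in> V \<and> (q, c) \<in> a x" "q \<subseteq> r" "r \<in> P" for x q r c
      using names_mono[of "a x" q c r] a that by auto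
  qed (rule p)
  then show "\<exists>q\<in>P. p \<subseteq> q \<and> (\<exists>h. \<forall>x\<in>V. (q, h x) \<in> a x)"
    by auto
qed (use hat_names in auto)

text \<open>Distinct members of an antichain are disjoint sets of conditions. At each condition at
  most one of the names \<open>t a\<close> is prescribed, so they can be glued to a single
  name.\<close>

lemma mixing_names: "mixing alg (model names)"
  unfolding mixing_def
proof (intro allI impI)
  fix A t
  assume A: "A \<subseteq> carrier alg" and disj: "\<forall>a\<in>A. \<forall>b\<in>A. a \<noteq> b \<longrightarrow> a \<sqinter>\<^bsub>alg\<^esub> b = \<bottom>\<^bsub>alg\<^esub>"
    and t: "t ` A \<subseteq> dom (model names)"
  obtain c0 where c0: "c0 \<in> csyms L"
    using csyms_nonempty by blast
  have nt: "name (t a) \<in> names" if "a \<in> A" for a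
    using t that by auto
  have RO: "dec a \<in> RO" if "a \<in> A" for a
    using A that by (intro dec_RO) blast
  have eq: "a = b" if "p \<in> dec a" "p \<in> dec b" "a \<in> A" "b \<in> A" for a b p
    using disjoint_dec[of a b] disj A that by blast
  \<comment> \<open>The antichain need not be maximal. At conditions incompatible with all of
    \<open>A\<close> the glued name takes the default value \<open>c0\<close>; without it there
    could be conditions above which it never takes a value, and it would not be a name.\<close>
  define \<tau> where "\<tau> = {(p, c). p \<in> P \<and> ((\<exists>a\<in>A. p \<in> dec a \<and> (p, c) \<in> name (t a)) \<or>
    c = c0 \<and> (\<forall>a\<in>A. p \<in> neg (dec a)))}"
  have not_neg: "p \<notin> neg (dec a)" if "a \<in> A" "p \<in> dec a" for p a
    using that RO_subset[OF RO[OF that(1)] that(2)] by (auto simp: neg_def)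
  have \<tau>_dec: "(p, c) \<in> \<tau> \<longleftrightarrow> (p, c) \<in> name (t a)" if a: "a \<in> A" "p \<in> dec a" for p c a
  proof
    assume "(p, c) \<in> \<tau>"
    then have "(\<exists>a\<in>A. p \<in> dec a \<and> (p, c) \<in> name (t a)) \<or> p \<in> neg (dec a)"
      using a(1) unfolding \<tau>_def by blast
    then obtain b where "b \<in> A" "p \<in> dec b" "(p, c) \<in> name (t b)"
      using not_neg[OF a] by blast
    then show "(p, c) \<in> name (t a)"
      using eq[OF a(2) _ a(1), of b] by simp
  next
    assume "(p, c) \<in> name (t a)"
    then show "(p, c) \<in> \<tau>"
      using a RO_subset[OF RO[OF a(1)] a(2)] by (auto simp: \<tau>_def)
  qed
  have \<tau>_neg: "(p, c) \<in> \<tau> \<longleftrightarrow> c = c0" if "p \<in> P" "\<forall>a\<in>A. p \<in> neg (dec a)" for p c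
    using that not_neg[of _ p] unfolding \<tau>_def by blast
  have cases: "(\<exists>a\<in>A. p \<in> dec a) \<or> p \<in> P \<and> (\<forall>a\<in>A. p \<in> neg (dec a))" if "(p, c) \<in> \<tau>" for p c
    using that unfolding \<tau>_def by blast
  have "\<tau> \<in> names"
    unfolding names_def
  proof (intro CollectI conjI allI impI ballI)
    show "\<tau> \<subseteq> P \<times> csyms L"
      using c0 names_closed[OF nt] by (auto simp: \<tau>_def)
  next
    fix p c q
    assume *: "(p, c) \<in> \<tau>" "q \<in> P" "p \<subseteq> q"
    show "(q, c) \<in> \<tau>"
    proof (cases "\<exists>a\<in>A. p \<in> dec a")
      case True
      then obtain a where a: "a \<in> A" "p \<in> dec a"
        by blast
      then have "q \<in> dec a"
        using RO_mono[OF RO[OF a(1)] a(2)] * by simp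
      moreover have "(p, c) \<in> name (t a)"
        using * \<tau>_dec[OF a] by simp
      then have "(q, c) \<in> name (t a)"
        using names_mono[OF nt[OF a(1)]] * by simp
      ultimately show ?thesis
        using a \<tau>_dec by simp
    next
      case False
      then have p: "p \<in> P" "\<forall>a\<in>A. p \<in> neg (dec a)"
        using cases[OF *(1)] by blast+
      then have "\<forall>a\<in>A. q \<in> neg (dec a)"
        using * by (auto simp: neg_def)
      then show ?thesis
        using * p \<tau>_neg by blast
    qed
  next
    fix p c d
    assume *: "(p, c) \<in> \<tau>" "(p, d) \<in> \<tau>"
    from cases[OF *(1)] show "eqc p c d"
    proof
      assume "\<exists>a\<in>A. p \<in> dec a"
      then obtain a where a: "a \<in> A" "p \<in> dec a"
        by blast
      then show ?thesis
        using * \<tau>_dec[OF a] names_eqc[OF nt[OF a(1)]] by simp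
    next
      assume "p \<in> P \<and> (\<forall>a\<in>A. p \<in> neg (dec a))"
      then show ?thesis
        using * \<tau>_neg[of p] eqc_refl[OF c0] by simp
    qed
  next
    fix p
    assume p: "p \<in> P"
    show "\<exists>q\<in>P. p \<subseteq> q \<and> (\<exists>c. (q, c) \<in> \<tau>)"
    proof (cases "\<forall>a\<in>A. p \<in> neg (dec a)")
      case True
      then show ?thesis
        using p \<tau>_neg by blast
    next
      case False
      then obtain a q where q: "a \<in> A" "q \<in> P" "p \<subseteq> q" "q \<in> dec a"
        using p by (auto simp: neg_def)
      then obtain r c where r: "r \<in> P" "q \<subseteq> r" "(r, c) \<in> name (t a)"
        using names_dense[OF nt[OF q(1)] q(2)] by blast
      then have "r \<in> dec a"
        using q RO_mono[OF RO[OF q(1)] q(4)] by simp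
      then have "(r, c) \<in> \<tau>"
        using \<tau>_dec[OF q(1)] r by simp
      then show ?thesis
        using q r by blast
    qed
  qed
  moreover have "a \<sqsubseteq>\<^bsub>alg\<^esub> eqv (model names) (code \<tau>) (t a)" if a: "a \<in> A" for a
  proof -
    have "p \<in> reg (eqset \<tau> (name (t a)))" if "p \<in> dec a" for p
      unfolding reg_def
    proof (intro CollectI conjI ballI impI)
      show "p \<in> P"
        using RO_subset[OF RO[OF a] that] .
      fix q
      assume q: "q \<in> P" "p \<subseteq> q"
      then obtain r c where r: "r \<in> P" "q \<subseteq> r" "(r, c) \<in> name (t a)"
        using names_dense[OF nt[OF a]] by blast
      then have "r \<in> dec a"
        using RO_mono[OF RO[OF a] that] q by blast
      then have "r \<in> eqset \<tau> (name (t a))"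
        using r \<tau>_dec[OF a] names_eqc[OF nt[OF a] r(3) r(3)] unfolding eqset_def by blast
      then show "\<exists>r\<in>P. q \<subseteq> r \<and> r \<in> eqset \<tau> (name (t a))"
        using r by blast
    qed
    then show ?thesis
      by auto
  qed
  ultimately show "\<exists>m\<in>dom (model names). \<forall>a\<in>A. a \<sqsubseteq>\<^bsub>alg\<^esub> eqv (model names) m (t a)"
    by (intro bexI[of _ "code \<tau>"]) auto
qed


section \<open>The truth lemma: conditions force their elements\<close>

lemma F_lang:
  assumes "\<phi> \<in> F"
  shows "lang L \<phi>"
  using assms lang fm_in_subfms unfolding lang_def by blast

lemma adequateD:
  assumes "adequate D" "All V \<phi> \<in> F \<or> Ex V \<phi> \<in> F" "p \<in> P" "a ` V \<subseteq> D"
  obtains q h where "q \<in> P" "p \<subseteq> q" "\<And>x. x \<in> V \<Longrightarrow> (q, h x) \<in> a x"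
proof -
  have "\<exists>q\<in>P. p \<subseteq> q \<and> (\<exists>h. \<forall>x\<in>V. (q, h x) \<in> a x)"
    by (rule assms(1)[unfolded adequate_def, THEN conjunct2, THEN conjunct2, rule_format,
        OF assms(3,2,4)])
  then show thesis
    using that by blast
qed

text \<open>Only one direction is claimed: what a condition contains, it forces. The two halves are
  proved together, as \<open>Neg\<close> exchanges them; in the negative half the induction descends
  to negated constituents, which is why \<open>subfms\<close> pushes negations inwards. Elements of
  the domain may be mixtures, so \<open>p\<close> is assumed to have decided each relevant
  \<open>\<nu> x\<close> as the constant \<open>g x\<close>, and the formula in \<open>p\<close> is
  the instance at these constants.\<close>

lemma truth:
  assumes D: "adequate D" and "p \<in> P" "\<nu> ` fv \<phi> \<subseteq> dom (model D)"
    and "\<And>x. x \<in> fv \<phi> \<Longrightarrow> (p, g x) \<in> name (\<nu> x)"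
  shows "\<lbrakk>\<phi> \<in> F; inst \<phi> g \<in> p\<rbrakk> \<Longrightarrow> p \<in> dec (val alg (model D) \<phi> \<nu>)"
    and "\<lbrakk>Neg \<phi> \<in> F; Neg (inst \<phi> g) \<in> p\<rbrakk> \<Longrightarrow> p \<in> neg (dec (val alg (model D) \<phi> \<nu>))"
proof -
  let ?M = "model D"
  have D_names: "D \<subseteq> names" and D_hat: "hat ` csyms L \<subseteq> D"
    using D by (simp_all add: adequate_def)
  have M: "bv_model L alg ?M"
    using D_names D_hat by (rule bv_model_model)
  have n: "name a \<in> names" if "a \<in> dom ?M" for a
    using D_names that by auto
  have cl: "val alg ?M \<phi> \<nu> \<in> carrier alg" if "\<phi> \<in> F" "\<nu> ` fv \<phi> \<subseteq> dom ?M" for \<phi> \<nu>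
    using val_closed[OF M F_lang] that by blast
  have negF: "\<phi> \<in> F" if "Neg \<phi> \<in> F" for \<phi>
    using that by (auto intro: subfms.neg)
  have name_cval: "(p, cval g t) \<in> name (val_trm ?M \<nu> t)"
    if "p \<in> P" "trm_in L t" "\<And>x. x \<in> vars_trm t \<Longrightarrow> (p, g x) \<in> name (\<nu> x)" for p g \<nu> t
    using that by (cases t) (auto simp: hat_def)
  have trm_dom: "val_trm ?M \<nu> t \<in> dom ?M" if "trm_in L t" "\<nu> ` vars_trm t \<subseteq> dom ?M" for \<nu> t
    using val_trm_closed[OF M] that by blast
  have mono: "(q, c) \<in> name m" if "(p, c) \<in> name m" "q \<in> P" "p \<subseteq> q" "m \<in> dom ?M" for p q c m
    using names_mono[OF n[OF that(4)] that(1-3)] .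
  have g_closed: "g ` X \<subseteq> csyms L"
    if "\<nu> ` X \<subseteq> dom ?M" "\<And>x. x \<in> X \<Longrightarrow> (p, g x) \<in> name (\<nu> x)" for p g \<nu> and X :: "'v set"
  proof
    fix c
    assume "c \<in> g ` X"
    then obtain x where "x \<in> X" "c = g x"
      by blast
    then show "c \<in> csyms L"
      using names_closed[OF n that(2)] that(1) by blast
  qed
  have decI: "p \<in> dec a" if "a \<in> carrier alg" "p \<in> P" "\<And>q. \<lbrakk>q \<in> P; p \<subseteq> q\<rbrakk> \<Longrightarrow> \<exists>r\<in>P. q \<subseteq> r \<and> r \<in> dec a" for p a
    using RO_dense[OF dec_RO[OF that(1)] that(2)] that(3) by blast
  have negI: "p \<in> neg (dec a)" if "a \<in> carrier alg" "p \<in> P" "\<And>q. \<lbrakk>q \<in> P; p \<subseteq> q\<rbrakk> \<Longrightarrow> \<exists>r\<in>P. q \<subseteq> r \<and> r \<in> neg (dec a)" for p a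
    using RO_dense[OF neg_in_RO[OF RO_up[OF dec_RO[OF that(1)]]] that(2)] that(3) by blast
  have eqset_cval: "eqc p (cval g s) (cval g t)"
    if "p \<in> eqset (name (val_trm ?M \<nu> s)) (name (val_trm ?M \<nu> t))"
      "p \<in> P" "trm_in L s" "trm_in L t" "\<nu> ` (vars_trm s \<union> vars_trm t) \<subseteq> dom ?M"
      "\<And>x. x \<in> vars_trm s \<union> vars_trm t \<Longrightarrow> (p, g x) \<in> name (\<nu> x)" for p g \<nu> s t
    using that by (intro eqset_names[OF n[OF trm_dom] n[OF trm_dom] that(1)] name_cval) auto
  have "(\<phi> \<in> F \<longrightarrow> inst \<phi> g \<in> p \<longrightarrow> p \<in> dec (val alg ?M \<phi> \<nu>)) \<and>
      (Neg \<phi> \<in> F \<longrightarrow> Neg (inst \<phi> g) \<in> p \<longrightarrow> p \<in> neg (dec (val alg ?M \<phi> \<nu>)))"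
    using assms(2-)
  proof (induction \<phi> arbitrary: p g \<nu>)
    case (Eq s t)
    let ?X = "eqset (name (val_trm ?M \<nu> s)) (name (val_trm ?M \<nu> t))"
    have pos: "p \<in> reg ?X" if "Eq s t \<in> F" "inst (Eq s t) g \<in> p"
    proof -
      have tm: "trm_in L s" "trm_in L t"
        using F_lang[OF that(1)] by simp_all
      then have "val_trm ?M \<nu> s \<in> dom ?M" "val_trm ?M \<nu> t \<in> dom ?M"
        using Eq.prems by (intro trm_dom; auto)+
      then have up: "up ?X"
        by (intro up_eqset n)
      have "eqc p (cval g s) (cval g t)"
        using that(2) Eq.prems(1) eq by (simp add: subst_trm_consts)
      moreover have "(p, cval g s) \<in> name (val_trm ?M \<nu> s)" "(p, cval g t) \<in> name (val_trm ?M \<nu> t)"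
        using tm Eq.prems by (intro name_cval; simp)+
      ultimately have "p \<in> ?X"
        using Eq.prems(1) unfolding eqset_def by blast
      then show ?thesis
        using subset_reg[OF up] by blast
    qed
    have "p \<in> neg (reg ?X)" if "Neg (Eq s t) \<in> F" "Neg (inst (Eq s t) g) \<in> p"
    proof -
      have tm: "trm_in L s" "trm_in L t"
        using F_lang[OF negF[OF that(1)]] by simp_all
      \<comment> \<open>If a stronger \<open>r\<close> made the two names equal, then
        \<open>eqc\<close> would hold at \<open>r\<close> between the constants that they denote,
        although \<open>r\<close> still contains the negated equation.\<close>
      have "q \<notin> reg ?X" if q: "q \<in> P" "p \<subseteq> q" for q
      proof
        assume "q \<in> reg ?X"
        then obtain r where r: "r \<in> P" "q \<subseteq> r" "r \<in> ?X"
          using reg_dense[of q ?X q] q by blast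
        then have pr: "p \<subseteq> r"
          using q by blast
        have "(r, g x) \<in> name (\<nu> x)" if "x \<in> vars_trm s \<union> vars_trm t" for x
          using Eq.prems that by (intro mono[OF _ r(1) pr]) auto
        then have "eqc r (cval g s) (cval g t)"
          using tm Eq.prems(2) by (intro eqset_cval[OF r(3,1)]) auto
        moreover have "Neg (Eq (Const (cval g s)) (Const (cval g t))) \<in> r"
          using \<open>Neg (inst (Eq s t) g) \<in> p\<close> pr by (auto simp: subst_trm_consts)
        ultimately show False
          using neg_eq[OF r(1)] by blast
      qed
      then show ?thesis
        using Eq.prems(1) by (simp add: neg_def)
    qed
    with pos show ?case
      by simp
  next
    case (Rel R ts)
    let ?\<tau>s = "map (\<lambda>t. name (val_trm ?M \<nu> t)) ts" and ?cs = "map (cval g) ts"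
    have inst: "inst (Rel R ts) g = Rel R (map Const ?cs)"
      by (simp add: subst_trm_consts)
    have v: "map name (map (val_trm ?M \<nu>) ts) = ?\<tau>s"
      by simp
    have ns: "set ?\<tau>s \<subseteq> names" and nts: "\<And>q i. \<lbrakk>q \<in> P; p \<subseteq> q; i < length ts\<rbrakk> \<Longrightarrow> (q, ?cs ! i) \<in> ?\<tau>s ! i"
      if "Rel R ts \<in> F"
    proof -
      have tm: "trm_in L t" if "t \<in> set ts" for t
        using F_lang[OF \<open>Rel R ts \<in> F\<close>] that by simp
      show "set ?\<tau>s \<subseteq> names"
      proof
        fix \<tau>
        assume "\<tau> \<in> set ?\<tau>s"
        then obtain t where t: "t \<in> set ts" "\<tau> = name (val_trm ?M \<nu> t)"
          by auto
        then have "vars_trm t \<subseteq> fv (Rel R ts)"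
          by auto
        then have "\<nu> ` vars_trm t \<subseteq> dom ?M"
          using Rel.prems(2) by blast
        then show "\<tau> \<in> names"
          using n[OF trm_dom[OF tm[OF t(1)]]] t(2) by simp
      qed
      fix q i
      assume q: "q \<in> P" "p \<subseteq> q" and "i < length ts"
      then have t: "ts ! i \<in> set ts"
        by simp
      have "(q, g x) \<in> name (\<nu> x)" if "x \<in> vars_trm (ts ! i)" for x
        using Rel.prems that t by (intro mono[OF _ q]) auto
      then show "(q, ?cs ! i) \<in> ?\<tau>s ! i"
        using name_cval[OF q(1) tm[OF t]] \<open>i < length ts\<close> by simp
    qed
    have pos: "p \<in> reg (relset R ?\<tau>s)" if "Rel R ts \<in> F" "inst (Rel R ts) g \<in> p"
    proof -
      have "relc p R ?cs"
        using that(2) rel[OF Rel.prems(1)] unfolding inst by blast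
      then have "p \<in> relset R ?\<tau>s"
        using nts[OF that(1) Rel.prems(1)] Rel.prems(1) unfolding relset_def
        by (auto intro!: exI[of _ ?cs])
      then show ?thesis
        using subset_reg[OF up_relset[OF ns[OF that(1)]]] by blast
    qed
    have "p \<in> neg (reg (relset R ?\<tau>s))" if N: "Neg (Rel R ts) \<in> F" "Neg (inst (Rel R ts) g) \<in> p"
    proof -
      note F = negF[OF N(1)]
      have l: "R \<in> rsyms L" "length ts = ar L R"
        using F_lang[OF F] by simp_all
      have "q \<notin> reg (relset R ?\<tau>s)" if q: "q \<in> P" "p \<subseteq> q" for q
      proof
        assume "q \<in> reg (relset R ?\<tau>s)"
        then obtain r where r: "r \<in> P" "q \<subseteq> r" "r \<in> relset R ?\<tau>s"
          using reg_dense[of q _ q] q by blast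
        then have pr: "p \<subseteq> r"
          using q by blast
        obtain ds where ds: "length ds = length ts" "\<And>i. i < length ts \<Longrightarrow> (r, ds ! i) \<in> ?\<tau>s ! i" "relc r R ds"
          using r(3) unfolding relset_def by auto
        have n': "?\<tau>s ! i \<in> names" if "i < length ts" for i
        proof -
          have "?\<tau>s ! i \<in> set ?\<tau>s"
            using that by (intro nth_mem) simp
          then show ?thesis
            using ns[OF F] by blast
        qed
        note cs = nts[OF F r(1) pr]
        have "relc r R ?cs"
        proof (rule relc_cong[OF ds(3) l(1)])
          show "set ds \<subseteq> csyms L"
          proof
            fix c
            assume "c \<in> set ds"
            then obtain i where "i < length ts" "c = ds ! i"
              using ds(1) by (metis in_set_conv_nth)
            then show "c \<in> csyms L"
              using names_closed[OF n' ds(2)] by simp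
          qed
          show "set ?cs \<subseteq> csyms L"
          proof
            fix c
            assume "c \<in> set ?cs"
            then obtain i where "i < length ts" "c = ?cs ! i"
              by (metis in_set_conv_nth length_map)
            then show "c \<in> csyms L"
              using names_closed[OF n' cs] by simp
          qed
          show "eqc r (ds ! i) (?cs ! i)" if "i < ar L R" for i
            using names_eqc[OF n' ds(2) cs] that l by simp
        qed (use l ds in simp_all)
        moreover have "Neg (Rel R (map Const ?cs)) \<in> r"
          using N(2) pr unfolding inst by blast
        ultimately show False
          using neg_rel[OF r(1)] by blast
      qed
      then show ?thesis
        using Rel.prems(1) by (simp add: neg_def)
    qed
    with pos show ?case
      by (simp add: comp_def)
  next
    case (Neg \<phi>)
    have \<nu>: "\<nu> ` fv \<phi> \<subseteq> dom ?M" and g: "\<And>x. x \<in> fv \<phi> \<Longrightarrow> (p, g x) \<in> name (\<nu> x)"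
      using Neg.prems by simp_all
    have step: "(q, g x) \<in> name (\<nu> x)" if "x \<in> fv \<phi>" "q \<in> P" "p \<subseteq> q" for x q
      using mono[OF g[OF that(1)] that(2,3)] \<nu> that(1) by blast
    \<comment> \<open>The value of \<open>Neg \<phi>\<close> decodes to \<open>neg\<close> of the
      value of \<open>\<phi>\<close>, so the negative half produces a double \<open>neg\<close>. It
      cancels on regular open sets, and what remains is to force \<open>\<phi>\<close>.\<close>
    have "p \<in> neg (neg (dec (val alg ?M \<phi> \<nu>)))" if N: "Neg (Neg \<phi>) \<in> F" "Neg (inst (Neg \<phi>) g) \<in> p"
    proof -
      have F: "\<phi> \<in> F"
        using negF[OF negF[OF N(1)]] .
      have "p \<in> dec (val alg ?M \<phi> \<nu>)"
      proof (rule decI[OF cl[OF F \<nu>] Neg.prems(1)])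
        fix q
        assume q: "q \<in> P" "p \<subseteq> q"
        let ?r = "insert (inst \<phi> g) q"
        have r: "?r \<in> P"
          using neg_neg'[OF q(1) N(1) g_closed[OF \<nu> g]] N(2) q(2) by auto
        have "?r \<in> dec (val alg ?M \<phi> \<nu>)"
          using Neg.IH[OF r \<nu> step[OF _ r]] q F by blast
        with r show "\<exists>r\<in>P. q \<subseteq> r \<and> r \<in> dec (val alg ?M \<phi> \<nu>)"
          by blast
      qed
      then show ?thesis
        by (simp only: neg_neg[OF dec_RO[OF cl[OF F \<nu>]]])
    qed
    moreover have "p \<in> neg (dec (val alg ?M \<phi> \<nu>))" if "Neg \<phi> \<in> F" "inst (Neg \<phi>) g \<in> p"
      using Neg.IH[OF Neg.prems(1) \<nu> g] that by simp
    ultimately show ?case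
      using dec_bcompl[OF cl[OF negF \<nu>]] dec_bcompl[OF cl[OF negF[OF negF] \<nu>]] by simp
  next
    case (Conj J f)
    have \<nu>: "\<nu> ` fv (f j) \<subseteq> dom ?M" and g: "\<And>x. x \<in> fv (f j) \<Longrightarrow> (p, g x) \<in> name (\<nu> x)" if "j \<in> J" for j
      using Conj.prems that by auto
    have IH: "(f j \<in> F \<longrightarrow> inst (f j) g \<in> q \<longrightarrow> q \<in> dec (val alg ?M (f j) \<nu>)) \<and>
      (Neg (f j) \<in> F \<longrightarrow> Neg (inst (f j) g) \<in> q \<longrightarrow> q \<in> neg (dec (val alg ?M (f j) \<nu>)))"
      if "j \<in> J" "q \<in> P" "p \<subseteq> q" for j q
    proof (rule Conj.IH[OF _ that(2) \<nu>[OF that(1)]])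
      fix x
      assume "x \<in> fv (f j)"
      then show "(q, g x) \<in> name (\<nu> x)"
        using mono[OF g[OF that(1)] that(2,3)] \<nu>[OF that(1)] by blast
    qed simp
    have F: "f j \<in> F" if "Conj J f \<in> F" "j \<in> J" for j
      using that by (auto intro: subfms.conj)
    have F': "Neg (f j) \<in> F" if "Neg (Conj J f) \<in> F" "j \<in> J" for j
      using that by (auto intro: subfms.neg_conj)
    have c: "(\<lambda>j. val alg ?M (f j) \<nu>) ` J \<subseteq> carrier alg" if "Conj J f \<in> F"
      using cl[OF F[OF that] \<nu>] by (intro image_subsetI)
    note gc = g_closed[OF Conj.prems(2,3)]
    have pos: "p \<in> dec (val alg ?M (Conj J f) \<nu>)" if C: "Conj J f \<in> F" "inst (Conj J f) g \<in> p"
    proof -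
      \<comment> \<open>The conjuncts need not belong to \<open>p\<close>, and the clause
        \<open>conj\<close> adds just one of them at a time. Each is therefore forced separately: it
        can be added to any stronger condition, and density returns to \<open>p\<close>.\<close>
      have "p \<in> dec (val alg ?M (f j) \<nu>)" if j: "j \<in> J" for j
      proof (rule decI[OF cl[OF F[OF C(1) j] \<nu>[OF j]] Conj.prems(1)])
        fix q
        assume q: "q \<in> P" "p \<subseteq> q"
        let ?r = "insert (inst (f j) g) q"
        have r: "?r \<in> P"
          using conj[OF q(1) C(1) gc _ j] C(2) q(2) by blast
        have "?r \<in> dec (val alg ?M (f j) \<nu>)"
          using IH[OF j r] q F[OF C(1) j] by blast
        with r show "\<exists>r\<in>P. q \<subseteq> r \<and> r \<in> dec (val alg ?M (f j) \<nu>)"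
          by blast
      qed
      then show ?thesis
        using dec_inf[OF c[OF C(1)]] Conj.prems(1) by simp
    qed
    have "p \<in> neg (dec (val alg ?M (Conj J f) \<nu>))" if N: "Neg (Conj J f) \<in> F" "Neg (inst (Conj J f) g) \<in> p"
    proof (rule negI[OF cl[OF negF[OF N(1)] Conj.prems(2)] Conj.prems(1)])
      fix q
      assume q: "q \<in> P" "p \<subseteq> q"
      obtain j where j: "j \<in> J" "insert (inst (Neg (f j)) g) q \<in> P"
        using neg_conj[OF q(1) N(1) gc] N(2) q(2) by auto
      let ?r = "insert (inst (Neg (f j)) g) q"
      have "?r \<in> neg (dec (val alg ?M (f j) \<nu>))"
        using IH[OF j(1,2)] q F'[OF N(1) j(1)] by auto
      then have "?r \<in> neg (dec (val alg ?M (Conj J f) \<nu>))"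
        using neg_infI[OF c[OF negF[OF N(1)]], of "val alg ?M (f j) \<nu>" ?r] j(1) by simp
      with j show "\<exists>r\<in>P. q \<subseteq> r \<and> r \<in> neg (dec (val alg ?M (Conj J f) \<nu>))"
        by blast
    qed
    with pos show ?case
      by simp
  next
    case (Disj J f)
    have \<nu>: "\<nu> ` fv (f j) \<subseteq> dom ?M" and g: "\<And>x. x \<in> fv (f j) \<Longrightarrow> (p, g x) \<in> name (\<nu> x)" if "j \<in> J" for j
      using Disj.prems that by auto
    have IH: "(f j \<in> F \<longrightarrow> inst (f j) g \<in> q \<longrightarrow> q \<in> dec (val alg ?M (f j) \<nu>)) \<and>
      (Neg (f j) \<in> F \<longrightarrow> Neg (inst (f j) g) \<in> q \<longrightarrow> q \<in> neg (dec (val alg ?M (f j) \<nu>)))"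
      if "j \<in> J" "q \<in> P" "p \<subseteq> q" for j q
    proof (rule Disj.IH[OF _ that(2) \<nu>[OF that(1)]])
      fix x
      assume "x \<in> fv (f j)"
      then show "(q, g x) \<in> name (\<nu> x)"
        using mono[OF g[OF that(1)] that(2,3)] \<nu>[OF that(1)] by blast
    qed simp
    have F: "f j \<in> F" if "Disj J f \<in> F" "j \<in> J" for j
      using that by (auto intro: subfms.disj)
    have F': "Neg (f j) \<in> F" if "Neg (Disj J f) \<in> F" "j \<in> J" for j
      using that by (auto intro: subfms.neg_disj)
    have c: "(\<lambda>j. val alg ?M (f j) \<nu>) ` J \<subseteq> carrier alg" if "Disj J f \<in> F"
      using cl[OF F[OF that] \<nu>] by (intro image_subsetI)
    note gc = g_closed[OF Disj.prems(2,3)]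
    have pos: "p \<in> dec (val alg ?M (Disj J f) \<nu>)" if C: "Disj J f \<in> F" "inst (Disj J f) g \<in> p"
    proof (rule decI[OF cl[OF C(1) Disj.prems(2)] Disj.prems(1)])
      fix q
      assume q: "q \<in> P" "p \<subseteq> q"
      obtain j where j: "j \<in> J" "insert (inst (f j) g) q \<in> P"
        using disj[OF q(1) C(1) gc] C(2) q(2) by blast
      let ?r = "insert (inst (f j) g) q"
      have "?r \<in> dec (val alg ?M (f j) \<nu>)"
        using IH[OF j(1,2)] q F[OF C(1) j(1)] by blast
      then have "?r \<in> dec (val alg ?M (Disj J f) \<nu>)"
        using dec_supI[OF c[OF C(1)], of "val alg ?M (f j) \<nu>" ?r] j(1) by simp
      with j show "\<exists>r\<in>P. q \<subseteq> r \<and> r \<in> dec (val alg ?M (Disj J f) \<nu>)"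
        by blast
    qed
    have "p \<in> neg (dec (val alg ?M (Disj J f) \<nu>))" if N: "Neg (Disj J f) \<in> F" "Neg (inst (Disj J f) g) \<in> p"
    proof -
      have "p \<in> neg (dec (val alg ?M (f j) \<nu>))" if j: "j \<in> J" for j
      proof (rule negI[OF cl[OF F[OF negF[OF N(1)] j] \<nu>[OF j]] Disj.prems(1)])
        fix q
        assume q: "q \<in> P" "p \<subseteq> q"
        let ?r = "insert (inst (Neg (f j)) g) q"
        have r: "?r \<in> P"
          using neg_disj[OF q(1) N(1) gc _ j] N(2) q(2) by auto
        have "?r \<in> neg (dec (val alg ?M (f j) \<nu>))"
          using IH[OF j r] q F'[OF N(1) j] by auto
        with r show "\<exists>r\<in>P. q \<subseteq> r \<and> r \<in> neg (dec (val alg ?M (f j) \<nu>))"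
          by blast
      qed
      then show ?thesis
        using neg_supI[OF c[OF negF[OF N(1)]] Disj.prems(1)] by auto
    qed
    with pos show ?case
      by simp
  next
    case (All V \<phi>)
    have F: "\<phi> \<in> F" if "All V \<phi> \<in> F"
      using that by (auto intro: subfms.all)
    have F': "Neg \<phi> \<in> F" if "Neg (All V \<phi>) \<in> F"
      using that by (auto intro: subfms.neg_all)
    have \<nu>: "override_on \<nu> a V ` fv \<phi> \<subseteq> dom ?M" if "a \<in> V \<rightarrow>\<^sub>E dom ?M" for a
      using override_on_closed[OF _ that] All.prems(2) by simp
    have IH: "(\<phi> \<in> F \<longrightarrow> inst \<phi> (override_on g h V) \<in> q \<longrightarrow> q \<in> dec (val alg ?M \<phi> (override_on \<nu> a V))) \<and>
      (Neg \<phi> \<in> F \<longrightarrow> Neg (inst \<phi> (override_on g h V)) \<in> q \<longrightarrow> q \<in> neg (dec (val alg ?M \<phi> (override_on \<nu> a V))))"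
      if a: "a \<in> V \<rightarrow>\<^sub>E dom ?M" and q: "q \<in> P" "p \<subseteq> q" and h: "\<And>x. x \<in> V \<Longrightarrow> (q, h x) \<in> name (a x)" for q h a
    proof (rule All.IH[OF q(1) \<nu>[OF a]])
      fix x
      assume x: "x \<in> fv \<phi>"
      show "(q, override_on g h V x) \<in> name (override_on \<nu> a V x)"
      proof (cases "x \<in> V")
        case False
        then have "(q, g x) \<in> name (\<nu> x)"
          using All.prems(2) x by (intro mono[OF All.prems(3) q]) auto
        with False show ?thesis
          by simp
      qed (use h in simp)
    qed
    have c: "(\<lambda>a. val alg ?M \<phi> (override_on \<nu> a V)) ` (V \<rightarrow>\<^sub>E dom ?M) \<subseteq> carrier alg" if "All V \<phi> \<in> F"
      using cl[OF F[OF that] \<nu>] by (intro image_subsetI)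
    note gc = g_closed[OF All.prems(2,3)]
    have pos: "p \<in> dec (val alg ?M (All V \<phi>) \<nu>)" if C: "All V \<phi> \<in> F" "inst (All V \<phi>) g \<in> p"
    proof -
      have "p \<in> dec (val alg ?M \<phi> (override_on \<nu> a V))" if a: "a \<in> V \<rightarrow>\<^sub>E dom ?M" for a
      proof (rule decI[OF cl[OF F[OF C(1)] \<nu>[OF a]] All.prems(1)])
        fix q
        assume q: "q \<in> P" "p \<subseteq> q"
        \<comment> \<open>The elements \<open>a x\<close> may be proper mixtures, whereas the clause
          \<open>all\<close> adds instances at constants. So \<open>q\<close> is first extended to a
          condition at which every \<open>a x\<close> with \<open>x \<in> V\<close> has a value
          \<open>h x\<close>.\<close>
        have "(\<lambda>x. name (a x)) ` V \<subseteq> D"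
          using PiE_mem[OF a] by fastforce
        then obtain r h where r: "r \<in> P" "q \<subseteq> r" and h: "\<And>x. x \<in> V \<Longrightarrow> (r, h x) \<in> name (a x)"
          using adequateD[OF D disjI1[OF C(1)] q(1)] by blast
        have hc: "h ` V \<subseteq> csyms L"
          using a by (intro g_closed[OF _ h]) auto
        let ?s = "insert (inst \<phi> (override_on g h V)) r"
        have pr: "p \<subseteq> r"
          using q r by blast
        have s: "?s \<in> P"
          using all[OF r(1) C(1) gc _ hc] C(2) pr by blast
        have "(?s, h x) \<in> name (a x)" if "x \<in> V" for x
          using a that s by (intro mono[OF h]) auto
        then have "?s \<in> dec (val alg ?M \<phi> (override_on \<nu> a V))"
          using IH[OF a s] pr F[OF C(1)] by blast
        with s r show "\<exists>r\<in>P. q \<subseteq> r \<and> r \<in> dec (val alg ?M \<phi> (override_on \<nu> a V))"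
          by blast
      qed
      then show ?thesis
        using dec_inf[OF c[OF C(1)]] All.prems(1) by simp
    qed
    have "p \<in> neg (dec (val alg ?M (All V \<phi>) \<nu>))" if N: "Neg (All V \<phi>) \<in> F" "Neg (inst (All V \<phi>) g) \<in> p"
    proof (rule negI[OF cl[OF negF[OF N(1)] All.prems(2)] All.prems(1)])
      fix q
      assume q: "q \<in> P" "p \<subseteq> q"
      obtain h where h: "h ` V \<subseteq> csyms L" "insert (inst (Neg \<phi>) (override_on g h V)) q \<in> P"
        using neg_all[OF q(1) N(1) gc] N(2) q(2) by auto
      \<comment> \<open>The counterexample consists of constants. In the domain they appear as their
        hats, which have the value \<open>h x\<close> at every condition.\<close>
      let ?r = "insert (inst (Neg \<phi>) (override_on g h V)) q" and ?a = "restrict (\<lambda>x. code (hat (h x))) V"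
      have a: "?a \<in> V \<rightarrow>\<^sub>E dom ?M"
        using h(1) D_hat by auto
      have "(?r, h x) \<in> name (?a x)" if "x \<in> V" for x
        using that h(2) by (simp add: hat_def)
      then have "?r \<in> neg (dec (val alg ?M \<phi> (override_on \<nu> ?a V)))"
        using IH[OF a h(2)] q F'[OF N(1)] by auto
      then have "?r \<in> neg (dec (val alg ?M (All V \<phi>) \<nu>))"
        using neg_infI[OF c[OF negF[OF N(1)]], of "val alg ?M \<phi> (override_on \<nu> ?a V)" ?r] a by simp
      with h show "\<exists>r\<in>P. q \<subseteq> r \<and> r \<in> neg (dec (val alg ?M (All V \<phi>) \<nu>))"
        by blast
    qed
    with pos show ?case
      by simp
  next
    case (Ex V \<phi>)
    have F: "\<phi> \<in> F" if "Ex V \<phi> \<in> F"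
      using that by (auto intro: subfms.ex)
    have F': "Neg \<phi> \<in> F" if "Neg (Ex V \<phi>) \<in> F"
      using that by (auto intro: subfms.neg_ex)
    have \<nu>: "override_on \<nu> a V ` fv \<phi> \<subseteq> dom ?M" if "a \<in> V \<rightarrow>\<^sub>E dom ?M" for a
      using override_on_closed[OF _ that] Ex.prems(2) by simp
    have IH: "(\<phi> \<in> F \<longrightarrow> inst \<phi> (override_on g h V) \<in> q \<longrightarrow> q \<in> dec (val alg ?M \<phi> (override_on \<nu> a V))) \<and>
      (Neg \<phi> \<in> F \<longrightarrow> Neg (inst \<phi> (override_on g h V)) \<in> q \<longrightarrow> q \<in> neg (dec (val alg ?M \<phi> (override_on \<nu> a V))))"
      if a: "a \<in> V \<rightarrow>\<^sub>E dom ?M" and q: "q \<in> P" "p \<subseteq> q" and h: "\<And>x. x \<in> V \<Longrightarrow> (q, h x) \<in> name (a x)" for q h a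
    proof (rule Ex.IH[OF q(1) \<nu>[OF a]])
      fix x
      assume x: "x \<in> fv \<phi>"
      show "(q, override_on g h V x) \<in> name (override_on \<nu> a V x)"
      proof (cases "x \<in> V")
        case False
        then have "(q, g x) \<in> name (\<nu> x)"
          using Ex.prems(2) x by (intro mono[OF Ex.prems(3) q]) auto
        with False show ?thesis
          by simp
      qed (use h in simp)
    qed
    have c: "(\<lambda>a. val alg ?M \<phi> (override_on \<nu> a V)) ` (V \<rightarrow>\<^sub>E dom ?M) \<subseteq> carrier alg" if "Ex V \<phi> \<in> F"
      using cl[OF F[OF that] \<nu>] by (intro image_subsetI)
    note gc = g_closed[OF Ex.prems(2,3)]
    have pos: "p \<in> dec (val alg ?M (Ex V \<phi>) \<nu>)" if C: "Ex V \<phi> \<in> F" "inst (Ex V \<phi>) g \<in> p"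
    proof (rule decI[OF cl[OF C(1) Ex.prems(2)] Ex.prems(1)])
      fix q
      assume q: "q \<in> P" "p \<subseteq> q"
      obtain h where h: "h ` V \<subseteq> csyms L" "insert (inst \<phi> (override_on g h V)) q \<in> P"
        using ex[OF q(1) C(1) gc] C(2) q(2) by blast
      let ?r = "insert (inst \<phi> (override_on g h V)) q" and ?a = "restrict (\<lambda>x. code (hat (h x))) V"
      have a: "?a \<in> V \<rightarrow>\<^sub>E dom ?M"
        using h(1) D_hat by auto
      have "(?r, h x) \<in> name (?a x)" if "x \<in> V" for x
        using that h(2) by (simp add: hat_def)
      then have "?r \<in> dec (val alg ?M \<phi> (override_on \<nu> ?a V))"
        using IH[OF a h(2)] q F[OF C(1)] by blast
      then have "?r \<in> dec (val alg ?M (Ex V \<phi>) \<nu>)"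
        using dec_supI[OF c[OF C(1)], of "val alg ?M \<phi> (override_on \<nu> ?a V)" ?r] a by simp
      with h show "\<exists>r\<in>P. q \<subseteq> r \<and> r \<in> dec (val alg ?M (Ex V \<phi>) \<nu>)"
        by blast
    qed
    have "p \<in> neg (dec (val alg ?M (Ex V \<phi>) \<nu>))" if N: "Neg (Ex V \<phi>) \<in> F" "Neg (inst (Ex V \<phi>) g) \<in> p"
    proof -
      have "p \<in> neg (dec (val alg ?M \<phi> (override_on \<nu> a V)))" if a: "a \<in> V \<rightarrow>\<^sub>E dom ?M" for a
      proof (rule negI[OF cl[OF F[OF negF[OF N(1)]] \<nu>[OF a]] Ex.prems(1)])
        fix q
        assume q: "q \<in> P" "p \<subseteq> q"
        have "(\<lambda>x. name (a x)) ` V \<subseteq> D"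
          using PiE_mem[OF a] by fastforce
        then obtain r h where r: "r \<in> P" "q \<subseteq> r" and h: "\<And>x. x \<in> V \<Longrightarrow> (r, h x) \<in> name (a x)"
          using adequateD[OF D disjI2[OF negF[OF N(1)]] q(1)] by blast
        have hc: "h ` V \<subseteq> csyms L"
          using a by (intro g_closed[OF _ h]) auto
        let ?s = "insert (inst (Neg \<phi>) (override_on g h V)) r"
        have pr: "p \<subseteq> r"
          using q r by blast
        have s: "?s \<in> P"
          using neg_ex[OF r(1) N(1) gc _ hc] N(2) pr by auto
        have "(?s, h x) \<in> name (a x)" if "x \<in> V" for x
          using a that s by (intro mono[OF h]) auto
        then have "?s \<in> neg (dec (val alg ?M \<phi> (override_on \<nu> a V)))"
          using IH[OF a s] pr F'[OF N(1)] by auto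
        with s r show "\<exists>r\<in>P. q \<subseteq> r \<and> r \<in> neg (dec (val alg ?M \<phi> (override_on \<nu> a V)))"
          by blast
      qed
      then show ?thesis
        using neg_supI[OF c[OF negF[OF N(1)]] Ex.prems(1)] by auto
    qed
    with pos show ?case
      by simp
  qed
  then show "\<lbrakk>\<phi> \<in> F; inst \<phi> g \<in> p\<rbrakk> \<Longrightarrow> p \<in> dec (val alg (model D) \<phi> \<nu>)"
    and "\<lbrakk>Neg \<phi> \<in> F; Neg (inst \<phi> g) \<in> p\<rbrakk> \<Longrightarrow> p \<in> neg (dec (val alg (model D) \<phi> \<nu>))"
    by blast+
qed

lemma val_eq_top:
  assumes D: "adequate D" and \<phi>: "\<phi> \<in> F" "sentence \<phi>" and \<nu>: "range \<nu> \<subseteq> dom (model D)"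
    and dense: "\<And>p. p \<in> P \<Longrightarrow> insert (inst \<phi> g) p \<in> P"
  shows "val alg (model D) \<phi> \<nu> = \<top>\<^bsub>alg\<^esub>"
proof -
  have M: "bv_model L alg (model D)"
    using D by (intro bv_model_model) (simp_all add: adequate_def)
  have \<nu>': "\<nu> ` fv \<phi> \<subseteq> dom (model D)"
    using \<nu> by blast
  have c: "val alg (model D) \<phi> \<nu> \<in> carrier alg"
    by (rule val_closed[OF M F_lang[OF \<phi>(1)] \<nu>'])
  have "p \<in> dec (val alg (model D) \<phi> \<nu>)" if "p \<in> P" for p
  proof (rule RO_dense[OF dec_RO[OF c] that])
    fix q
    assume q: "q \<in> P"
    then have "insert (inst \<phi> g) q \<in> dec (val alg (model D) \<phi> \<nu>)"
      using \<phi>(2) by (intro truth(1)[OF D dense \<nu>' _ \<phi>(1), where g = g]) (simp_all add: sentence_def)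
    with dense[OF q] show "\<exists>r\<in>P. q \<subseteq> r \<and> r \<in> dec (val alg (model D) \<phi> \<nu>)"
      by blast
  qed
  then show ?thesis
    using c by (intro eq_topI) auto
qed

end

section \<open>Boolean consistency\<close>

lemma bool_consistentE:
  fixes L :: "('r, 'c) signature"
  assumes "bool_consistent (U :: 'u itself) L \<Gamma>"
  obtains B and M :: "('u, 'u, 'r, 'c) bv_structure" and \<nu>
  where "bv_model L B M" "range \<nu> \<subseteq> dom M" "\<forall>\<phi>\<in>\<Gamma>. val B M \<phi> \<nu> = \<top>\<^bsub>B\<^esub>"
  using assms unfolding bool_consistent_def by blast

lemma bv_model_cstv:
  assumes M: "bv_model L B M" and L': "rsyms L' = rsyms L" "ar L' = ar L"
    and k: "\<And>c. c \<in> csyms L' \<Longrightarrow> k c \<in> dom M"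
  shows "bv_model L' B (M\<lparr>cstv := k\<rparr>)"
proof -
  interpret cba B
    using bv_modelD(1)[OF M] by (simp add: cba_def)
  let ?M = "M\<lparr>cstv := k\<rparr>"
  show ?thesis
  proof (rule bv_modelI)
    fix x y z d
    assume "x \<in> dom ?M" "y \<in> dom ?M" "z \<in> dom ?M" "d \<in> carrier B"
      "d \<sqsubseteq>\<^bsub>B\<^esub> eqv ?M x y" "d \<sqsubseteq>\<^bsub>B\<^esub> eqv ?M y z"
    then show "d \<sqsubseteq>\<^bsub>B\<^esub> eqv ?M x z"
      using bv_model_transD[OF M, of x y z d] by simp
  next
    fix R as bs d
    assume "R \<in> rsyms L'" "as \<in> lists (dom ?M)" "bs \<in> lists (dom ?M)" "d \<in> carrier B"
      "length as = ar L' R" "length bs = ar L' R"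
      "\<And>i. i < ar L' R \<Longrightarrow> d \<sqsubseteq>\<^bsub>B\<^esub> eqv ?M (as ! i) (bs ! i)" "d \<sqsubseteq>\<^bsub>B\<^esub> relv ?M R as"
    then show "d \<sqsubseteq>\<^bsub>B\<^esub> relv ?M R bs"
      using bv_model_relD[OF M, of R as bs d] by (simp add: L' del: in_lists_conv_set)
  next
    fix x y
    assume "x \<in> dom ?M" "y \<in> dom ?M"
    then show "eqv ?M x y = eqv ?M y x"
      using bv_modelD(7)[OF M, of x y] by simp
  qed (use bv_modelD[OF M] k L' in \<open>simp_all del: in_lists_conv_set\<close>)
qed

lemma bool_consistent_insert:
  assumes "bool_consistent (U :: 'u itself) L \<Gamma>" "\<And>\<phi>. \<phi> \<in> \<Gamma> \<Longrightarrow> lang L \<phi>" "\<And>\<chi>. \<chi> \<in> X \<Longrightarrow> lang L \<chi>"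
    and "\<And>B (M :: ('u, 'u, 'r, 'c) bv_structure) \<nu>.
      \<lbrakk>cba B; bv_model L B M; range \<nu> \<subseteq> dom M; \<And>\<phi>. \<phi> \<in> \<Gamma> \<Longrightarrow> val B M \<phi> \<nu> = \<top>\<^bsub>B\<^esub>\<rbrakk>
      \<Longrightarrow> \<exists>\<chi>\<in>X. val B M \<chi> \<nu> \<noteq> \<bottom>\<^bsub>B\<^esub>"
  shows "\<exists>\<chi>\<in>X. bool_consistent (U :: 'u itself) L (insert \<chi> \<Gamma>)"
proof -
  obtain B and M :: "('u, 'u, 'r, 'c) bv_structure" and \<nu>
    where M: "bv_model L B M" "range \<nu> \<subseteq> dom M" "\<And>\<phi>. \<phi> \<in> \<Gamma> \<Longrightarrow> val B M \<phi> \<nu> = \<top>\<^bsub>B\<^esub>"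
    using assms(1) unfolding bool_consistent_def by blast
  have B: "cba B"
    using bv_modelD(1)[OF M(1)] by (simp add: cba_def)
  then interpret cba B .
  obtain \<chi> where \<chi>: "\<chi> \<in> X" "val B M \<chi> \<nu> \<noteq> \<bottom>\<^bsub>B\<^esub>"
    using assms(4)[OF B M] by blast
  have c: "val B M \<chi> \<nu> \<in> carrier B"
    using M(2) assms(3)[OF \<chi>(1)] by (intro val_closed[OF M(1)]) auto
  have "bool_consistent (U :: 'u itself) L (insert \<chi> \<Gamma>)"
    using M(1,2) c \<chi>(2)
  proof (rule bool_consistentI_nonzero)
    fix \<phi>
    assume "\<phi> \<in> insert \<chi> \<Gamma>"
    then show "lang L \<phi> \<and> val B M \<chi> \<nu> \<sqsubseteq>\<^bsub>B\<^esub> val B M \<phi> \<nu>"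
      using M(3) c assms(2,3) \<chi>(1) by (cases "\<phi> = \<chi>") simp_all
  qed
  with \<chi>(1) show ?thesis
    by blast
qed

lemma bool_consistent_insert1:
  assumes "bool_consistent (U :: 'u itself) L \<Gamma>" "\<And>\<phi>. \<phi> \<in> \<Gamma> \<Longrightarrow> lang L \<phi>" "lang L \<chi>"
    and "\<And>B (M :: ('u, 'u, 'r, 'c) bv_structure) \<nu>.
      \<lbrakk>cba B; bv_model L B M; range \<nu> \<subseteq> dom M; \<And>\<phi>. \<phi> \<in> \<Gamma> \<Longrightarrow> val B M \<phi> \<nu> = \<top>\<^bsub>B\<^esub>\<rbrakk>
      \<Longrightarrow> val B M \<chi> \<nu> = \<top>\<^bsub>B\<^esub>"
  shows "bool_consistent (U :: 'u itself) L (insert \<chi> \<Gamma>)"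
proof -
  have "\<exists>\<chi>\<in>{\<chi>}. bool_consistent (U :: 'u itself) L (insert \<chi> \<Gamma>)"
  proof (rule bool_consistent_insert[OF assms(1,2)])
    fix B :: "'u gorder" and M :: "('u, 'u, 'r, 'c) bv_structure" and \<nu>
    assume *: "cba B" "bv_model L B M" "range \<nu> \<subseteq> dom M" "\<And>\<phi>. \<phi> \<in> \<Gamma> \<Longrightarrow> val B M \<phi> \<nu> = \<top>\<^bsub>B\<^esub>"
    then interpret cba B
      by simp
    show "\<exists>\<chi>\<in>{\<chi>}. val B M \<chi> \<nu> \<noteq> \<bottom>\<^bsub>B\<^esub>"
      using assms(4)[OF *] bottom_neq_top by simp
  qed (use assms(3) in auto)
  then show ?thesis
    by simp
qed

text \<open>A witness is named by reinterpreting the constants \<open>k ` V\<close>, which do not occur in \<open>\<Gamma>\<close>.\<close>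

lemma bool_consistent_witness:
  fixes B :: "'u gorder" and M :: "('u, 'u, 'r, 'c) bv_structure"
    and \<phi> :: "('r, 'c, 'v, 'i) fm"
  assumes M: "bv_model L B M" "range \<nu> \<subseteq> dom M"
    and \<Gamma>: "\<And>\<chi>. \<chi> \<in> \<Gamma> \<Longrightarrow> lang K \<chi> \<and> val B M \<chi> \<nu> = \<top>\<^bsub>B\<^esub>"
    and K: "rsyms K = rsyms L" "ar K = ar L" "csyms K \<subseteq> csyms L"
    and k: "inj_on k V" "k ` V \<subseteq> csyms L - csyms K"
    and \<phi>: "lang K \<phi>" "g ` (fv \<phi> - V) \<subseteq> csyms K"
    and a: "a \<in> V \<rightarrow>\<^sub>E dom M" "val B M \<phi> (override_on (\<lambda>x. cstv M (g x)) a V) \<noteq> \<bottom>\<^bsub>B\<^esub>"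
  shows "bool_consistent (U :: 'u itself) L (insert (inst \<phi> (override_on g k V)) \<Gamma>)"
proof -
  interpret cba B
    using bv_modelD(1)[OF M(1)] by (simp add: cba_def)
  \<comment> \<open>Injectivity of \<open>k\<close> on \<open>V\<close> lets its values name the
    components of \<open>a\<close>. The constants of \<open>K\<close> keep their meaning, so
    \<open>\<Gamma>\<close>, \<open>\<phi>\<close> and the parameters \<open>g\<close> are not
    affected.\<close>
  define M' where "M' = M\<lparr>cstv := \<lambda>c. if c \<in> k ` V then a (inv_into V k c) else cstv M c\<rparr>"
  have M'_simps [simp]: "dom M' = dom M" "eqv M' = eqv M" "relv M' = relv M"
    by (simp_all add: M'_def)
  have cst_k: "cstv M' (k x) = a x" if "x \<in> V" for x
    using that k(1) by (simp add: M'_def)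
  have cst: "cstv M' c = cstv M c" if "c \<in> csyms K" for c
    using that k(2) by (auto simp: M'_def)
  have M': "bv_model L B M'"
    unfolding M'_def
  proof (rule bv_model_cstv[OF M(1)])
    fix c
    assume "c \<in> csyms L"
    then show "(if c \<in> k ` V then a (inv_into V k c) else cstv M c) \<in> dom M"
      using bv_modelD(5)[OF M(1)] PiE_mem[OF a(1)] by (simp add: inv_into_into)
  qed simp_all
  have val: "val B M' \<chi> \<nu>' = val B M \<chi> \<nu>'" if "lang K \<chi>" for \<chi> :: "('r, 'c, 'v, 'i) fm" and \<nu>'
    using that cst by (intro val_cong_signature) simp_all
  have "val B M' (inst \<phi> (override_on g k V)) \<nu> = val B M' \<phi> (\<lambda>x. cstv M' (override_on g k V x))"
    by (rule val_subst_consts)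
  also have "\<dots> = val B M' \<phi> (override_on (\<lambda>x. cstv M (g x)) a V)"
  proof (rule val_cong_fv)
    fix x
    assume "x \<in> fv \<phi>"
    then show "cstv M' (override_on g k V x) = override_on (\<lambda>x. cstv M (g x)) a V x"
      using cst_k cst[of "g x"] \<phi>(2) by (cases "x \<in> V") auto
  qed
  finally have v: "val B M' (inst \<phi> (override_on g k V)) \<nu> \<noteq> \<bottom>\<^bsub>B\<^esub>"
    using a(2) val[OF \<phi>(1)] by simp
  have l: "lang L \<chi>" if "lang K \<chi>" for \<chi> :: "('r, 'c, 'v, 'i) fm"
    using that K by (intro lang_mono[OF that]) auto
  have lang: "lang L (inst \<phi> (override_on g k V))"
    using k(2) \<phi>(2) K(3) by (intro lang_subst_consts l[OF \<phi>(1)]) (auto simp: override_on_def)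
  have c: "val B M' (inst \<phi> (override_on g k V)) \<nu> \<in> carrier B"
    using lang M(2) by (intro val_closed[OF M']) auto
  have "range \<nu> \<subseteq> dom M'"
    using M(2) by simp
  with M' show ?thesis
    using c v
  proof (rule bool_consistentI_nonzero)
    fix \<chi>
    assume \<chi>: "\<chi> \<in> insert (inst \<phi> (override_on g k V)) \<Gamma>"
    show "lang L \<chi> \<and> val B M' (inst \<phi> (override_on g k V)) \<nu> \<sqsubseteq>\<^bsub>B\<^esub> val B M' \<chi> \<nu>"
    proof (cases "\<chi> = inst \<phi> (override_on g k V)")
      case True
      then show ?thesis
        using c lang by simp
    next
      case False
      then have "lang K \<chi>" "val B M \<chi> \<nu> = \<top>\<^bsub>B\<^esub>"
        using \<chi> \<Gamma> by auto
      then show ?thesis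
        using l val c by simp
    qed
  qed
qed

section \<open>Conjunctions of sets of formulae\<close>

lemma BigConj_eq:
  fixes \<Phi> :: "('r, 'c, 'v, 'i) fm set"
  assumes "|\<Phi>| \<le>o |UNIV :: 'i set|"
  obtains J f where "BigConj \<Phi> = Conj J f" "f ` J = \<Phi>"
proof -
  let ?e = "SOME e :: ('r, 'c, 'v, 'i) fm \<Rightarrow> 'i. inj_on e \<Phi>"
  have "\<exists>e :: ('r, 'c, 'v, 'i) fm \<Rightarrow> 'i. inj_on e \<Phi>"
    using assms card_of_ordLeq[of \<Phi> "UNIV :: 'i set"] by auto
  then have "inj_on ?e \<Phi>"
    by (rule someI_ex)
  then have "inv_into \<Phi> ?e ` (?e ` \<Phi>) = \<Phi>"
    by (simp add: image_image)
  moreover have "BigConj \<Phi> = Conj (?e ` \<Phi>) (inv_into \<Phi> ?e)"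
    by (simp add: BigConj_def Let_def)
  ultimately show thesis
    using that by blast
qed

context
  fixes \<Phi> :: "('r, 'c, 'v, 'i) fm set"
  assumes card: "|\<Phi>| \<le>o |UNIV :: 'i set|"
begin

lemma lang_BigConj: "lang L (BigConj \<Phi>) \<longleftrightarrow> (\<forall>\<phi>\<in>\<Phi>. lang L \<phi>)"
proof -
  obtain J f where J: "BigConj \<Phi> = Conj J f" "f ` J = \<Phi>"
    using BigConj_eq[OF card] .
  show ?thesis
    using J(2) by (auto simp: J(1))
qed

lemma fv_BigConj: "fv (BigConj \<Phi>) = (\<Union>\<phi>\<in>\<Phi>. fv \<phi>)"
proof -
  obtain J f where J: "BigConj \<Phi> = Conj J f" "f ` J = \<Phi>"
    using BigConj_eq[OF card] .
  show ?thesis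
    using J(2) by (auto simp: J(1))
qed

lemma val_BigConj_eq_top_iff:
  assumes M: "bv_model L B M" "range \<nu> \<subseteq> dom M" "\<And>\<phi>. \<phi> \<in> \<Phi> \<Longrightarrow> lang L \<phi>"
  shows "val B M (BigConj \<Phi>) \<nu> = \<top>\<^bsub>B\<^esub> \<longleftrightarrow> (\<forall>\<phi>\<in>\<Phi>. val B M \<phi> \<nu> = \<top>\<^bsub>B\<^esub>)"
proof -
  obtain J f where J: "BigConj \<Phi> = Conj J f" "f ` J = \<Phi>"
    using BigConj_eq[OF card] .
  interpret cba B
    using bv_modelD(1)[OF M(1)] by (simp add: cba_def)
  have "(\<lambda>j. val B M (f j) \<nu>) ` J \<subseteq> carrier B"
    using M J(2) by (intro image_subsetI val_closed[OF M(1)]) auto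
  then have "val B M (BigConj \<Phi>) \<nu> = \<top>\<^bsub>B\<^esub> \<longleftrightarrow> (\<forall>j\<in>J. val B M (f j) \<nu> = \<top>\<^bsub>B\<^esub>)"
    unfolding J(1) by (simp add: inf_eq_top_iff)
  also have "\<dots> \<longleftrightarrow> (\<forall>\<phi>\<in>f ` J. val B M \<phi> \<nu> = \<top>\<^bsub>B\<^esub>)"
    by simp
  finally show ?thesis
    by (simp only: J(2))
qed

lemma bool_consistent_BigConj_iff:
  assumes "\<And>\<phi>. \<phi> \<in> \<Phi> \<Longrightarrow> lang L \<phi>"
  shows "bool_consistent (U :: 'u itself) L {BigConj \<Phi>} \<longleftrightarrow> bool_consistent (U :: 'u itself) L \<Phi>"
proof -
  have "bv_model L B M \<and> range \<nu> \<subseteq> dom M \<and> (\<forall>\<phi>\<in>{BigConj \<Phi>}. val B M \<phi> \<nu> = \<top>\<^bsub>B\<^esub>) \<longleftrightarrow>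
      bv_model L B M \<and> range \<nu> \<subseteq> dom M \<and> (\<forall>\<phi>\<in>\<Phi>. val B M \<phi> \<nu> = \<top>\<^bsub>B\<^esub>)"
    for B and M :: "('u, 'u, 'r, 'c) bv_structure" and \<nu>
    using val_BigConj_eq_top_iff[of L B M \<nu>] assms by auto
  then show ?thesis
    by (simp only: bool_consistent_def)
qed

text \<open>The root is a conjunction, so no clause for negations applies to it, and every step
  below it happens inside a member of \<open>\<Phi>\<close>. The root itself is the one subformula
  that the members do not account for; \<open>conservative_strengthening_family\<close> has to treat
  it separately.\<close>

lemma subfms_BigConj:
  "subfms (BigConj \<Phi>) = insert (BigConj \<Phi>) (\<Union>\<phi>\<in>\<Phi>. subfms \<phi>)"
proof
  obtain J f where J: "BigConj \<Phi> = Conj J f" "f ` J = \<Phi>"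
    using BigConj_eq[OF card] .
  show "subfms (BigConj \<Phi>) \<subseteq> insert (BigConj \<Phi>) (\<Union>\<phi>\<in>\<Phi>. subfms \<phi>)"
  proof
    fix \<chi>
    assume "\<chi> \<in> subfms (BigConj \<Phi>)"
    then show "\<chi> \<in> insert (BigConj \<Phi>) (\<Union>\<phi>\<in>\<Phi>. subfms \<phi>)"
    proof induction
      case (conj J' f' j)
      show ?case
      proof (cases "Conj J' f' = BigConj \<Phi>")
        case True
        then have "f' j \<in> \<Phi>"
          using J conj.hyps by auto
        then show ?thesis
          using subfms.self by blast
      next
        case False
        then obtain \<phi> where "\<phi> \<in> \<Phi>" "Conj J' f' \<in> subfms \<phi>"
          using conj.IH by auto
        then show ?thesis
          using subfms.conj[OF _ conj.hyps(2)] by blast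
      qed
    next
      case self
      then show ?case
        by simp
    next
      case (neg \<phi>)
      then show ?case
        using J(1) by (auto intro: subfms.neg)
    next
      case (disj J' f' j)
      then show ?case
        using J(1) by (auto intro: subfms.disj)
    next
      case (all V \<phi>)
      then show ?case
        using J(1) by (auto intro: subfms.all)
    next
      case (ex V \<phi>)
      then show ?case
        using J(1) by (auto intro: subfms.ex)
    next
      case (neg_conj J' f' j)
      then show ?case
        using J(1) by (auto intro: subfms.neg_conj)
    next
      case (neg_disj J' f' j)
      then show ?case
        using J(1) by (auto intro: subfms.neg_disj)
    next
      case (neg_all V \<phi>)
      then show ?case
        using J(1) by (auto intro: subfms.neg_all)
    next
      case (neg_ex V \<phi>)
      then show ?case
        using J(1) by (auto intro: subfms.neg_ex)
    qed
  qed
  have "f j \<in> subfms (BigConj \<Phi>)" if "j \<in> J" for j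
    unfolding J(1) by (rule subfms.conj[OF subfms.self that])
  then have "\<phi> \<in> subfms (BigConj \<Phi>)" if "\<phi> \<in> \<Phi>" for \<phi>
    using J(2) that by blast
  then show "insert (BigConj \<Phi>) (\<Union>\<phi>\<in>\<Phi>. subfms \<phi>) \<subseteq> subfms (BigConj \<Phi>)"
    using subfms_trans[of _ _ "BigConj \<Phi>"] by (auto intro: subfms.self)
qed

end

text \<open>The only derivation that has to be exhibited: take the right conjunction apart, then the
  left one, and each branch is an axiom. Everything else about conservativity is semantic.\<close>

lemma provable_BigConj_subset:
  fixes \<Phi> \<Psi> :: "('r, 'c, 'v, 'i) fm set"
  assumes card: "|\<Phi>| \<le>o |UNIV :: 'i set|" and sub: "\<Psi> \<subseteq> \<Phi>" and lang: "\<And>\<phi>. \<phi> \<in> \<Phi> \<Longrightarrow> lang L \<phi>"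
  shows "provable L {BigConj \<Phi>} {BigConj \<Psi>}"
proof -
  have card': "|\<Psi>| \<le>o |UNIV :: 'i set|"
    using card_of_mono1[OF sub] card by (rule ordLeq_transitive)
  obtain J f where J: "BigConj \<Phi> = Conj J f" "f ` J = \<Phi>"
    using BigConj_eq[OF card] .
  obtain K g where K: "BigConj \<Psi> = Conj K g" "g ` K = \<Psi>"
    using BigConj_eq[OF card'] .
  have gK: "g j \<in> \<Phi>" if "j \<in> K" for j
    using K(2) sub that by blast
  have fJ: "f j \<in> \<Phi>" if "j \<in> J" for j
    using J(2) that by blast
  have inf: "fm_inf_inf L (Conj J f)" "fm_inf_inf L (Conj K g)" "\<And>\<phi>. \<phi> \<in> \<Phi> \<Longrightarrow> fm_inf_inf L \<phi>"
    using lang gK fJ by (auto intro!: lang_fm_inf_inf)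
  have "provable L {Conj J f} {Conj K g}"
  proof (rule provable.ConjR[where \<Delta> = "{}"])
    fix j
    assume "j \<in> K"
    then have g: "g j \<in> \<Phi>"
      by (rule gK)
    have "provable L (insert (g j) \<Phi>) (insert (g j) {})"
      using inf g by (intro provable.Axiom) auto
    then have "provable L ({} \<union> f ` J) {g j}"
      using g J(2) by (simp add: insert_absorb)
    then show "provable L {Conj J f} {g j}"
      using inf g by (intro provable.ConjL) auto
  qed (use inf in auto)
  then show ?thesis
    by (simp add: J K)
qed

lemma finite_card_of_le_infinite:
  assumes "finite A" "infinite B"
  shows "|A| \<le>o |B|"
  using assms by (intro ordLess_imp_ordLeq finite_ordLess_infinite) (simp_all add: Field_card_of card_of_well_order_on)

lemma bv_model_reduct:
  assumes "bv_model (expand L C) B M"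
  shows "bv_model L B M"
proof -
  have "bv_model L B (M\<lparr>cstv := cstv M\<rparr>)"
    by (rule bv_model_cstv[OF assms]) (simp_all add: bv_modelD(5)[OF assms])
  then show ?thesis
    by simp
qed

lemma bool_consistent_expand:
  fixes L :: "('r, 'c) signature"
  assumes "bool_consistent (U :: 'u itself) L \<Gamma>" "\<And>\<phi>. \<phi> \<in> \<Gamma> \<Longrightarrow> lang L \<phi>"
  shows "bool_consistent (U :: 'u itself) (expand L C) \<Gamma>"
proof -
  obtain B and M :: "('u, 'u, 'r, 'c) bv_structure" and \<nu>
    where M: "bv_model L B M" "range \<nu> \<subseteq> dom M" "\<forall>\<phi>\<in>\<Gamma>. val B M \<phi> \<nu> = \<top>\<^bsub>B\<^esub>"
    using bool_consistentE[OF assms(1)] .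
  obtain m where m: "m \<in> dom M"
    using bv_modelD(2)[OF M(1)] by blast
  let ?M = "M\<lparr>cstv := \<lambda>c. if c \<in> csyms L then cstv M c else m\<rparr>"
  have "bv_model (expand L C) B ?M"
    using m bv_modelD(5)[OF M(1)] by (intro bv_model_cstv[OF M(1)]) simp_all
  moreover have "val B ?M \<phi> \<nu> = \<top>\<^bsub>B\<^esub>" if "\<phi> \<in> \<Gamma>" for \<phi>
    using M(3) that assms(2)[OF that] by (subst val_cong_signature[where M = M and L = L]) simp_all
  ultimately show ?thesis
    unfolding bool_consistent_def using M(2)
    by (intro exI[of _ B] exI[of _ ?M] exI[of _ \<nu>]) simp
qed

lemma bool_consistent_mono:
  "\<lbrakk>bool_consistent U L \<Gamma>; \<Delta> \<subseteq> \<Gamma>\<rbrakk> \<Longrightarrow> bool_consistent U L \<Delta>"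
  unfolding bool_consistent_def by (meson subsetD)

lemma bool_consistent_And_BigConj_iff:
  fixes \<Phi> \<Theta> :: "('r, 'c, 'v, 'i) fm set"
  assumes "|\<Phi>| \<le>o |UNIV :: 'i set|" "|\<Theta>| \<le>o |UNIV :: 'i set|" "infinite (UNIV :: 'i set)"
    and lang: "\<And>\<phi>. \<phi> \<in> \<Phi> \<union> \<Theta> \<Longrightarrow> lang L \<phi>"
  shows "bool_consistent (U :: 'u itself) L {And (BigConj \<Phi>) (BigConj \<Theta>)} \<longleftrightarrow>
    bool_consistent (U :: 'u itself) L (\<Phi> \<union> \<Theta>)"
proof -
  have pair: "|{BigConj \<Phi>, BigConj \<Theta>}| \<le>o |UNIV :: 'i set|"
    using assms(3) by (intro finite_card_of_le_infinite) simp_all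
  have "bool_consistent (U :: 'u itself) L {And (BigConj \<Phi>) (BigConj \<Theta>)} \<longleftrightarrow>
      bool_consistent (U :: 'u itself) L {BigConj \<Phi>, BigConj \<Theta>}"
    unfolding And_def using lang lang_BigConj[OF assms(1), of L] lang_BigConj[OF assms(2), of L]
    by (intro bool_consistent_BigConj_iff[OF pair]) auto
  also have "\<dots> \<longleftrightarrow> bool_consistent (U :: 'u itself) L (\<Phi> \<union> \<Theta>)"
  proof -
    have "bv_model L B M \<and> range \<nu> \<subseteq> dom M \<and> (\<forall>\<phi>\<in>{BigConj \<Phi>, BigConj \<Theta>}. val B M \<phi> \<nu> = \<top>\<^bsub>B\<^esub>) \<longleftrightarrow>
        bv_model L B M \<and> range \<nu> \<subseteq> dom M \<and> (\<forall>\<phi>\<in>\<Phi> \<union> \<Theta>. val B M \<phi> \<nu> = \<top>\<^bsub>B\<^esub>)"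
      for B and M :: "('u, 'u, 'r, 'c) bv_structure" and \<nu>
      using val_BigConj_eq_top_iff[OF assms(1), of L B M \<nu>] val_BigConj_eq_top_iff[OF assms(2), of L B M \<nu>] lang
      by auto
    then show ?thesis
      by (simp only: bool_consistent_def)
  qed
  finally show ?thesis .
qed

lemma subsentences_lang:
  assumes "lang L \<psi>" "\<chi> \<in> subsentences L C \<psi>"
  shows "lang (expand L C) \<chi>"
proof -
  obtain \<phi> g where \<phi>: "\<chi> = inst \<phi> g" "\<phi> \<in> subfms \<psi>" "g ` fv \<phi> \<subseteq> csyms L \<union> C"
    using assms(2) unfolding subsentences_def by blast
  have "lang L \<phi>"
    using fm_in_subfms[OF \<phi>(2)] assms(1) unfolding lang_def .
  then show ?thesis
    using \<phi>(3) unfolding \<phi>(1) by (intro lang_subst_consts lang_expand) simp_all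
qed

text \<open>Boolean valued consequence at value \<open>1\<close>. Used as \<open>eqc\<close> and
  \<open>relc\<close> it is monotone in the condition and respects equality by the axioms of Boolean
  valued models.\<close>

definition entails ::
  "'u itself \<Rightarrow> ('r, 'c) signature \<Rightarrow> ('r, 'c, 'v, 'i) fm set \<Rightarrow> ('r, 'c, 'v, 'i) fm \<Rightarrow> bool" where
  "entails U L \<Gamma> \<chi> \<longleftrightarrow> (\<forall>B (M :: ('u, 'u, 'r, 'c) bv_structure) \<nu>. bv_model L B M \<longrightarrow>
     range \<nu> \<subseteq> dom M \<longrightarrow> (\<forall>\<phi>\<in>\<Gamma>. val B M \<phi> \<nu> = \<top>\<^bsub>B\<^esub>) \<longrightarrow> val B M \<chi> \<nu> = \<top>\<^bsub>B\<^esub>)"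

lemma entailsI:
  fixes U :: "'u itself" and L :: "('r, 'c) signature"
  assumes "\<And>B (M :: ('u, 'u, 'r, 'c) bv_structure) \<nu>.
    \<lbrakk>cba B; bv_model L B M; range \<nu> \<subseteq> dom M; \<forall>\<phi>\<in>\<Gamma>. val B M \<phi> \<nu> = \<top>\<^bsub>B\<^esub>\<rbrakk> \<Longrightarrow> val B M \<chi> \<nu> = \<top>\<^bsub>B\<^esub>"
  shows "entails U L \<Gamma> \<chi>"
  using assms bv_modelD(1) unfolding entails_def cba_def by blast

lemma entailsD:
  fixes U :: "'u itself" and L :: "('r, 'c) signature"
  assumes "entails U L \<Gamma> \<chi>" "bv_model L B (M :: ('u, 'u, 'r, 'c) bv_structure)"
    and "range \<nu> \<subseteq> dom M" "\<forall>\<phi>\<in>\<Gamma>. val B M \<phi> \<nu> = \<top>\<^bsub>B\<^esub>"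
  shows "val B M \<chi> \<nu> = \<top>\<^bsub>B\<^esub>"
  using assms unfolding entails_def by (simp only: simp_thms)

lemma entails_mono:
  fixes U :: "'u itself" and L :: "('r, 'c) signature"
  assumes "entails U L \<Gamma> \<chi>" "\<Gamma> \<subseteq> \<Delta>"
  shows "entails U L \<Delta> \<chi>"
proof (rule entailsI)
  fix B :: "'u gorder" and M :: "('u, 'u, 'r, 'c) bv_structure" and \<nu>
  assume *: "bv_model L B M" "range \<nu> \<subseteq> dom M" "\<forall>\<phi>\<in>\<Delta>. val B M \<phi> \<nu> = \<top>\<^bsub>B\<^esub>"
  then show "val B M \<chi> \<nu> = \<top>\<^bsub>B\<^esub>"
    using assms(2) by (intro entailsD[OF assms(1) *(1,2)]) blast
qed

lemma entails_refl:
  fixes U :: "'u itself" and L :: "('r, 'c) signature"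
  assumes "c \<in> csyms L"
  shows "entails U L \<Gamma> (Eq (Const c) (Const c))"
proof (rule entailsI)
  fix B :: "'u gorder" and M :: "('u, 'u, 'r, 'c) bv_structure" and \<nu>
  assume "bv_model L B M"
  from bv_modelD(6)[OF this bv_modelD(5)[OF this assms]]
  show "val B M (Eq (Const c) (Const c)) \<nu> = \<top>\<^bsub>B\<^esub>"
    by simp
qed

lemma entails_sym:
  fixes U :: "'u itself" and L :: "('r, 'c) signature"
  assumes "entails U L \<Gamma> (Eq (Const c) (Const d))" "c \<in> csyms L" "d \<in> csyms L"
  shows "entails U L \<Gamma> (Eq (Const d) (Const c))"
proof (rule entailsI)
  fix B :: "'u gorder" and M :: "('u, 'u, 'r, 'c) bv_structure" and \<nu>
  assume *: "bv_model L B M" "range \<nu> \<subseteq> dom M" "\<forall>\<phi>\<in>\<Gamma>. val B M \<phi> \<nu> = \<top>\<^bsub>B\<^esub>"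
  show "val B M (Eq (Const d) (Const c)) \<nu> = \<top>\<^bsub>B\<^esub>"
    using entailsD[OF assms(1) *] bv_modelD(7)[OF *(1) bv_modelD(5,5)[OF *(1)], of c d] assms(2,3) by simp
qed

lemma entails_trans:
  fixes U :: "'u itself" and L :: "('r, 'c) signature"
  assumes "entails U L \<Gamma> (Eq (Const b) (Const c))" "entails U L \<Gamma> (Eq (Const c) (Const d))"
    and "b \<in> csyms L" "c \<in> csyms L" "d \<in> csyms L"
  shows "entails U L \<Gamma> (Eq (Const b) (Const d))"
proof (rule entailsI)
  fix B :: "'u gorder" and M :: "('u, 'u, 'r, 'c) bv_structure" and \<nu>
  assume "cba B"
  then interpret cba B .
  assume *: "bv_model L B M" "range \<nu> \<subseteq> dom M" "\<forall>\<phi>\<in>\<Gamma>. val B M \<phi> \<nu> = \<top>\<^bsub>B\<^esub>"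
  note cl = bv_modelD(5)[OF *(1)]
  have "\<top>\<^bsub>B\<^esub> \<sqsubseteq>\<^bsub>B\<^esub> eqv M (cstv M b) (cstv M d)"
    using entailsD[OF assms(1) *] entailsD[OF assms(2) *]
    by (intro bv_model_transD[OF *(1) cl[OF assms(3)] cl[OF assms(4)] cl[OF assms(5)]]) simp_all
  then show "val B M (Eq (Const b) (Const d)) \<nu> = \<top>\<^bsub>B\<^esub>"
    using bv_modelD(3)[OF *(1) cl[OF assms(3)] cl[OF assms(5)]] by (simp add: top_le_iff)
qed

lemma entails_rel:
  fixes U :: "'u itself" and L :: "('r, 'c) signature"
  assumes "entails U L \<Gamma> (Rel R (map Const cs))" "R \<in> rsyms L" "length cs = ar L R" "length ds = ar L R"
    and "set cs \<subseteq> csyms L" "set ds \<subseteq> csyms L"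
    and eq: "\<And>i. i < ar L R \<Longrightarrow> entails U L \<Gamma> (Eq (Const (cs ! i)) (Const (ds ! i)))"
  shows "entails U L \<Gamma> (Rel R (map Const ds))"
proof (rule entailsI)
  fix B :: "'u gorder" and M :: "('u, 'u, 'r, 'c) bv_structure" and \<nu>
  assume "cba B"
  then interpret cba B .
  assume *: "bv_model L B M" "range \<nu> \<subseteq> dom M" "\<forall>\<phi>\<in>\<Gamma>. val B M \<phi> \<nu> = \<top>\<^bsub>B\<^esub>"
  have v: "val B M (Rel R (map Const es)) \<nu> = relv M R (map (cstv M) es)" for es
    by (simp add: comp_def)
  have l: "map (cstv M) es \<in> lists (dom M)" if "set es \<subseteq> csyms L" for es
    using that bv_modelD(5)[OF *(1)] by fastforce
  have "\<top>\<^bsub>B\<^esub> \<sqsubseteq>\<^bsub>B\<^esub> relv M R (map (cstv M) ds)"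
  proof (rule bv_model_relD[OF *(1) assms(2) l[OF assms(5)] l[OF assms(6)]])
    show "\<top>\<^bsub>B\<^esub> \<sqsubseteq>\<^bsub>B\<^esub> eqv M (map (cstv M) cs ! i) (map (cstv M) ds ! i)" if "i < ar L R" for i
      using entailsD[OF eq[OF that] *] assms(3,4) that by simp
    show "\<top>\<^bsub>B\<^esub> \<sqsubseteq>\<^bsub>B\<^esub> relv M R (map (cstv M) cs)"
      using entailsD[OF assms(1) *] unfolding v by simp
  qed (use assms(3,4) in simp_all)
  then show "val B M (Rel R (map Const ds)) \<nu> = \<top>\<^bsub>B\<^esub>"
    using bv_modelD(4)[OF *(1) assms(2) l[OF assms(6)]] assms(4) unfolding v by (simp add: top_le_iff)
qed

lemma entails_mem: "\<chi> \<in> \<Gamma> \<Longrightarrow> entails U L \<Gamma> \<chi>"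
  by (rule entailsI) simp

lemma not_entails_Neg:
  fixes U :: "'u itself" and L :: "('r, 'c) signature"
  assumes "bool_consistent U L \<Gamma>" "Neg \<chi> \<in> \<Gamma>"
  shows "\<not> entails U L \<Gamma> \<chi>"
proof
  assume ent: "entails U L \<Gamma> \<chi>"
  obtain B and M :: "('u, 'u, 'r, 'c) bv_structure" and \<nu>
    where M: "bv_model L B M" "range \<nu> \<subseteq> dom M" "\<forall>\<phi>\<in>\<Gamma>. val B M \<phi> \<nu> = \<top>\<^bsub>B\<^esub>"
    using bool_consistentE[OF assms(1)] .
  interpret cba B
    using bv_modelD(1)[OF M(1)] by (simp add: cba_def)
  have "bcompl B (val B M \<chi> \<nu>) = \<top>\<^bsub>B\<^esub>"
    using M(3) assms(2) by auto
  then show False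
    using entailsD[OF ent M] bottom_neq_top by simp
qed

section \<open>The consistency property of a finitely conservative family\<close>

locale conservative_family =
  fixes U :: "'u itself" and L :: "('r, 'c) signature" and \<kappa> :: "'i rel" and \<mu> :: "'l rel" and C :: "'c set"
    and I :: "'j set" and \<psi> :: "'j \<Rightarrow> ('r, 'c, 'v, 'i) fm"
    and e :: "('r, 'c, 'v, 'i) fm set set \<Rightarrow> 'u"
    and code :: "(('r, 'c, 'v, 'i) fm set \<times> 'c) set \<Rightarrow> 'u"
  assumes inj_e: "inj e" and inj_code: "inj code"
    and cardinals: "Cinfinite \<kappa>" "Cinfinite \<mu>"
    and sentences: "\<And>i. i \<in> I \<Longrightarrow> fm_in L \<kappa> \<mu> (\<psi> i)" "\<And>i. i \<in> I \<Longrightarrow> sentence (\<psi> i)"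
    and index: "|I| <o \<kappa>"
    and fresh: "C \<inter> csyms L = {}" "|C| =o \<mu>"
    and conservative: "finitely_conservative U L C I \<psi>"
begin

abbreviation LC :: "('r, 'c) signature" where
  "LC \<equiv> expand L C"

abbreviation cons :: "('r, 'c, 'v, 'i) fm set \<Rightarrow> bool" where
  "cons \<equiv> bool_consistent U LC"

text \<open>Smaller than the set of subsentences of the conjunction over \<open>u\<close>: instances
  of the conjunction itself are not added. Thus each formula in a condition comes from a single
  \<open>\<psi> i\<close>.\<close>

definition sub :: "'j set \<Rightarrow> ('r, 'c, 'v, 'i) fm set" where
  "sub u = (\<Union>i\<in>u. subsentences L C (\<psi> i))"

definition conds :: "('r, 'c, 'v, 'i) fm set set" where
  "conds = {s. finite s \<and> (\<exists>u. u \<noteq> {} \<and> finite u \<and> u \<subseteq> I \<and> s \<subseteq> sub u \<and> cons (\<psi> ` u \<union> s))}"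

lemma infinite_UNIV_i: "infinite (UNIV :: 'i set)"
  using cardinals(1) infinite_super[of "Field \<kappa>" UNIV] by (auto simp: cinfinite_def)

lemma finite_card_le: "finite \<Phi> \<Longrightarrow> |\<Phi>| \<le>o |UNIV :: 'i set|"
  using infinite_UNIV_i by (intro finite_card_of_le_infinite)

lemma card_family_le: "|\<psi> ` I| \<le>o |UNIV :: 'i set|"
proof -
  have "\<kappa> =o |Field \<kappa>|"
    using cardinals(1) by (simp add: card_of_Field_ordIso ordIso_symmetric)
  then have "\<kappa> \<le>o |UNIV :: 'i set|"
    using card_of_mono1[of "Field \<kappa>" UNIV] ordIso_ordLeq_trans by blast
  then have "|I| \<le>o |UNIV :: 'i set|"
    using index ordLess_ordLeq_trans ordLess_imp_ordLeq by blast
  then show ?thesis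
    using card_of_image ordLeq_transitive by blast
qed

lemma lang_family: "i \<in> I \<Longrightarrow> lang L (\<psi> i)"
  using sentences(1) fm_in_lang by blast

lemma lang_sub: "\<lbrakk>u \<subseteq> I; \<chi> \<in> sub u\<rbrakk> \<Longrightarrow> lang LC \<chi>"
  using subsentences_lang lang_family unfolding sub_def by blast

lemma sub_mono: "u \<subseteq> v \<Longrightarrow> sub u \<subseteq> sub v"
  unfolding sub_def by blast

lemma inst_sub:
  "\<lbrakk>i \<in> u; \<phi> \<in> subfms (\<psi> i); g ` fv \<phi> \<subseteq> csyms LC\<rbrakk> \<Longrightarrow> inst \<phi> g \<in> sub u"
  unfolding sub_def subsentences_def by auto

lemma sub_subset_subsentences:
  assumes "finite u"
  shows "sub u \<subseteq> subsentences L C (BigConj (\<psi> ` u))"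
proof -
  have "subfms (\<psi> i) \<subseteq> subfms (BigConj (\<psi> ` u))" if "i \<in> u" for i
    using subfms_BigConj[OF finite_card_le[of "\<psi> ` u"]] assms that by auto
  then show ?thesis
    unfolding sub_def subsentences_def by blast
qed

text \<open>This is where conservativity enters. It applies to \<open>s\<close> because subsentences
  of the members are subsentences of the conjunction over \<open>u\<close>.\<close>

lemma cons_mono_family:
  assumes "u \<noteq> {}" "u \<subseteq> v" "finite v" "v \<subseteq> I" "finite s" "s \<subseteq> sub u" "cons (\<psi> ` u \<union> s)"
  shows "cons (\<psi> ` v \<union> s)"
proof -
  have u: "finite u" "u \<subseteq> I"
    using assms finite_subset by blast+
  have lang: "lang LC \<phi>" if "\<phi> \<in> \<psi> ` v \<union> s" for \<phi>
    using that assms(4,6) lang_expand[OF lang_family] lang_sub[OF u(2)] by blast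
  have "s \<subseteq> subsentences L C (BigConj (\<psi> ` u))"
    using assms(6) sub_subset_subsentences[OF u(1)] by blast
  moreover have "conservative_strengthening U L C (BigConj (\<psi> ` v)) (BigConj (\<psi> ` u))"
    using conservative assms(1-4) unfolding finitely_conservative_def by blast
  ultimately have "cons {And (BigConj (\<psi> ` u)) (BigConj s)} \<longleftrightarrow> cons {And (BigConj (\<psi> ` v)) (BigConj s)}"
    using assms(5) unfolding conservative_strengthening_def by blast
  moreover have "cons {And (BigConj (\<psi> ` w)) (BigConj s)} \<longleftrightarrow> cons (\<psi> ` w \<union> s)"
    if "finite w" "w \<subseteq> v" for w
    using that lang assms(5)
    by (intro bool_consistent_And_BigConj_iff finite_card_le infinite_UNIV_i) auto
  ultimately show ?thesis
    using assms u by blast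
qed

text \<open>The finite subfamily that witnesses a condition need not contain \<open>i\<close>.
  Conservativity allows it to be enlarged by \<open>i\<close>, and then subsentences of
  \<open>\<psi> i\<close> may join the condition.\<close>

lemma condsE:
  assumes "p \<in> conds" "i \<in> I"
  obtains v where "i \<in> v" "finite v" "v \<subseteq> I" "p \<subseteq> sub v" "cons (\<psi> ` v \<union> p)"
proof -
  obtain u where u: "finite p" "u \<noteq> {}" "finite u" "u \<subseteq> I" "p \<subseteq> sub u" "cons (\<psi> ` u \<union> p)"
    using assms(1) unfolding conds_def by blast
  have "cons (\<psi> ` insert i u \<union> p)"
    using cons_mono_family[of u "insert i u" p] u assms(2) by (simp add: subset_insertI)
  then show thesis
    using that[of "insert i u"] u assms(2) sub_mono[of u "insert i u"] by blast
qed

lemma conds_insert: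
  assumes p: "p \<in> conds" and i: "i \<in> I" and X: "X \<subseteq> sub {i}"
    and step: "\<And>v. \<lbrakk>v \<subseteq> I; p \<subseteq> sub v; cons (\<psi> ` v \<union> p)\<rbrakk> \<Longrightarrow> \<exists>\<chi>\<in>X. cons (insert \<chi> (\<psi> ` v \<union> p))"
  shows "\<exists>\<chi>\<in>X. insert \<chi> p \<in> conds"
proof -
  obtain v where v: "i \<in> v" "finite v" "v \<subseteq> I" "p \<subseteq> sub v" "cons (\<psi> ` v \<union> p)"
    using condsE[OF p i] .
  obtain \<chi> where \<chi>: "\<chi> \<in> X" "cons (\<psi> ` v \<union> insert \<chi> p)"
    using step[OF v(3-5)] by auto
  have "insert \<chi> p \<subseteq> sub v"
    using v(1,4) \<chi>(1) X sub_mono[of "{i}" v] by blast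
  moreover have "finite p"
    using p by (simp add: conds_def)
  ultimately have "insert \<chi> p \<in> conds"
    using v \<chi>(2) unfolding conds_def by blast
  then show ?thesis
    using \<chi>(1) by blast
qed

lemma lang_conds:
  "\<lbrakk>v \<subseteq> I; p \<subseteq> sub v; \<phi> \<in> \<psi> ` v \<union> p\<rbrakk> \<Longrightarrow> lang LC \<phi>"
  using lang_expand[OF lang_family] lang_sub by blast

lemma conds_insert_model:
  assumes p: "p \<in> conds" and i: "i \<in> I" and X: "X \<subseteq> sub {i}"
    and step: "\<And>B (M :: ('u, 'u, 'r, 'c) bv_structure) \<nu>.
      \<lbrakk>cba B; bv_model LC B M; range \<nu> \<subseteq> dom M; \<And>\<phi>. \<phi> \<in> p \<Longrightarrow> val B M \<phi> \<nu> = \<top>\<^bsub>B\<^esub>\<rbrakk>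
      \<Longrightarrow> \<exists>\<chi>\<in>X. val B M \<chi> \<nu> \<noteq> \<bottom>\<^bsub>B\<^esub>"
  shows "\<exists>\<chi>\<in>X. insert \<chi> p \<in> conds"
  using p i X
proof (rule conds_insert)
  fix v
  assume v: "v \<subseteq> I" "p \<subseteq> sub v" "cons (\<psi> ` v \<union> p)"
  show "\<exists>\<chi>\<in>X. cons (insert \<chi> (\<psi> ` v \<union> p))"
    using v(3)
  proof (rule bool_consistent_insert)
    show "lang LC \<phi>" if "\<phi> \<in> \<psi> ` v \<union> p" for \<phi>
      using lang_conds[OF v(1,2) that] .
    show "lang LC \<chi>" if "\<chi> \<in> X" for \<chi>
      using lang_sub[of "{i}" \<chi>] i X that by blast
  qed (rule step; simp)
qed

lemma conds_insert_model1:
  assumes p: "p \<in> conds" and i: "i \<in> I" and \<chi>: "\<chi> \<in> sub {i}"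
    and step: "\<And>B (M :: ('u, 'u, 'r, 'c) bv_structure) \<nu>.
      \<lbrakk>cba B; bv_model LC B M; range \<nu> \<subseteq> dom M; \<And>\<phi>. \<phi> \<in> p \<Longrightarrow> val B M \<phi> \<nu> = \<top>\<^bsub>B\<^esub>\<rbrakk>
      \<Longrightarrow> val B M \<chi> \<nu> = \<top>\<^bsub>B\<^esub>"
  shows "insert \<chi> p \<in> conds"
proof -
  have "\<exists>\<chi>\<in>{\<chi>}. insert \<chi> p \<in> conds"
    using p i
  proof (rule conds_insert_model)
    fix B :: "'u gorder" and M :: "('u, 'u, 'r, 'c) bv_structure" and \<nu>
    assume *: "cba B" "bv_model LC B M" "range \<nu> \<subseteq> dom M" "\<And>\<phi>. \<phi> \<in> p \<Longrightarrow> val B M \<phi> \<nu> = \<top>\<^bsub>B\<^esub>"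
    then interpret cba B
      by simp
    show "\<exists>\<chi>\<in>{\<chi>}. val B M \<chi> \<nu> \<noteq> \<bottom>\<^bsub>B\<^esub>"
      using step[OF *] bottom_neq_top by simp
  qed (use \<chi> in simp)
  then show ?thesis
    by simp
qed

text \<open>Each member of \<open>p\<close> is an instance of an \<open>L\<close>-formula with fewer
  than \<open>\<mu>\<close> free variables and so uses fewer than \<open>\<mu>\<close> constants of
  \<open>C\<close>; a finite union of such sets stays below the infinite \<open>\<mu>\<close>. The
  set \<open>A\<close> is for further constants that have to be spared.\<close>

lemma fresh_constants:
  assumes "v \<subseteq> I" "finite p" "p \<subseteq> sub v" "|A| <o \<mu>"
  obtains X where "X \<subseteq> C" "|X| <o \<mu>" "A \<inter> C \<subseteq> X" "\<And>\<chi>. \<chi> \<in> p \<Longrightarrow> lang (expand L X) \<chi>"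
proof -
  have inf: "infinite (Field \<mu>)" "Card_order \<mu>"
    using cardinals(2) by (simp_all add: cinfinite_def)
  have "\<exists>X\<subseteq>C. |X| <o \<mu> \<and> (\<forall>\<chi>\<in>p. lang (expand L X) \<chi>)"
    using assms(2,3)
  proof (induction p rule: finite_induct)
    case empty
    have "|{} :: 'c set| <o \<mu>"
      using cardinals(2) by (intro finite_card_of_less) simp_all
    then show ?case
      by blast
  next
    case (insert \<chi> p)
    then obtain X where X: "X \<subseteq> C" "|X| <o \<mu>" "\<And>\<chi>. \<chi> \<in> p \<Longrightarrow> lang (expand L X) \<chi>"
      by auto
    obtain i where i: "i \<in> v" "\<chi> \<in> subsentences L C (\<psi> i)"
      using insert.prems unfolding sub_def by blast
    then obtain \<phi> g where \<phi>: "\<chi> = inst \<phi> g" "\<phi> \<in> subfms (\<psi> i)" "g ` fv \<phi> \<subseteq> csyms L \<union> C"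
      unfolding subsentences_def by blast
    have fm: "fm_in L \<kappa> \<mu> \<phi>"
      using fm_in_subfms[OF \<phi>(2)] sentences(1) i(1) assms(1) by blast
    let ?Y = "X \<union> g ` fv \<phi> \<inter> C"
    have "|g ` fv \<phi> \<inter> C| \<le>o |fv \<phi>|"
      by (meson card_of_image card_of_mono1 inf_le1 ordLeq_transitive)
    then have "|g ` fv \<phi> \<inter> C| <o \<mu>"
      using card_of_fv_less[OF fm cardinals(2)] ordLeq_ordLess_trans by blast
    then have Y: "|?Y| <o \<mu>"
      using X(2) inf by (intro card_of_Un_ordLess_infinite_Field)
    have "lang (expand L ?Y) \<chi>"
      unfolding \<phi>(1) using \<phi>(3) fm_in_lang[OF fm] by (intro lang_subst_consts lang_expand) auto
    moreover have "lang (expand L ?Y) \<chi>'" if "\<chi>' \<in> p" for \<chi>'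
      using X(3)[OF that] by (rule lang_mono) auto
    ultimately show ?case
      using X(1) Y by (intro exI[of _ ?Y]) auto
  qed
  then obtain X where X: "X \<subseteq> C" "|X| <o \<mu>" "\<And>\<chi>. \<chi> \<in> p \<Longrightarrow> lang (expand L X) \<chi>"
    by blast
  let ?Y = "X \<union> A \<inter> C"
  have "|A \<inter> C| <o \<mu>"
    using assms(4) card_of_mono1[of "A \<inter> C" A] ordLeq_ordLess_trans by blast
  then have "|?Y| <o \<mu>"
    using X(2) inf by (intro card_of_Un_ordLess_infinite_Field)
  moreover have "lang (expand L ?Y) \<chi>" if "\<chi> \<in> p" for \<chi>
    using X(3)[OF that] by (rule lang_mono) auto
  ultimately show thesis
    using that[of ?Y] X(1) by blast
qed

text \<open>Removing fewer than \<open>\<mu>\<close> elements from a set of infinite size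
  \<open>\<mu>\<close> leaves at least \<open>\<mu>\<close> of them, enough to name the variables in
  \<open>V\<close>.\<close>

lemma fresh_injection:
  assumes "|V| <o \<mu>" "|X| <o \<mu>"
  obtains k where "inj_on k V" "k ` V \<subseteq> C - X"
proof -
  have \<mu>: "infinite (Field \<mu>)" "Card_order \<mu>"
    using cardinals(2) by (simp_all add: cinfinite_def)
  have "\<not> |C - X| <o \<mu>"
  proof
    assume "|C - X| <o \<mu>"
    then have "|(C - X) \<union> X| <o \<mu>"
      using assms(2) \<mu> by (intro card_of_Un_ordLess_infinite_Field)
    then have "|C| <o \<mu>"
      using card_of_mono1[of C "(C - X) \<union> X"] ordLeq_ordLess_trans by blast
    then show False
      using fresh(2) not_ordLess_ordIso by blast
  qed
  then have "\<mu> \<le>o |C - X|"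
    using \<mu>(2) by (simp add: not_ordLess_iff_ordLeq card_order_on_well_order_on card_of_Well_order)
  then have "|V| \<le>o |C - X|"
    using assms(1) ordLess_ordLeq_trans ordLess_imp_ordLeq by blast
  then show thesis
    using that card_of_ordLeq[of V "C - X"] by blast
qed

lemma conds_witness:
  assumes p: "p \<in> conds" and i: "i \<in> I" and \<phi>: "\<phi> \<in> subfms (\<psi> i)"
    and g: "g ` (fv \<phi> - V) \<subseteq> csyms LC" and V: "|V| <o \<mu>"
    and step: "\<And>B (M :: ('u, 'u, 'r, 'c) bv_structure) \<nu>.
      \<lbrakk>cba B; bv_model LC B M; range \<nu> \<subseteq> dom M; \<And>\<phi>. \<phi> \<in> p \<Longrightarrow> val B M \<phi> \<nu> = \<top>\<^bsub>B\<^esub>\<rbrakk>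
      \<Longrightarrow> \<exists>a\<in>V \<rightarrow>\<^sub>E dom M. val B M \<phi> (override_on (\<lambda>x. cstv M (g x)) a V) \<noteq> \<bottom>\<^bsub>B\<^esub>"
  shows "\<exists>h. h ` V \<subseteq> csyms LC \<and> insert (inst \<phi> (override_on g h V)) p \<in> conds"
proof -
  let ?X = "{inst \<phi> (override_on g h V) |h. h ` V \<subseteq> csyms LC}"
  have "\<exists>\<chi>\<in>?X. insert \<chi> p \<in> conds"
    using p i
  proof (rule conds_insert)
    show "?X \<subseteq> sub {i}"
    proof clarify
      fix h
      assume "h ` V \<subseteq> csyms LC"
      then show "inst \<phi> (override_on g h V) \<in> sub {i}"
        using g by (intro inst_sub[OF _ \<phi>]) (auto simp: override_on_def)
    qed
  next
    fix v
    assume v: "v \<subseteq> I" "p \<subseteq> sub v" "cons (\<psi> ` v \<union> p)"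
    have fm: "fm_in L \<kappa> \<mu> \<phi>"
      using fm_in_subfms[OF \<phi>] sentences(1) i by blast
    have "|g ` (fv \<phi> - V)| \<le>o |fv \<phi>|"
      by (meson Diff_subset card_of_image card_of_mono1 ordLeq_transitive)
    then have "|g ` (fv \<phi> - V)| <o \<mu>"
      using card_of_fv_less[OF fm cardinals(2)] ordLeq_ordLess_trans by blast
    moreover have "finite p"
      using p by (simp add: conds_def)
    \<comment> \<open>\<open>X\<close> is also to contain the constants of \<open>C\<close> among
      the parameters \<open>g\<close>: these must keep their interpretation when the new constants
      are given a meaning.\<close>
    ultimately obtain X where X: "X \<subseteq> C" "|X| <o \<mu>" "g ` (fv \<phi> - V) \<inter> C \<subseteq> X"
        "\<And>\<chi>. \<chi> \<in> p \<Longrightarrow> lang (expand L X) \<chi>"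
      using fresh_constants[of v p] v(1,2) by blast
    obtain k where k: "inj_on k V" "k ` V \<subseteq> C - X"
      using fresh_injection[OF V X(2)] .
    obtain B and M :: "('u, 'u, 'r, 'c) bv_structure" and \<nu>
      where M: "bv_model LC B M" "range \<nu> \<subseteq> dom M" "\<forall>\<phi>\<in>\<psi> ` v \<union> p. val B M \<phi> \<nu> = \<top>\<^bsub>B\<^esub>"
      using bool_consistentE[OF v(3)] .
    have "cba B"
      using bv_modelD(1)[OF M(1)] by (simp add: cba_def)
    then have "\<exists>a\<in>V \<rightarrow>\<^sub>E dom M. val B M \<phi> (override_on (\<lambda>x. cstv M (g x)) a V) \<noteq> \<bottom>\<^bsub>B\<^esub>"
      using step[OF _ M(1,2)] M(3) by simp
    then obtain a where a: "a \<in> V \<rightarrow>\<^sub>E dom M" "val B M \<phi> (override_on (\<lambda>x. cstv M (g x)) a V) \<noteq> \<bottom>\<^bsub>B\<^esub>"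
      by blast
    have "cons (insert (inst \<phi> (override_on g k V)) (\<psi> ` v \<union> p))"
      using M(1,2)
    proof (rule bool_consistent_witness[where K = "expand L X"])
      show "lang (expand L X) \<chi> \<and> val B M \<chi> \<nu> = \<top>\<^bsub>B\<^esub>" if "\<chi> \<in> \<psi> ` v \<union> p" for \<chi>
        using M(3) that X(4) v(1) lang_expand[OF lang_family] by blast
      show "k ` V \<subseteq> csyms LC - csyms (expand L X)"
        using k(2) fresh(1) by auto
      show "lang (expand L X) \<phi>"
        using fm_in_lang[OF fm] by (rule lang_expand)
      show "g ` (fv \<phi> - V) \<subseteq> csyms (expand L X)"
        using g X(3) unfolding expand_simps by blast
    qed (use X(1) k(1) a in auto)
    moreover have "k ` V \<subseteq> csyms LC"
      using k(2) by auto
    ultimately show "\<exists>\<chi>\<in>?X. cons (insert \<chi> (\<psi> ` v \<union> p))"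
      by blast
  qed
  then show ?thesis
    by blast
qed

section \<open>The clauses of a consistency property for the conditions\<close>

abbreviation F :: "('r, 'c, 'v, 'i) fm set" where
  "F \<equiv> \<Union>(subfms ` \<psi> ` I)"

lemma val_sub_closed:
  assumes "bv_model LC B M" "range \<nu> \<subseteq> dom M" "\<chi> \<in> sub {i}" "i \<in> I"
  shows "val B M \<chi> \<nu> \<in> carrier B"
  using assms lang_sub[of "{i}" \<chi>] by (intro val_closed) auto

lemma fm_in_family: "\<lbrakk>i \<in> I; \<phi> \<in> subfms (\<psi> i)\<rbrakk> \<Longrightarrow> fm_in L \<kappa> \<mu> \<phi>"
  using fm_in_subfms sentences(1) by blast

lemma conds_neg_neg:
  assumes "p \<in> conds" "Neg (Neg \<phi>) \<in> F" "g ` fv \<phi> \<subseteq> csyms LC" "inst (Neg (Neg \<phi>)) g \<in> p"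
  shows "insert (inst \<phi> g) p \<in> conds"
proof -
  obtain i where i: "i \<in> I" "Neg (Neg \<phi>) \<in> subfms (\<psi> i)"
    using assms(2) by blast
  have s: "inst \<phi> g \<in> sub {i}"
    using assms(3) by (rule inst_sub[OF singletonI subfms.neg[OF subfms.neg[OF i(2)]]])
  show ?thesis
    using assms(1) i(1) s
  proof (rule conds_insert_model1)
    fix B :: "'u gorder" and M :: "('u, 'u, 'r, 'c) bv_structure" and \<nu>
    assume "cba B"
    then interpret cba B .
    assume M: "bv_model LC B M" "range \<nu> \<subseteq> dom M" "\<And>\<phi>. \<phi> \<in> p \<Longrightarrow> val B M \<phi> \<nu> = \<top>\<^bsub>B\<^esub>"
    have "bcompl B (bcompl B (val B M (inst \<phi> g) \<nu>)) = \<top>\<^bsub>B\<^esub>"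
      using M(3)[OF assms(4)] by simp
    then show "val B M (inst \<phi> g) \<nu> = \<top>\<^bsub>B\<^esub>"
      using val_sub_closed[OF M(1,2) s i(1)] by (simp add: bcompl_bcompl)
  qed
qed

lemma conds_conj:
  assumes "p \<in> conds" "Conj J f \<in> F" "g ` fv (Conj J f) \<subseteq> csyms LC"
    "inst (Conj J f) g \<in> p" "j \<in> J"
  shows "insert (inst (f j) g) p \<in> conds"
proof -
  obtain i where i: "i \<in> I" "Conj J f \<in> subfms (\<psi> i)"
    using assms(2) by blast
  have s: "inst (f j) g \<in> sub {i}" if "j \<in> J" for j
    using assms(3) that by (intro inst_sub[OF singletonI subfms.conj[OF i(2) that]]) auto
  show ?thesis
    using assms(1) i(1) s[OF assms(5)]
  proof (rule conds_insert_model1)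
    fix B :: "'u gorder" and M :: "('u, 'u, 'r, 'c) bv_structure" and \<nu>
    assume "cba B"
    then interpret cba B .
    assume M: "bv_model LC B M" "range \<nu> \<subseteq> dom M" "\<And>\<phi>. \<phi> \<in> p \<Longrightarrow> val B M \<phi> \<nu> = \<top>\<^bsub>B\<^esub>"
    have "(\<lambda>j. val B M (inst (f j) g) \<nu>) ` J \<subseteq> carrier B"
      using val_sub_closed[OF M(1,2) s i(1)] by (rule image_subsetI)
    then show "val B M (inst (f j) g) \<nu> = \<top>\<^bsub>B\<^esub>"
      using M(3)[OF assms(4)] assms(5) by (simp add: inf_eq_top_iff)
  qed
qed

lemma conds_neg_conj:
  assumes "p \<in> conds" "Neg (Conj J f) \<in> F" "g ` fv (Conj J f) \<subseteq> csyms LC"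
    "inst (Neg (Conj J f)) g \<in> p"
  shows "\<exists>j\<in>J. insert (inst (Neg (f j)) g) p \<in> conds"
proof -
  obtain i where i: "i \<in> I" "Neg (Conj J f) \<in> subfms (\<psi> i)"
    using assms(2) by blast
  have s: "inst (f j) g \<in> sub {i}" if "j \<in> J" for j
    using assms(3) that
    by (intro inst_sub[OF singletonI subfms.conj[OF subfms.neg[OF i(2)] that]]) auto
  have s': "inst (Neg (f j)) g \<in> sub {i}" if "j \<in> J" for j
    using assms(3) that by (intro inst_sub[OF singletonI subfms.neg_conj[OF i(2) that]]) auto
  have "\<exists>\<chi>\<in>{inst (Neg (f j)) g |j. j \<in> J}. insert \<chi> p \<in> conds"
    using assms(1) i(1)
  proof (rule conds_insert_model)
    fix B :: "'u gorder" and M :: "('u, 'u, 'r, 'c) bv_structure" and \<nu>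
    assume "cba B"
    then interpret cba B .
    assume M: "bv_model LC B M" "range \<nu> \<subseteq> dom M" "\<And>\<phi>. \<phi> \<in> p \<Longrightarrow> val B M \<phi> \<nu> = \<top>\<^bsub>B\<^esub>"
    have cl: "(\<lambda>j. val B M (inst (f j) g) \<nu>) ` J \<subseteq> carrier B"
      using val_sub_closed[OF M(1,2) s i(1)] by (rule image_subsetI)
    have "bcompl B (\<Sqinter>\<^bsub>B\<^esub> ((\<lambda>j. val B M (inst (f j) g) \<nu>) ` J)) = \<top>\<^bsub>B\<^esub>"
      using M(3)[OF assms(4)] by simp
    then have "\<Sqinter>\<^bsub>B\<^esub> ((\<lambda>j. val B M (inst (f j) g) \<nu>) ` J) \<noteq> \<top>\<^bsub>B\<^esub>"
      using bottom_neq_top by auto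
    then obtain j where j: "j \<in> J" "val B M (inst (f j) g) \<nu> \<noteq> \<top>\<^bsub>B\<^esub>"
      using inf_eq_top_iff[OF cl] by auto
    then have "val B M (inst (Neg (f j)) g) \<nu> \<noteq> \<bottom>\<^bsub>B\<^esub>"
      using cl by (simp add: bcompl_eq_bottom_iff image_subset_iff)
    with j(1) show "\<exists>\<chi>\<in>{inst (Neg (f j)) g |j. j \<in> J}. val B M \<chi> \<nu> \<noteq> \<bottom>\<^bsub>B\<^esub>"
      by blast
  qed (use s' in blast)
  then show ?thesis
    by blast
qed

lemma conds_disj:
  assumes "p \<in> conds" "Disj J f \<in> F" "g ` fv (Disj J f) \<subseteq> csyms LC"
    "inst (Disj J f) g \<in> p"
  shows "\<exists>j\<in>J. insert (inst (f j) g) p \<in> conds"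
proof -
  obtain i where i: "i \<in> I" "Disj J f \<in> subfms (\<psi> i)"
    using assms(2) by blast
  have s: "inst (f j) g \<in> sub {i}" if "j \<in> J" for j
    using assms(3) that by (intro inst_sub[OF singletonI subfms.disj[OF i(2) that]]) auto
  have "\<exists>\<chi>\<in>{inst (f j) g |j. j \<in> J}. insert \<chi> p \<in> conds"
    using assms(1) i(1)
  proof (rule conds_insert_model)
    fix B :: "'u gorder" and M :: "('u, 'u, 'r, 'c) bv_structure" and \<nu>
    assume "cba B"
    then interpret cba B .
    assume M: "bv_model LC B M" "range \<nu> \<subseteq> dom M" "\<And>\<phi>. \<phi> \<in> p \<Longrightarrow> val B M \<phi> \<nu> = \<top>\<^bsub>B\<^esub>"
    have cl: "(\<lambda>j. val B M (inst (f j) g) \<nu>) ` J \<subseteq> carrier B"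
      using val_sub_closed[OF M(1,2) s i(1)] by (rule image_subsetI)
    have "\<Squnion>\<^bsub>B\<^esub> ((\<lambda>j. val B M (inst (f j) g) \<nu>) ` J) \<noteq> \<bottom>\<^bsub>B\<^esub>"
      using M(3)[OF assms(4)] bottom_neq_top by simp
    then obtain j where "j \<in> J" "val B M (inst (f j) g) \<nu> \<noteq> \<bottom>\<^bsub>B\<^esub>"
      using sup_eq_bottom_iff[OF cl] by auto
    then show "\<exists>\<chi>\<in>{inst (f j) g |j. j \<in> J}. val B M \<chi> \<nu> \<noteq> \<bottom>\<^bsub>B\<^esub>"
      by blast
  qed (use s in blast)
  then show ?thesis
    by blast
qed

lemma conds_neg_disj:
  assumes "p \<in> conds" "Neg (Disj J f) \<in> F" "g ` fv (Disj J f) \<subseteq> csyms LC"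
    "inst (Neg (Disj J f)) g \<in> p" "j \<in> J"
  shows "insert (inst (Neg (f j)) g) p \<in> conds"
proof -
  obtain i where i: "i \<in> I" "Neg (Disj J f) \<in> subfms (\<psi> i)"
    using assms(2) by blast
  have s: "inst (f j) g \<in> sub {i}" if "j \<in> J" for j
    using assms(3) that
    by (intro inst_sub[OF singletonI subfms.disj[OF subfms.neg[OF i(2)] that]]) auto
  have s': "inst (Neg (f j)) g \<in> sub {i}"
    using assms(3,5) by (intro inst_sub[OF singletonI subfms.neg_disj[OF i(2) assms(5)]]) auto
  show ?thesis
    using assms(1) i(1) s'
  proof (rule conds_insert_model1)
    fix B :: "'u gorder" and M :: "('u, 'u, 'r, 'c) bv_structure" and \<nu>
    assume "cba B"
    then interpret cba B .
    assume M: "bv_model LC B M" "range \<nu> \<subseteq> dom M" "\<And>\<phi>. \<phi> \<in> p \<Longrightarrow> val B M \<phi> \<nu> = \<top>\<^bsub>B\<^esub>"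
    have cl: "(\<lambda>j. val B M (inst (f j) g) \<nu>) ` J \<subseteq> carrier B"
      using val_sub_closed[OF M(1,2) s i(1)] by (rule image_subsetI)
    have "bcompl B (\<Squnion>\<^bsub>B\<^esub> ((\<lambda>j. val B M (inst (f j) g) \<nu>) ` J)) = \<top>\<^bsub>B\<^esub>"
      using M(3)[OF assms(4)] by simp
    then have "val B M (inst (f j) g) \<nu> = \<bottom>\<^bsub>B\<^esub>"
      using assms(5) sup_eq_bottom_iff[OF cl] bcompl_eq_top_iff[OF sup_closed[OF cl]] by simp
    then show "val B M (inst (Neg (f j)) g) \<nu> = \<top>\<^bsub>B\<^esub>"
      by (simp add: bcompl_eq_top_iff)
  qed
qed

text \<open>Quantifiers range over functions that are extensional on \<open>V\<close>, so the values
  of the constants \<open>h\<close> are restricted to \<open>V\<close> to form such a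
  function.\<close>

lemma val_inst_override:
  assumes "bv_model LC B M"
  shows "val B M (inst \<phi> (override_on g h V)) \<nu> =
    val B M \<phi> (override_on (\<lambda>x. cstv M (g x)) (restrict (\<lambda>x. cstv M (h x)) V) V)"
  unfolding val_subst_consts by (rule val_cong_fv) (simp add: override_on_def)

lemma vals_closed:
  assumes "bv_model LC B M" "\<phi> \<in> subfms (\<psi> i)" "i \<in> I" "g ` (fv \<phi> - V) \<subseteq> csyms LC"
  shows "(\<lambda>a. val B M \<phi> (override_on (\<lambda>x. cstv M (g x)) a V)) ` (V \<rightarrow>\<^sub>E dom M) \<subseteq> carrier B"
proof (rule image_subsetI)
  fix a
  assume a: "a \<in> V \<rightarrow>\<^sub>E dom M"
  have "(\<lambda>x. cstv M (g x)) ` (fv \<phi> - V) \<subseteq> dom M"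
    using bv_modelD(5)[OF assms(1)] assms(4) by blast
  from override_on_closed[OF this a] show "val B M \<phi> (override_on (\<lambda>x. cstv M (g x)) a V) \<in> carrier B"
    by (rule val_closed[OF assms(1) lang_expand[OF fm_in_lang[OF fm_in_family[OF assms(3,2)]]]])
qed

lemma restrict_cstv:
  assumes "bv_model LC B M" "h ` V \<subseteq> csyms LC"
  shows "restrict (\<lambda>x. cstv M (h x)) V \<in> V \<rightarrow>\<^sub>E dom M"
  using bv_modelD(5)[OF assms(1)] assms(2) by (simp add: image_subset_iff del: expand_simps)

lemma conds_all:
  assumes "p \<in> conds" "All V \<phi> \<in> F" "g ` fv (All V \<phi>) \<subseteq> csyms LC"
    "inst (All V \<phi>) g \<in> p" "h ` V \<subseteq> csyms LC"
  shows "insert (inst \<phi> (override_on g h V)) p \<in> conds"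
proof -
  obtain i where i: "i \<in> I" "All V \<phi> \<in> subfms (\<psi> i)"
    using assms(2) by blast
  have \<phi>: "\<phi> \<in> subfms (\<psi> i)"
    using i(2) by (rule subfms.all)
  have s: "inst \<phi> (override_on g h V) \<in> sub {i}"
    using assms(3,5) by (intro inst_sub[OF singletonI \<phi>]) (auto simp: override_on_def)
  show ?thesis
    using assms(1) i(1) s
  proof (rule conds_insert_model1)
    fix B :: "'u gorder" and M :: "('u, 'u, 'r, 'c) bv_structure" and \<nu>
    assume "cba B"
    then interpret cba B .
    assume M: "bv_model LC B M" "range \<nu> \<subseteq> dom M" "\<And>\<phi>. \<phi> \<in> p \<Longrightarrow> val B M \<phi> \<nu> = \<top>\<^bsub>B\<^esub>"
    \<comment> \<open>Moving from the instance to the assignment given by the constants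
      \<open>g\<close> avoids shielded substitutions under the quantifier.\<close>
    have "val B M (All V \<phi>) (\<lambda>x. cstv M (g x)) = \<top>\<^bsub>B\<^esub>"
      using M(3)[OF assms(4)] unfolding val_subst_consts .
    then have "\<forall>a\<in>V \<rightarrow>\<^sub>E dom M. val B M \<phi> (override_on (\<lambda>x. cstv M (g x)) a V) = \<top>\<^bsub>B\<^esub>"
      using inf_eq_top_iff[OF vals_closed[OF M(1) \<phi> i(1), of g V]] assms(3) by simp
    then show "val B M (inst \<phi> (override_on g h V)) \<nu> = \<top>\<^bsub>B\<^esub>"
      using restrict_cstv[OF M(1) assms(5)] unfolding val_inst_override[OF M(1)] by blast
  qed
qed

lemma conds_neg_ex:
  assumes "p \<in> conds" "Neg (Ex V \<phi>) \<in> F" "g ` fv (Ex V \<phi>) \<subseteq> csyms LC"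
    "inst (Neg (Ex V \<phi>)) g \<in> p" "h ` V \<subseteq> csyms LC"
  shows "insert (inst (Neg \<phi>) (override_on g h V)) p \<in> conds"
proof -
  obtain i where i: "i \<in> I" "Neg (Ex V \<phi>) \<in> subfms (\<psi> i)"
    using assms(2) by blast
  have \<phi>: "\<phi> \<in> subfms (\<psi> i)" "Neg \<phi> \<in> subfms (\<psi> i)"
    using subfms.ex[OF subfms.neg[OF i(2)]] subfms.neg_ex[OF i(2)] .
  have s: "inst (Neg \<phi>) (override_on g h V) \<in> sub {i}"
    using assms(3,5) by (intro inst_sub[OF singletonI \<phi>(2)]) (auto simp: override_on_def)
  show ?thesis
    using assms(1) i(1) s
  proof (rule conds_insert_model1)
    fix B :: "'u gorder" and M :: "('u, 'u, 'r, 'c) bv_structure" and \<nu>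
    assume "cba B"
    then interpret cba B .
    assume M: "bv_model LC B M" "range \<nu> \<subseteq> dom M" "\<And>\<phi>. \<phi> \<in> p \<Longrightarrow> val B M \<phi> \<nu> = \<top>\<^bsub>B\<^esub>"
    note cl = vals_closed[OF M(1) \<phi>(1) i(1), of g V]
    have "val B M (Neg (Ex V \<phi>)) (\<lambda>x. cstv M (g x)) = \<top>\<^bsub>B\<^esub>"
      using M(3)[OF assms(4)] unfolding val_subst_consts .
    then have "\<forall>a\<in>V \<rightarrow>\<^sub>E dom M. val B M \<phi> (override_on (\<lambda>x. cstv M (g x)) a V) = \<bottom>\<^bsub>B\<^esub>"
      using sup_eq_bottom_iff[OF cl] bcompl_eq_top_iff[OF sup_closed[OF cl]] assms(3) by simp
    then have "val B M (inst \<phi> (override_on g h V)) \<nu> = \<bottom>\<^bsub>B\<^esub>"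
      using restrict_cstv[OF M(1) assms(5)] unfolding val_inst_override[OF M(1)] by blast
    then show "val B M (inst (Neg \<phi>) (override_on g h V)) \<nu> = \<top>\<^bsub>B\<^esub>"
      by (simp add: bcompl_eq_top_iff)
  qed
qed

lemma conds_ex:
  assumes "p \<in> conds" "Ex V \<phi> \<in> F" "g ` fv (Ex V \<phi>) \<subseteq> csyms LC"
    "inst (Ex V \<phi>) g \<in> p"
  shows "\<exists>h. h ` V \<subseteq> csyms LC \<and> insert (inst \<phi> (override_on g h V)) p \<in> conds"
proof -
  obtain i where i: "i \<in> I" "Ex V \<phi> \<in> subfms (\<psi> i)"
    using assms(2) by blast
  have \<phi>: "\<phi> \<in> subfms (\<psi> i)"
    using i(2) by (rule subfms.ex)
  have g: "g ` (fv \<phi> - V) \<subseteq> csyms LC" and V: "|V| <o \<mu>"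
    using assms(3) fm_in_family[OF i] by simp_all
  show ?thesis
    using assms(1) i(1) \<phi> g V
  proof (rule conds_witness)
    fix B :: "'u gorder" and M :: "('u, 'u, 'r, 'c) bv_structure" and \<nu>
    assume "cba B"
    then interpret cba B .
    assume M: "bv_model LC B M" "range \<nu> \<subseteq> dom M" "\<And>\<phi>. \<phi> \<in> p \<Longrightarrow> val B M \<phi> \<nu> = \<top>\<^bsub>B\<^esub>"
    note cl = vals_closed[OF M(1) \<phi> i(1) g]
    have "val B M (Ex V \<phi>) (\<lambda>x. cstv M (g x)) = \<top>\<^bsub>B\<^esub>"
      using M(3)[OF assms(4)] unfolding val_subst_consts .
    then show "\<exists>a\<in>V \<rightarrow>\<^sub>E dom M. val B M \<phi> (override_on (\<lambda>x. cstv M (g x)) a V) \<noteq> \<bottom>\<^bsub>B\<^esub>"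
      using sup_eq_bottom_iff[OF cl] bottom_neq_top by auto
  qed
qed

lemma conds_neg_all:
  assumes "p \<in> conds" "Neg (All V \<phi>) \<in> F" "g ` fv (All V \<phi>) \<subseteq> csyms LC"
    "inst (Neg (All V \<phi>)) g \<in> p"
  shows "\<exists>h. h ` V \<subseteq> csyms LC \<and> insert (inst (Neg \<phi>) (override_on g h V)) p \<in> conds"
proof -
  obtain i where i: "i \<in> I" "Neg (All V \<phi>) \<in> subfms (\<psi> i)"
    using assms(2) by blast
  have \<phi>: "\<phi> \<in> subfms (\<psi> i)" "Neg \<phi> \<in> subfms (\<psi> i)"
    using subfms.all[OF subfms.neg[OF i(2)]] subfms.neg_all[OF i(2)] .
  have g: "g ` (fv \<phi> - V) \<subseteq> csyms LC" and V: "|V| <o \<mu>"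
    using assms(3) fm_in_family[OF i] by simp_all
  have g': "g ` (fv (Neg \<phi>) - V) \<subseteq> csyms LC"
    using g by simp
  show ?thesis
    using assms(1) i(1) \<phi>(2) g' V
  proof (rule conds_witness)
    fix B :: "'u gorder" and M :: "('u, 'u, 'r, 'c) bv_structure" and \<nu>
    assume "cba B"
    then interpret cba B .
    assume M: "bv_model LC B M" "range \<nu> \<subseteq> dom M" "\<And>\<phi>. \<phi> \<in> p \<Longrightarrow> val B M \<phi> \<nu> = \<top>\<^bsub>B\<^esub>"
    note cl = vals_closed[OF M(1) \<phi>(1) i(1) g]
    have "val B M (Neg (All V \<phi>)) (\<lambda>x. cstv M (g x)) = \<top>\<^bsub>B\<^esub>"
      using M(3)[OF assms(4)] unfolding val_subst_consts .
    then have "val B M (All V \<phi>) (\<lambda>x. cstv M (g x)) \<noteq> \<top>\<^bsub>B\<^esub>"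
      using bottom_neq_top by auto
    then obtain a where a: "a \<in> V \<rightarrow>\<^sub>E dom M" "val B M \<phi> (override_on (\<lambda>x. cstv M (g x)) a V) \<noteq> \<top>\<^bsub>B\<^esub>"
      using inf_eq_top_iff[OF cl] by auto
    then have "val B M (Neg \<phi>) (override_on (\<lambda>x. cstv M (g x)) a V) \<noteq> \<bottom>\<^bsub>B\<^esub>"
      using cl by (simp add: bcompl_eq_bottom_iff image_subset_iff)
    with a(1) show "\<exists>a\<in>V \<rightarrow>\<^sub>E dom M. val B M (Neg \<phi>) (override_on (\<lambda>x. cstv M (g x)) a V) \<noteq> \<bottom>\<^bsub>B\<^esub>"
      by blast
  qed
qed

text \<open>Once the witnessing subfamily contains \<open>i\<close>, its models give
  \<open>\<psi> i\<close> the value \<open>1\<close>. The instance has the same value but may be a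
  different formula: substitution also acts on members of an indexed connective outside its index
  set.\<close>

lemma conds_family:
  assumes "p \<in> conds" "i \<in> I"
  shows "insert (inst (\<psi> i) g) p \<in> conds"
proof -
  have s: "inst (\<psi> i) g \<in> sub {i}"
    using sentences(2)[OF assms(2)] by (intro inst_sub[OF singletonI subfms.self]) (simp add: sentence_def)
  obtain v where v: "i \<in> v" "finite v" "v \<subseteq> I" "p \<subseteq> sub v" "cons (\<psi> ` v \<union> p)"
    using condsE[OF assms] .
  have "cons (insert (inst (\<psi> i) g) (\<psi> ` v \<union> p))"
    using v(5)
  proof (rule bool_consistent_insert1)
    show "lang LC \<phi>" if "\<phi> \<in> \<psi> ` v \<union> p" for \<phi>
      using lang_conds[OF v(3,4) that] .
    show "lang LC (inst (\<psi> i) g)"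
      using lang_sub[of "{i}"] s assms(2) by simp
    fix B :: "'u gorder" and M :: "('u, 'u, 'r, 'c) bv_structure" and \<nu>
    assume "\<And>\<phi>. \<phi> \<in> \<psi> ` v \<union> p \<Longrightarrow> val B M \<phi> \<nu> = \<top>\<^bsub>B\<^esub>"
    then have "val B M (\<psi> i) \<nu> = \<top>\<^bsub>B\<^esub>"
      using v(1) by simp
    then show "val B M (inst (\<psi> i) g) \<nu> = \<top>\<^bsub>B\<^esub>"
      unfolding val_subst_consts using val_sentence[OF sentences(2)[OF assms(2)]] by metis
  qed
  moreover have "insert (inst (\<psi> i) g) p \<subseteq> sub v"
    using s v(1,4) sub_mono[of "{i}" v] by blast
  moreover have "finite (insert (inst (\<psi> i) g) p)"
    using assms(1) by (simp add: conds_def)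
  ultimately show ?thesis
    using v(1-3) unfolding conds_def by (intro CollectI conjI exI[of _ v]) auto
qed

lemma cons_conds: "p \<in> conds \<Longrightarrow> cons p"
  unfolding conds_def by (blast intro: bool_consistent_mono)

lemma empty_conds: "{} \<in> conds"
proof -
  obtain i where i: "i \<in> I" "bool_consistent U L {\<psi> i}"
    using conservative unfolding finitely_conservative_def by blast
  then have "cons (\<psi> ` {i} \<union> {})"
    using bool_consistent_expand[OF i(2)] lang_family by simp
  then show ?thesis
    using i(1) unfolding conds_def by (intro CollectI conjI exI[of _ "{i}"]) simp_all
qed

text \<open>The clauses for negated atoms hold because a condition is consistent and cannot entail a
  formula whose negation it contains. The laws for \<open>eqc\<close> and \<open>relc\<close> are
  those of Boolean valued models.\<close>

lemma consistency_property_conds: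
  "consistency_property conds e code LC (\<psi> ` I)
    (\<lambda>p c d. entails U LC p (Eq (Const c) (Const d))) (\<lambda>p R cs. entails U LC p (Rel R (map Const cs)))"
proof
  have neg: "\<not> entails U LC p \<chi>" if "p \<in> conds" "Neg \<chi> \<in> p" for p \<chi>
    using that by (intro not_entails_Neg[OF cons_conds])
  show "\<not> entails U LC p (Eq (Const c) (Const d))" if "p \<in> conds" "Neg (Eq (Const c) (Const d)) \<in> p" for p c d
    using that by (rule neg)
  show "\<not> entails U LC p (Rel R (map Const cs))" if "p \<in> conds" "Neg (Rel R (map Const cs)) \<in> p" for p R cs
    using that by (rule neg)
  show "conds \<noteq> {}"
    using empty_conds by blast
  \<comment> \<open>\<open>L\<close> may have no constants at all; \<open>C\<close> is non-empty
    because its size \<open>\<mu>\<close> is infinite.\<close>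
  show "csyms LC \<noteq> {}"
    using cardinals(2) fresh(2) by (auto simp: cinfinite_def dest!: card_of_ordIso_finite_Field[OF _ ordIso_symmetric])
  show "lang LC \<chi>" if "\<chi> \<in> \<psi> ` I" for \<chi>
    using that lang_expand[OF lang_family] by blast
qed (fact inj_e inj_code conds_neg_neg conds_conj conds_neg_conj conds_disj conds_neg_disj conds_all
    conds_neg_all conds_ex conds_neg_ex entails_mono entails_refl entails_sym entails_trans entails_rel
    entails_mem | rule entails_mem, assumption)+

text \<open>In the model on the names of constants every \<open>\<psi> i\<close> has value
  \<open>1\<close> by density, while \<open>s\<close> forces its own members. The meet of their
  values is non-zero, having \<open>s\<close> itself as an element, and cutting the algebra down to
  it gives all of them the value \<open>1\<close>.\<close>

lemma cons_family_Un_condition: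
  assumes s: "s \<in> conds"
  shows "cons (\<psi> ` I \<union> s)"
proof -
  interpret G: consistency_property conds e code LC "\<psi> ` I"
    "\<lambda>p c d. entails U LC p (Eq (Const c) (Const d))" "\<lambda>p R cs. entails U LC p (Rel R (map Const cs))"
    by (rule consistency_property_conds)
  interpret B: cba G.alg
    by (simp add: cba_def G.complete_boolean_algebra_alg)
  let ?M = "G.model (G.hat ` csyms LC)"
  note ad = G.adequate_hats
  have M: "bv_model LC G.alg ?M"
    using ad by (intro G.bv_model_model) (simp_all only: G.adequate_def)
  obtain m where m: "m \<in> dom ?M"
    using bv_modelD(2)[OF M] by blast
  have \<nu>: "range (\<lambda>x :: 'v. m) \<subseteq> dom ?M"
    using m by blast
  have family: "val G.alg ?M (\<psi> i) (\<lambda>x. m) = \<top>\<^bsub>G.alg\<^esub>" if i: "i \<in> I" for i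
    using i subfms.self by (intro G.val_eq_top[OF ad _ sentences(2)[OF i] \<nu> conds_family]) blast+
  have cond: "s \<in> G.dec (val G.alg ?M \<chi> (\<lambda>x. m))" if \<chi>: "\<chi> \<in> s" for \<chi>
  proof -
    obtain i \<phi> g where \<phi>: "i \<in> I" "\<phi> \<in> subfms (\<psi> i)" "g ` fv \<phi> \<subseteq> csyms L \<union> C" "\<chi> = inst \<phi> g"
      using s \<chi> unfolding conds_def sub_def subsentences_def by blast
    have "(\<lambda>x. cstv ?M (g x)) ` fv \<phi> \<subseteq> dom ?M"
      using bv_modelD(5)[OF M] \<phi>(3) by auto
    then have "s \<in> G.dec (val G.alg ?M \<phi> (\<lambda>x. cstv ?M (g x)))"
      using \<phi>(1,2,4) \<chi> s by (intro G.truth(1)[OF ad s, where g = g]) (auto simp: G.hat_def)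
    then show ?thesis
      by (simp only: \<phi>(4) val_subst_consts)
  qed
  have lang: "lang LC \<phi>" if "\<phi> \<in> \<psi> ` I \<union> s" for \<phi>
    using that s lang_expand[OF lang_family] lang_sub unfolding conds_def by blast
  let ?v = "(\<lambda>\<chi>. val G.alg ?M \<chi> (\<lambda>x. m)) ` s"
  have v: "?v \<subseteq> carrier G.alg"
    using lang m by (intro image_subsetI val_closed[OF M]) auto
  have "s \<in> G.dec (\<Sqinter>\<^bsub>G.alg\<^esub> ?v)"
    unfolding G.dec_inf[OF v] using s cond by blast
  then have "\<Sqinter>\<^bsub>G.alg\<^esub> ?v \<noteq> \<bottom>\<^bsub>G.alg\<^esub>"
    by (auto simp: G.bottom_alg)
  with M \<nu> B.inf_closed[OF v] show ?thesis
  proof (rule bool_consistentI_nonzero)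
    fix \<phi>
    assume \<phi>: "\<phi> \<in> \<psi> ` I \<union> s"
    then consider i where "\<phi> = \<psi> i" "i \<in> I" | "\<phi> \<in> s"
      by blast
    then have "\<Sqinter>\<^bsub>G.alg\<^esub> ?v \<sqsubseteq>\<^bsub>G.alg\<^esub> val G.alg ?M \<phi> (\<lambda>x. m)"
    proof cases
      case 1
      show ?thesis
        unfolding 1(1) family[OF 1(2)] by (rule B.top_higher[OF B.inf_closed[OF v]])
    qed (rule B.inf_lower[OF v]; simp)
    with lang[OF \<phi>] show "lang LC \<phi> \<and> \<Sqinter>\<^bsub>G.alg\<^esub> ?v \<sqsubseteq>\<^bsub>G.alg\<^esub> val G.alg ?M \<phi> (\<lambda>x. m)" ..
  qed
qed

section \<open>Consistency, conservativity and mixing for the whole family\<close>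

lemma card_image_le: "finite u \<Longrightarrow> |\<psi> ` u| \<le>o |UNIV :: 'i set|"
  by (rule finite_card_le) simp

lemma consistent_family: "bool_consistent U L {BigConj (\<psi> ` I)}"
proof -
  have "cons (\<psi> ` I)"
    using cons_family_Un_condition[OF empty_conds] by simp
  then obtain B and M :: "('u, 'u, 'r, 'c) bv_structure" and \<nu> :: "'v \<Rightarrow> 'u"
    where M: "bv_model LC B M" "range \<nu> \<subseteq> dom M" "\<forall>\<phi>\<in>\<psi> ` I. val B M \<phi> \<nu> = \<top>\<^bsub>B\<^esub>"
    by (rule bool_consistentE)
  have "bool_consistent U L (\<psi> ` I)"
    unfolding bool_consistent_def using bv_model_reduct[OF M(1)] M(2,3)
    by (intro exI[of _ B] exI[of _ M] exI[of _ \<nu>]) simp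
  then show ?thesis
    using lang_family by (subst bool_consistent_BigConj_iff[OF card_family_le]) auto
qed

lemma conservative_strengthening_family:
  assumes u: "u \<noteq> {}" "finite u" "u \<subseteq> I"
  shows "conservative_strengthening U L C (BigConj (\<psi> ` I)) (BigConj (\<psi> ` u))"
  unfolding conservative_strengthening_def
proof (intro conjI allI impI)
  show "provable L {BigConj (\<psi> ` I)} {BigConj (\<psi> ` u)}"
    using u(3) lang_family by (intro provable_BigConj_subset[OF card_family_le]) auto
next
  fix s
  assume s: "finite s" "s \<subseteq> subsentences L C (BigConj (\<psi> ` u))"
  have lang_u: "lang L (BigConj (\<psi> ` u))"
    using u(3) lang_family by (auto simp: lang_BigConj[OF card_image_le[OF u(2)]])
  have lang_s: "lang LC \<chi>" if "\<chi> \<in> s" for \<chi>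
    using subsentences_lang[OF lang_u] s(2) that by blast
  have lang: "lang LC \<phi>" if "\<phi> \<in> \<psi> ` I \<union> s" for \<phi>
    using that lang_s lang_expand[OF lang_family] by blast
  have "cons (\<psi> ` u \<union> s) \<longleftrightarrow> cons (\<psi> ` I \<union> s)"
  proof
    assume cons: "cons (\<psi> ` u \<union> s)"
    \<comment> \<open>Members of \<open>s\<close> may be instances of the conjunction over
      \<open>u\<close> itself and then need not lie in \<open>sub u\<close>. They are set aside here
      and recovered afterwards, since they hold in every model of the family.\<close>
    have "cons (\<psi> ` u \<union> s \<inter> sub u)"
      using cons by (rule bool_consistent_mono) blast
    then have "s \<inter> sub u \<in> conds"
      using u s(1) unfolding conds_def by (intro CollectI conjI exI[of _ u]) simp_all
    then have "cons (\<psi> ` I \<union> s \<inter> sub u)"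
      by (rule cons_family_Un_condition)
    then obtain B and M :: "('u, 'u, 'r, 'c) bv_structure" and \<nu> :: "'v \<Rightarrow> 'u"
      where M: "bv_model LC B M" "range \<nu> \<subseteq> dom M" "\<forall>\<phi>\<in>\<psi> ` I \<union> s \<inter> sub u. val B M \<phi> \<nu> = \<top>\<^bsub>B\<^esub>"
      by (rule bool_consistentE)
    \<comment> \<open>All assignments are needed, because an instance is evaluated at the values of
      its constants and not at \<open>\<nu>\<close>.\<close>
    have top_u: "val B M (BigConj (\<psi> ` u)) \<nu>' = \<top>\<^bsub>B\<^esub>" for \<nu>'
    proof -
      have "val B M (BigConj (\<psi> ` u)) \<nu> = \<top>\<^bsub>B\<^esub>"
        using M(3) u(3) lang
        by (subst val_BigConj_eq_top_iff[OF card_image_le[OF u(2)] M(1,2)]) auto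
      moreover have "sentence (BigConj (\<psi> ` u))"
        using sentences(2) u(3) unfolding sentence_def fv_BigConj[OF card_image_le[OF u(2)]] by blast
      ultimately show ?thesis
        using val_sentence by metis
    qed
    have "val B M \<chi> \<nu> = \<top>\<^bsub>B\<^esub>" if \<chi>: "\<chi> \<in> s" for \<chi>
    proof (cases "\<chi> \<in> sub u")
      case False
      obtain \<phi> g where \<phi>: "\<phi> \<in> subfms (BigConj (\<psi> ` u))" "g ` fv \<phi> \<subseteq> csyms L \<union> C" "\<chi> = inst \<phi> g"
        using s(2) \<chi> unfolding subsentences_def by blast
      have "\<phi> \<notin> (\<Union>\<phi>\<in>\<psi> ` u. subfms \<phi>)"
        using False \<phi>(2,3) inst_sub[of _ u \<phi> g] by auto
      then have "\<phi> = BigConj (\<psi> ` u)"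
        using \<phi>(1) unfolding subfms_BigConj[OF card_image_le[OF u(2)]] by blast
      then show ?thesis
        using top_u by (simp only: \<phi>(3) val_subst_consts)
    qed (use M(3) \<chi> in blast)
    then show "cons (\<psi> ` I \<union> s)"
      unfolding bool_consistent_def using M by (intro exI[of _ B] exI[of _ M] exI[of _ \<nu>]) auto
  next
    assume "cons (\<psi> ` I \<union> s)"
    then show "cons (\<psi> ` u \<union> s)"
      by (rule bool_consistent_mono) (use u(3) in blast)
  qed
  moreover have "cons {And (BigConj (\<psi> ` u)) (BigConj s)} \<longleftrightarrow> cons (\<psi> ` u \<union> s)"
    using lang u(3) by (intro bool_consistent_And_BigConj_iff card_image_le[OF u(2)]
        finite_card_le[OF s(1)] infinite_UNIV_i) auto
  moreover have "cons {And (BigConj (\<psi> ` I)) (BigConj s)} \<longleftrightarrow> cons (\<psi> ` I \<union> s)"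
    using lang by (intro bool_consistent_And_BigConj_iff card_family_le
        finite_card_le[OF s(1)] infinite_UNIV_i) auto
  ultimately show "cons {And (BigConj (\<psi> ` u)) (BigConj s)} \<longleftrightarrow> cons {And (BigConj (\<psi> ` I)) (BigConj s)}"
    by simp
qed

text \<open>When all quantified sets are finite, the set of all names is an adequate domain. Mixing
  concerns only the domain and the equality, so it survives when the constants in \<open>C\<close>
  are forgotten.\<close>

lemma mixing_model_family:
  assumes fin: "\<And>i. i \<in> I \<Longrightarrow> fm_inf L natLeq (\<psi> i)"
  shows "has_mixing_model U L (BigConj (\<psi> ` I))"
proof -
  interpret G: consistency_property conds e code LC "\<psi> ` I"
    "\<lambda>p c d. entails U LC p (Eq (Const c) (Const d))" "\<lambda>p R cs. entails U LC p (Rel R (map Const cs))"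
    by (rule consistency_property_conds)
  let ?M = "G.model G.names"
  have ad: "G.adequate G.names"
  proof (rule G.adequate_names)
    fix V \<phi>
    assume V: "All V \<phi> \<in> \<Union>(subfms ` \<psi> ` I) \<or> Ex V \<phi> \<in> \<Union>(subfms ` \<psi> ` I)"
    then obtain i where i: "i \<in> I" "All V \<phi> \<in> subfms (\<psi> i) \<or> Ex V \<phi> \<in> subfms (\<psi> i)"
      by blast
    obtain \<kappa>' :: "('i + nat) set rel" where "fm_in L \<kappa>' natLeq (\<psi> i)"
      using fin[OF i(1)] unfolding fm_inf_def by blast
    then have "|V| <o natLeq"
      using i(2) fm_in_subfms[of "All V \<phi>" "\<psi> i" L \<kappa>' natLeq] fm_in_subfms[of "Ex V \<phi>" "\<psi> i" L \<kappa>' natLeq]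
      by auto
    then show "finite V"
      using infinite_iff_natLeq_ordLeq[of V] not_ordLess_ordLeq by blast
  qed
  have M: "bv_model LC G.alg ?M"
    using ad by (intro G.bv_model_model) (simp_all only: G.adequate_def)
  have "val G.alg ?M (BigConj (\<psi> ` I)) \<nu> = \<top>\<^bsub>G.alg\<^esub>" if \<nu>: "range \<nu> \<subseteq> dom ?M" for \<nu>
  proof -
    have "val G.alg ?M (\<psi> i) \<nu> = \<top>\<^bsub>G.alg\<^esub>" if i: "i \<in> I" for i
      using i subfms.self by (intro G.val_eq_top[OF ad _ sentences(2)[OF i] \<nu> conds_family]) blast+
    then show ?thesis
      using lang_expand[OF lang_family]
      by (subst val_BigConj_eq_top_iff[OF card_family_le M \<nu>]) auto
  qed
  then show ?thesis
    unfolding has_mixing_model_def using bv_model_reduct[OF M] G.mixing_names by blast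
qed

end

text \<open>A pair \<open>(p, c)\<close> is coded by the set that consists of the negations of \<open>p\<close> and of \<open>c = c\<close>.\<close>

lemma encodings:
  assumes "|UNIV :: ('r, 'c, 'v, 'i) fm set set set set| \<le>o |UNIV :: 'u set|"
  obtains e :: "('r, 'c, 'v, 'i) fm set set \<Rightarrow> 'u" and code :: "(('r, 'c, 'v, 'i) fm set \<times> 'c) set \<Rightarrow> 'u"
  where "inj e" "inj code"
proof -
  obtain f :: "('r, 'c, 'v, 'i) fm set set set \<Rightarrow> 'u" where f: "inj f"
    using assms card_of_ordLeq[of "UNIV :: ('r, 'c, 'v, 'i) fm set set set set" "UNIV :: 'u set"] by blast
  define j :: "('r, 'c, 'v, 'i) fm set \<times> 'c \<Rightarrow> ('r, 'c, 'v, 'i) fm set" where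
    "j = (\<lambda>(p, c). insert (Eq (Const c) (Const c)) (Neg ` p))"
  have j_Neg: "{\<phi>. Neg \<phi> \<in> j (p, c)} = p" and j_Eq: "{d. Eq (Const d) (Const d) \<in> j (p, c)} = {c}" for p c
    by (auto simp: j_def)
  have "inj j"
  proof (rule injI)
    fix x y
    assume xy: "j x = j y"
    have "fst x = fst y"
      using j_Neg[of "fst x" "snd x"] j_Neg[of "fst y" "snd y"] xy by simp
    moreover have "{snd x} = {snd y}"
      using j_Eq[of "fst x" "snd x"] j_Eq[of "fst y" "snd y"] xy by (simp only: prod.collapse)
    ultimately show "x = y"
      by (simp add: prod_eq_iff)
  qed
  \<comment> \<open>The singletons raise both kinds of sets to the type on which \<open>f\<close> is
    defined, so one injection serves for \<open>e\<close> and for \<open>code\<close>.\<close>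
  then have "inj (\<lambda>\<tau>. f {j ` \<tau>})"
    using f by (intro injI) (auto simp: inj_eq inj_image_eq_iff)
  moreover have "inj (\<lambda>X. f {X})"
    using f by (intro injI) (simp add: inj_eq)
  ultimately show thesis
    using that by blast
qed

theorem theorem1:
  fixes L :: "('r, 'c) signature"
    and \<kappa> :: "'i rel"
    and \<mu> :: "'l rel"
    and C :: "'c set"
    and I :: "'j set"
    and \<psi> :: "'j \<Rightarrow> ('r, 'c, 'v, 'i) fm"
  assumes universe:
      "|UNIV :: ('r, 'c, 'v, 'i) fm set set set set| \<le>o |UNIV :: 'u set|"
    and cardinals: "Cinfinite \<kappa>" "Cinfinite \<mu>"
    and sentences: "\<forall>i\<in>I. fm_in L \<kappa> \<mu> (\<psi> i) \<and> sentence (\<psi> i)"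
    and index: "|I| <o \<kappa>"
    and fresh: "C \<inter> csyms L = {}" "|C| =o \<mu>"
    and conservative: "finitely_conservative TYPE('u) L C I \<psi>"
  shows "bool_consistent TYPE('u) L {BigConj (\<psi> ` I)} \<and>
    (\<forall>u. u \<noteq> {} \<longrightarrow> finite u \<longrightarrow> u \<subseteq> I \<longrightarrow>
       conservative_strengthening TYPE('u) L C (BigConj (\<psi> ` I)) (BigConj (\<psi> ` u))) \<and>
    ((\<forall>i\<in>I. fm_inf L natLeq (\<psi> i)) \<longrightarrow>
       has_mixing_model TYPE('u) L (BigConj (\<psi> ` I)))"
proof -
  obtain e :: "('r, 'c, 'v, 'i) fm set set \<Rightarrow> 'u" and code :: "(('r, 'c, 'v, 'i) fm set \<times> 'c) set \<Rightarrow> 'u"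
    where "inj e" "inj code"
    using encodings[OF universe] .
  then interpret conservative_family "TYPE('u)" L \<kappa> \<mu> C I \<psi> e code
    using assms by unfold_locales auto
  show ?thesis
    using consistent_family conservative_strengthening_family mixing_model_family by blast
qed

end
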